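(* Fix an integer $d\ge3$, $\nu>0$ and $u\in(0,1)$, and let $\gamma_n=\frac{n}{2\vartheta_{d,\nu}}$. Then for every $T>0$, $$\frac{\gamma_n}{n}\int_0^T\mathcal D_{\gamma_n s}\,{\rm d}s-\int_0^T\mathcal O_{\gamma_n s}\big(1-\mathcal O_{\gamma_n s}\big)\,{\rm d}s\longrightarrow0$$ in probability under $\mathbb P_{\mu_d,u}$ as $n\to\infty$.
   Context: Graphs: each vertex $x\in[n]$ carries $d$ stubs $\sigma_{x,1},\dots,\sigma_{x,d}$; a graph is a perfect matching of the $dn$ stubs ($dn$ even); $\mathcal G_n(d)$ is the set of such matchings, $\mu_d$ the uniform distribution on it, ${\rm v}_G(x,i)$ the vertex owning the stub matched to $\sigma_{x,i}$ in $G$. Rewiring dynamics $(G_t)$: for each ordered pair of distinct stubs $(\sigma_{x,i},\sigma_{y,j})$ not matched to each other, at rate $\frac\nu4\cdot\frac1{dn-1}$ the edges $\{\sigma_{x,i},\sigma_{z,k}\},\{\sigma_{y,j},\sigma_{v,\ell}\}$ are replaced by $\{\sigma_{x,i},\sigma_{y,j}\},\{\sigma_{z,k},\sigma_{v,\ell}\}$. Voter model: $(G_t,\eta_t)$ with $G_t$ following the rewiring dynamics and, for each $x$ and $1\le i\le d$, at rate $1/d$ the opinion $\eta(x)$ is replaced by $\eta({\rm v}_{G_t}(x,i))$. $\mathbb P_{\mu_d,u}$: $G_0\sim\mu_d$ and independently $\eta_0$ i.i.d. Bernoulli$(u)$. Observables: $\mathcal O_t=\frac1n\sum_x\eta_t(x)$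 and $\mathcal D_t=\frac{2}{dn}\sum_x\eta_t(x)\sum_{i=1}^d(1-\eta_t({\rm v}_{G_t}(x,i)))$ (density of discordant edges). Diffusion constant: $\beta_d=\sqrt{d-1}$, $\rho_d=2\sqrt{d-1}/d$, $\Delta_{d,\nu}=\cfrac{1}{a_1-\cfrac{1}{a_2-\cfrac{1}{a_3-\cdots}}}$ with $a_i=\frac{2+i\nu}{\rho_d}$, and $\vartheta_{d,\nu}=1-\Delta_{d,\nu}/\beta_d$. *)

theory Defs
  imports "HOL-Probability.Probability"
begin

text \<open>Stubs are pairs (x,i) with x < n (vertex) and i < d (stub index; 0-based).
A graph is a perfect matching of the stubs, represented as a fixed-point-free
involution on the stub set, extended by the identity outside the stub set.\<close>

type_synonym stub = "nat \<times> nat"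
type_synonym matching = "stub \<Rightarrow> stub"
type_synonym vstate = "matching \<times> (nat \<Rightarrow> bool)"

definition stubs :: "nat \<Rightarrow> nat \<Rightarrow> stub set" where
  "stubs n d = {..<n} \<times> {..<d}"

definition matchings :: "nat \<Rightarrow> nat \<Rightarrow> matching set" where
  "matchings n d = {G. (\<forall>s\<in>stubs n d. G s \<in> stubs n d \<and> G s \<noteq> s \<and> G (G s) = s)
                      \<and> (\<forall>s. s \<notin> stubs n d \<longrightarrow> G s = s)}"

definition opinions :: "nat \<Rightarrow> (nat \<Rightarrow> bool) set" where
  "opinions n = {\<eta>. \<forall>x. n \<le> x \<longrightarrow> \<not> \<eta> x}"

definition vstates :: "nat \<Rightarrow> nat \<Rightarrow> vstate set" where
  "vstates n d = matchings n d \<times> opinions n"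

definition vertex_of :: "matching \<Rightarrow> nat \<Rightarrow> nat \<Rightarrow> nat" where
  "vertex_of G x i = fst (G (x, i))"

definition rewire :: "matching \<Rightarrow> stub \<Rightarrow> stub \<Rightarrow> matching" where
  "rewire G s t = G(s := t, t := s, G s := G t, G t := G s)"

definition rate :: "nat \<Rightarrow> nat \<Rightarrow> real \<Rightarrow> vstate \<Rightarrow> vstate \<Rightarrow> real" where
  "rate n d nu a b = (case a of (G, \<eta>) \<Rightarrow> case b of (G', \<eta>') \<Rightarrow>
     (if \<eta>' = \<eta> then
        (\<Sum>s\<in>stubs n d. \<Sum>t\<in>stubs n d.
           if s \<noteq> t \<and> G s \<noteq> t \<and> rewire G s t = G' then nu / 4 * (1 / (real (d * n) - 1)) else 0)
      else 0)
   + (if G' = G then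
        (\<Sum>x<n. \<Sum>i<d. if \<eta>(x := \<eta> (vertex_of G x i)) = \<eta>' then 1 / real d else 0)
      else 0))"

definition gen :: "nat \<Rightarrow> nat \<Rightarrow> real \<Rightarrow> vstate \<Rightarrow> vstate \<Rightarrow> real" where
  "gen n d nu a b = rate n d nu a b - (if a = b then (\<Sum>c\<in>vstates n d. rate n d nu a c) else 0)"

primrec mpow :: "'s set \<Rightarrow> ('s \<Rightarrow> 's \<Rightarrow> real) \<Rightarrow> nat \<Rightarrow> 's \<Rightarrow> 's \<Rightarrow> real" where
  "mpow S Q 0 a b = (if a = b then 1 else 0)"
| "mpow S Q (Suc k) a b = (\<Sum>c\<in>S. Q a c * mpow S Q k c b)"

definition trans_prob :: "nat \<Rightarrow> nat \<Rightarrow> real \<Rightarrow> real \<Rightarrow> vstate \<Rightarrow> vstate \<Rightarrow> real" where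
  "trans_prob n d nu t a b = (\<Sum>k. t ^ k / fact k * mpow (vstates n d) (gen n d nu) k a b)"

definition init_law :: "nat \<Rightarrow> nat \<Rightarrow> real \<Rightarrow> vstate \<Rightarrow> real" where
  "init_law n d u a = (case a of (G, \<eta>) \<Rightarrow>
     if G \<in> matchings n d \<and> \<eta> \<in> opinions n
     then (1 / real (card (matchings n d))) * (\<Prod>x<n. if \<eta> x then u else 1 - u)
     else 0)"

text \<open>X is (a jointly measurable version of) the continuous-time Markov chain with
generator gen and initial law init_law: all finite-dimensional distributions match.\<close>
definition is_voter_process ::
  "nat \<Rightarrow> nat \<Rightarrow> real \<Rightarrow> real \<Rightarrow> 'w measure \<Rightarrow> (real \<Rightarrow> 'w \<Rightarrow> vstate) \<Rightarrow> bool" where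
  "is_voter_process n d nu u M X \<longleftrightarrow>
     prob_space M \<and>
     (\<lambda>(t, \<omega>). X t \<omega>) \<in> (borel :: real measure) \<Otimes>\<^sub>M M \<rightarrow>\<^sub>M count_space UNIV \<and>
     (\<forall>(k::nat) (t::nat \<Rightarrow> real) (a::nat \<Rightarrow> vstate).
        t 0 = 0 \<and> (\<forall>j<k. t j \<le> t (Suc j)) \<longrightarrow>
        measure M {\<omega> \<in> space M. \<forall>j\<le>k. X (t j) \<omega> = a j}
          = init_law n d u (a 0) * (\<Prod>j<k. trans_prob n d nu (t (Suc j) - t j) (a j) (a (Suc j))))"

definition O_obs :: "nat \<Rightarrow> vstate \<Rightarrow> real" where
  "O_obs n a = (case a of (G, \<eta>) \<Rightarrow> (\<Sum>x<n. if \<eta> x then 1 else 0) / real n)"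

definition D_obs :: "nat \<Rightarrow> nat \<Rightarrow> vstate \<Rightarrow> real" where
  "D_obs n d a = (case a of (G, \<eta>) \<Rightarrow>
     2 / real (d * n) * (\<Sum>x<n. (if \<eta> x then 1 else 0) *
                               (\<Sum>i<d. if \<eta> (vertex_of G x i) then 0 else 1)))"

definition beta_d :: "nat \<Rightarrow> real" where "beta_d d = sqrt (real d - 1)"
definition rho_d :: "nat \<Rightarrow> real" where "rho_d d = 2 * sqrt (real d - 1) / real d"
definition cf_coef :: "nat \<Rightarrow> real \<Rightarrow> nat \<Rightarrow> real" where
  "cf_coef d nu i = (2 + real i * nu) / rho_d d"

fun cf_trunc :: "(nat \<Rightarrow> real) \<Rightarrow> nat \<Rightarrow> nat \<Rightarrow> real" where
  "cf_trunc a m 0 = 0"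
| "cf_trunc a m (Suc k) = 1 / (a m - cf_trunc a (Suc m) k)"

definition Delta :: "nat \<Rightarrow> real \<Rightarrow> real" where
  "Delta d nu = lim (\<lambda>N. cf_trunc (cf_coef d nu) 1 N)"

definition theta :: "nat \<Rightarrow> real \<Rightarrow> real" where
  "theta d nu = 1 - Delta d nu / beta_d d"

definition gamma_n :: "nat \<Rightarrow> real \<Rightarrow> nat \<Rightarrow> real" where
  "gamma_n d nu n = real n / (2 * theta d nu)"

end

theory Submission
  imports Defs
begin

text \<open>
The proof is a corrector argument. Let \<open>A = 2 O (1 - O)\<close> and let \<open>D\<^sub>k\<close> be the density of discordant end points of
non-backtracking paths of length \<open>k\<close>, so that \<open>D\<^sub>0 = 0\<close> and \<open>D\<^sub>1\<close> is the density of discordant edges. Voter moves at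
the two ends lengthen or shorten a path, and rewiring an edge of the path makes its ends
independent and uniform. Up to short loops and terms of order \<open>1 / n\<close>, the defects \<open>E\<^sub>k = A - D\<^sub>k\<close> therefore satisfy
\<open>L E\<^sub>k = 2 (E\<^sub>k\<^sub>-\<^sub>1 / d + (d - 1) / d * E\<^sub>k\<^sub>+\<^sub>1 - E\<^sub>k) - \<nu> k E\<^sub>k\<close> with \<open>E\<^sub>0 = A\<close>. Solving the adjoint recursion for \<open>c\<^sub>1, ..., c\<^sub>K\<close> with
\<open>c\<^sub>K\<^sub>+\<^sub>1 = 0\<close> produces the truncated continued fraction and \<open>F = c\<^sub>1 E\<^sub>1 + ... + c\<^sub>K E\<^sub>K\<close> with \<open>L F = D\<^sub>1 - \<theta>\<^sub>K A + O(c\<^sub>K)\<close>. Time integrals of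
\<open>L F\<close> are small in mean square because \<open>F\<close> is bounded and time is sped up by a factor of order \<open>n\<close>. Loops are rare on time
average because rewiring destroys them at a positive rate and creates them at rate \<open>O(1 / n)\<close>.
\<close>

section \<open>Random transpositions and non-backtracking walks\<close>

text \<open>Stubs are used instead of vertices because, for a fixed word, the walk is then a
  bijection of the stub set: averages over starting stubs can be shifted along the path exactly.
  Conjugation by a transposition treats the four stubs of the two edges alike, so a given edge is
  picked up at four places; this cancels the 4 in \<open>nu / 4\<close> and refreshes each edge at
  rate close to \<open>nu\<close>. The obstacle is that the hierarchy in \<open>k\<close> is
  infinite, while loops are controlled only for a fixed length, with constants growing in
  \<open>k\<close>. Hence \<open>K\<close> is fixed before \<open>n\<close> grows, at the price of a
  boundary term of size \<open>c K\<close>, which is at most \<open>1 / (nu * K)\<close> because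
  rewiring damps level \<open>k\<close> at rate \<open>nu * k\<close>. The process is known only
  through joint measurability and its finite-dimensional laws, so second moments computed from
  two-time laws take the place of a martingale argument.\<close>

text \<open>A word of increments in \<open>{1..<d}\<close> encodes a non-backtracking path: each step crosses the edge at the
current stub and then moves to another stub of the vertex reached. The final rotation only picks a
stub of the end vertex.\<close>

definition rot :: "nat \<Rightarrow> nat \<Rightarrow> stub \<Rightarrow> stub" where
  "rot d j s = (fst s, (snd s + j) mod d)"

primrec walk :: "nat \<Rightarrow> matching \<Rightarrow> nat list \<Rightarrow> stub \<Rightarrow> stub" where
  "walk d G [] a = a"
| "walk d G (j # w) a = walk d G w (rot d j (G a))"

text \<open>Conjugation by a transposition. Rewiring at \<open>(s, t)\<close> is \<open>reswap (G s) t\<close>, and it is trivial for the excluded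
pairs, so the rewiring dynamics conjugates \<open>G\<close> by transpositions of uniform pairs of stubs.\<close>

definition reswap :: "stub \<Rightarrow> stub \<Rightarrow> matching \<Rightarrow> matching" where
  "reswap s t G = (\<lambda>z. Transposition.transpose s t (G (Transposition.transpose s t z)))"

definition wavg :: "nat \<Rightarrow> nat \<Rightarrow> (nat \<Rightarrow> nat \<Rightarrow> real) \<Rightarrow> matching \<Rightarrow> nat list \<Rightarrow> real" where
  "wavg n d \<Phi> G w = (\<Sum>a\<in>stubs n d. \<Phi> (fst a) (fst (walk d G w a))) / real (d * n)"

definition pavg :: "nat \<Rightarrow> nat \<Rightarrow> (nat \<Rightarrow> nat \<Rightarrow> real) \<Rightarrow> real" where
  "pavg n d \<Phi> = (\<Sum>a\<in>stubs n d. \<Sum>e\<in>stubs n d. \<Phi> (fst a) (fst e)) / (real (d * n))\<^sup>2"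

definition ret :: "nat \<Rightarrow> nat \<Rightarrow> matching \<Rightarrow> nat list \<Rightarrow> real" where
  "ret n d = wavg n d (\<lambda>x y. of_bool (x = y))"

definition Lrew :: "nat \<Rightarrow> nat \<Rightarrow> real \<Rightarrow> (matching \<Rightarrow> real) \<Rightarrow> matching \<Rightarrow> real" where
  "Lrew n d nu f G = nu / (4 * (real (d * n) - 1)) *
     (\<Sum>s\<in>stubs n d. \<Sum>t\<in>stubs n d. f (reswap s t G) - f G)"

definition Lvot :: "nat \<Rightarrow> nat \<Rightarrow> matching \<Rightarrow> ((nat \<Rightarrow> bool) \<Rightarrow> real) \<Rightarrow> (nat \<Rightarrow> bool) \<Rightarrow> real" where
  "Lvot n d G f \<eta> = (\<Sum>x<n. \<Sum>i<d. f (\<eta>(x := \<eta> (vertex_of G x i))) - f \<eta>) / real d"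

definition words :: "nat \<Rightarrow> nat \<Rightarrow> nat list set" where
  "words d k = {w. set w \<subseteq> {1..<d} \<and> length w = k}"

section \<open>Rotations, walks and rewirings as maps on stubs\<close>

lemma finite_stubs [simp]: "finite (stubs n d)" and card_stubs [simp]: "card (stubs n d) = d * n"
  by (auto simp: stubs_def card_cartesian_product)

lemma fst_rot [simp]: "fst (rot d j s) = fst s"
  by (simp add: rot_def)

lemma mod_add_inj: 
  assumes "a < d" "b < d" "(a + j) mod d = (b + j) mod (d::nat)" shows "a = b"
proof -
  have *: "x = y" if "x \<le> y" "y < d" "(x + j) mod d = (y + j) mod d" for x y
  proof -
    have "(y + j - (x + j)) mod d = 0" using that by (metis add_le_mono1 mod_eq_dvd_iff_nat mod_0_imp_dvd dvd_imp_mod_0)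
    then have "d dvd y - x" by (simp add: dvd_eq_mod_eq_0)
    then show ?thesis using that by (metis dvd_imp_le diff_le_self diff_is_0_eq le_antisym leD le_less_trans neq0_conv)
  qed
  show ?thesis using *[of a b] *[of b a] assms by (metis nat_le_linear)
qed

lemma bij_rot: assumes "0 < d" shows "bij_betw (rot d j) (stubs n d) (stubs n d)"
proof -
  have "inj_on (rot d j) (stubs n d)"
  proof (rule inj_onI)
    fix s t assume "s \<in> stubs n d" "t \<in> stubs n d" "rot d j s = rot d j t"
    then show "s = t"
      using mod_add_inj[of "snd s" d "snd t" j] by (auto simp: rot_def stubs_def intro: prod_eqI)
  qed
  moreover have "rot d j ` stubs n d \<subseteq> stubs n d"
    using assms by (auto simp: rot_def stubs_def)
  ultimately show ?thesis
    unfolding bij_betw_def using endo_inj_surj[OF finite_stubs] by blast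
qed

text \<open>This is what makes the walks non-backtracking: the stub through which a vertex is left
  is never the one through which it was entered.\<close>

lemma rot_neq: assumes "1 \<le> j" "j < d" "s \<in> stubs n d" shows "rot d j s \<noteq> s"
proof
  assume "rot d j s = s"
  then have "(snd s + j) mod d = snd s" by (metis rot_def snd_conv)
  moreover have "snd s < d" using assms by (auto simp: stubs_def)
  ultimately have "(j + snd s) mod d = (0 + snd s) mod d" by (simp add: add.commute)
  then have "j = 0" using mod_add_inj[of j d 0 "snd s"] assms by simp
  then show False using assms by simp
qed

lemma walk_append: "walk d G (u @ v) a = walk d G v (walk d G u a)"
  by (induction u arbitrary: a) auto

context
  fixes n d :: nat and G :: matching
  assumes G: "G \<in> matchings n d"
begin

lemma match_in: "s \<in> stubs n d \<Longrightarrow> G s \<in> stubs n d"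
  and match_neq: "s \<in> stubs n d \<Longrightarrow> G s \<noteq> s"
  and match_out: "s \<notin> stubs n d \<Longrightarrow> G s = s"
  using G unfolding matchings_def by blast+

lemma match_inv: "G (G s) = s"
  using G unfolding matchings_def by (cases "s \<in> stubs n d") (blast, metis (mono_tags, lifting) mem_Collect_eq)

lemma bij_match: "bij_betw G (stubs n d) (stubs n d)"
  by (rule bij_betwI[where g = G]) (auto intro: match_in simp: match_inv)

lemma bij_step: assumes "0 < d" shows "bij_betw (\<lambda>a. rot d j (G a)) (stubs n d) (stubs n d)"
  using bij_betw_trans[OF bij_match bij_rot[OF assms]] by (simp add: o_def)

lemma bij_walk: assumes "0 < d" shows "bij_betw (walk d G w) (stubs n d) (stubs n d)"
proof (induction w)
  case Nil
  then show ?case by (simp add: bij_betw_def inj_on_def)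
next
  case (Cons j w)
  show ?case using bij_betw_trans[OF bij_step[OF assms, of j] Cons] by (simp add: o_def)
qed

lemma walk_in: assumes "0 < d" "a \<in> stubs n d" shows "walk d G w a \<in> stubs n d"
  using bij_walk[OF assms(1)] assms(2) bij_betwE by blast

lemma reswap_matching:
  assumes "s \<in> stubs n d" "t \<in> stubs n d" shows "reswap s t G \<in> matchings n d"
proof -
  have tr: "Transposition.transpose s t z \<in> stubs n d \<longleftrightarrow> z \<in> stubs n d" for z
    using assms by (auto simp: Transposition.transpose_def)
  have "Transposition.transpose s t (G (Transposition.transpose s t z)) \<noteq> z" if "z \<in> stubs n d" for z
    using match_neq[of "Transposition.transpose s t z"] that tr by (metis Transposition.transpose_involutory)
  then show ?thesis
    by (auto simp: matchings_def reswap_def tr match_in match_out match_inv)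
qed

lemma reswap_other: "z \<notin> {s, t, G s, G t} \<Longrightarrow> reswap s t G z = G z"
  by (metis insertCI match_inv reswap_def transpose_apply_other)

lemma reswap_left: "t \<noteq> s \<Longrightarrow> t \<noteq> G s \<Longrightarrow> s \<in> stubs n d \<Longrightarrow> t \<in> stubs n d \<Longrightarrow> reswap s t G s = G t"
  by (metis match_inv match_neq reswap_def transpose_apply_first transpose_apply_other)

lemma reswap_triv: "t = s \<or> t = G s \<Longrightarrow> reswap s t G = G"
  by (rule ext, unfold reswap_def Transposition.transpose_def, metis match_inv)

lemma reswap_commute: "reswap s t G = reswap t s G"
  by (simp add: reswap_def Transposition.transpose_commute)

text \<open>The pairs \<open>(s, t)\<close> and \<open>(G s, G t)\<close> prescribe the same
  exchange of partners: outside the trivial cases both produce the edges \<open>{s, G t}\<close> and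
  \<open>{t, G s}\<close>. Together with commutativity this yields four equivalent positions for a
  given stub.\<close>

lemma reswap_match_match:
  assumes "s \<in> stubs n d" "t \<in> stubs n d"
  shows "reswap (G s) (G t) G = reswap s t G"
proof (cases "t = s \<or> t = G s")
  case True
  then show ?thesis
    using reswap_triv[of t s] reswap_triv[of "G t" "G s"] by auto
next
  case False
  then have ne: "s \<noteq> t" "t \<noteq> s" "t \<noteq> G s" "G s \<noteq> t" "s \<noteq> G t" "G t \<noteq> s" "G s \<noteq> G t" "G t \<noteq> G s"
      "G s \<noteq> s" "s \<noteq> G s" "G t \<noteq> t" "t \<noteq> G t"
    using match_neq[OF assms(1)] match_neq[OF assms(2)] match_inv by metis+
  show ?thesis
  proof
    fix z
    consider "z \<notin> {s, t, G s, G t}" | "z = s" | "z = t" | "z = G s" | "z = G t" by blast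
    then show "reswap (G s) (G t) G z = reswap s t G z"
    proof cases
      case 1
      then show ?thesis using reswap_other[of z s t] reswap_other[of z "G s" "G t"] by (auto simp: match_inv)
    qed (simp_all add: reswap_def Transposition.transpose_def ne match_inv)
  qed
qed

lemma rewire_eq_reswap:
  assumes "s \<in> stubs n d" "t \<in> stubs n d" "s \<noteq> t" "G s \<noteq> t"
  shows "rewire G s t = reswap (G s) t G"
proof
  fix z
  have ne: "s \<noteq> t" "t \<noteq> s" "t \<noteq> G s" "G s \<noteq> t" "s \<noteq> G t" "G t \<noteq> s" "G s \<noteq> G t" "G t \<noteq> G s"
      "G s \<noteq> s" "s \<noteq> G s" "G t \<noteq> t" "t \<noteq> G t"
    using assms match_neq[OF assms(1)] match_neq[OF assms(2)] match_inv by metis+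
  consider "z \<notin> {s, t, G s, G t}" | "z = s" | "z = t" | "z = G s" | "z = G t" by blast
  then show "rewire G s t z = reswap (G s) t G z"
  proof cases
    case 1
    then show ?thesis using reswap_other[of z "G s" t] by (auto simp: rewire_def match_inv)
  qed (simp_all add: reswap_def Transposition.transpose_def rewire_def ne match_inv)
qed

text \<open>A walk reads the matching only at the stubs from which it crosses an edge, that is,
  after proper prefixes of the word. The last stub reached is not tested, and this off-by-one later
  keeps the full word out of the error terms.\<close>

lemma walk_reswap_eq:
  assumes "\<forall>i<length v. walk d G (take i v) y \<notin> {s, t, G s, G t}"
  shows "walk d (reswap s t G) v y = walk d G v y"
  using assms
proof (induction v arbitrary: y)
  case (Cons j v)
  have "y \<notin> {s, t, G s, G t}" using Cons.prems[rule_format, of 0] by simp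
  then have eq: "reswap s t G y = G y" by (rule reswap_other)
  have "walk d G (take i v) (rot d j (G y)) \<notin> {s, t, G s, G t}" if "i < length v" for i
    using Cons.prems[rule_format, of "Suc i"] that by simp
  then show ?case using Cons.IH eq by simp
qed simp

end

section \<open>Return frequencies and collisions with rewired edges\<close>

lemma ret_nonneg: "0 \<le> ret n d G w"
  by (auto simp: ret_def wavg_def intro!: divide_nonneg_nonneg sum_nonneg)

lemma ret_sum: "0 < n \<Longrightarrow> 0 < d \<Longrightarrow>
   (\<Sum>a\<in>stubs n d. of_bool (fst (walk d G w a) = fst a)) = real (d * n) * ret n d G w"
  by (simp add: ret_def wavg_def eq_commute[of "fst _" "fst (walk d G w _)"] del: sum_of_bool_eq)

text \<open>Collision bound for \<open>w\<close>: return frequencies of its blocks of length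
  strictly between 0 and \<open>length w\<close>. Blocks running past the end are cut by
  \<open>take\<close> and hence counted repeatedly, which is harmless in an upper bound. That all
  blocks are strictly shorter than \<open>w\<close> makes an induction on lengths possible.\<close>

definition subret :: "nat \<Rightarrow> nat \<Rightarrow> matching \<Rightarrow> nat list \<Rightarrow> real" where
  "subret n d G w = (\<Sum>m<length w. \<Sum>i\<in>{1..<length w}. ret n d G (take i (drop m w)))"

context
  fixes n d :: nat and G :: matching
  assumes G: "G \<in> matchings n d"
begin

text \<open>The factor 4 counts the position of \<open>p\<close> among the four stubs of the two rewired edges.\<close>

lemma sum_reswap_pivot:
  fixes Y :: "matching \<Rightarrow> real"
  assumes p: "p \<in> stubs n d" and Y0: "\<And>G'. G' p = G p \<Longrightarrow> Y G' = 0"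
  shows "(\<Sum>s\<in>stubs n d. \<Sum>t\<in>stubs n d. Y (reswap s t G)) = 4 * (\<Sum>t\<in>stubs n d. Y (reswap p t G))"
proof -
  define Z where "Z s t = Y (reswap s t G)" for s t
  let ?S = "stubs n d"
  have Gp: "G p \<in> ?S" using match_in[OF G p] .
  \<comment> \<open>When \<open>p\<close> keeps its partner, everything vanishes by
    \<open>Y0\<close>. Otherwise \<open>s\<close>, \<open>t\<close>, \<open>G s\<close>,
    \<open>G t\<close> are distinct and \<open>p\<close> is exactly one of them, so exactly one of
    the four indicators is 1.\<close>
  have *: "Z s t = Z s t * of_bool (s = p) + Z s t * of_bool (s = G p)
        + Z s t * of_bool (t = p) + Z s t * of_bool (t = G p)"
    if st: "s \<in> ?S" "t \<in> ?S" for s t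
  proof (cases "t = s \<or> t = G s \<or> p \<notin> {s, t, G s, G t}")
    case True
    then have "reswap s t G p = G p" using reswap_triv[OF G, of t s] reswap_other[OF G, of p s t] by auto
    then have "Z s t = 0" using Y0 by (simp add: Z_def)
    then show ?thesis by simp
  next
    case False
    then have ne: "s \<noteq> t" "t \<noteq> G s" "s \<noteq> G t" "G s \<noteq> G t"
      "G s \<noteq> s" "G t \<noteq> t"
      using match_neq[OF G st(1)] match_neq[OF G st(2)] match_inv[OF G] by metis+
    then show ?thesis using False by (auto simp: match_inv[OF G])
  qed
  have comm: "Z s t = Z t s" for s t by (simp add: Z_def reswap_commute[OF G])
  have one: "(\<Sum>s\<in>?S. \<Sum>t\<in>?S. Z s t * of_bool (s = q)) = (\<Sum>t\<in>?S. Z q t)" if "q \<in> ?S" for q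
  proof -
    have "(\<Sum>s\<in>?S. \<Sum>t\<in>?S. Z s t * of_bool (s = q)) = (\<Sum>s\<in>?S. if s = q then \<Sum>t\<in>?S. Z s t else 0)"
      by (intro sum.cong) auto
    then show ?thesis using that by (simp add: sum.delta')
  qed
  have two: "(\<Sum>s\<in>?S. \<Sum>t\<in>?S. Z s t * of_bool (t = q)) = (\<Sum>t\<in>?S. Z q t)" if "q \<in> ?S" for q
  proof -
    have "(\<Sum>s\<in>?S. \<Sum>t\<in>?S. Z s t * of_bool (t = q)) = (\<Sum>t\<in>?S. \<Sum>s\<in>?S. Z t s * of_bool (t = q))"
      by (subst sum.swap) (intro sum.cong refl, metis comm)
    then show ?thesis using one[OF that] by simp
  qed
  have GG: "(\<Sum>t\<in>?S. Z (G p) t) = (\<Sum>t\<in>?S. Z p t)"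
  proof -
    have "(\<Sum>t\<in>?S. Z (G p) t) = (\<Sum>t\<in>?S. Z (G p) (G t))"
      by (rule sum.reindex_bij_betw[symmetric, OF bij_match[OF G]])
    also have "\<dots> = (\<Sum>t\<in>?S. Z p t)"
      by (rule sum.cong) (auto simp: Z_def reswap_match_match[OF G p])
    finally show ?thesis .
  qed
  have "(\<Sum>s\<in>?S. \<Sum>t\<in>?S. Z s t) = (\<Sum>s\<in>?S. \<Sum>t\<in>?S. Z s t * of_bool (s = p) + Z s t * of_bool (s = G p)
        + Z s t * of_bool (t = p) + Z s t * of_bool (t = G p))"
    using * by (intro sum.cong refl) blast
  also have "\<dots> = 4 * (\<Sum>t\<in>?S. Z p t)"
    by (simp only: sum.distrib one[OF p] one[OF Gp] two[OF p] two[OF Gp] GG)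
  finally show ?thesis by (simp add: Z_def)
qed

text \<open>The continuation after crossing the edge at \<open>t\<close> leaves through a stub of
  one of the edges at \<open>p\<close> and \<open>t\<close>. Only proper prefixes are inspected, to
  match the hypothesis of \<open>walk_reswap_eq\<close>.\<close>

definition hit :: "stub \<Rightarrow> stub \<Rightarrow> nat \<Rightarrow> nat list \<Rightarrow> bool" where
  "hit p t j v \<longleftrightarrow> (\<exists>i<length v. walk d G (take i v) (rot d j (G t)) \<in> {p, t, G p, G t})"

text \<open>Union bound over the prefix length \<open>i\<close>. Given \<open>t\<close> and
  \<open>i\<close>, the stub \<open>z i t\<close> is determined, so meeting the edge at
  \<open>p\<close> leaves at most two values of \<open>p\<close>. Meeting the edge at
  \<open>t\<close> does not involve \<open>p\<close> but closes a loop: \<open>z i t = t\<close> is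
  a return of the block \<open>j # take i v\<close>, and \<open>z i t = G t\<close> is a return of
  \<open>take i v\<close>, impossible for \<open>i = 0\<close> because the rotation moves the
  stub.\<close>

lemma hit_count:
  assumes d: "2 \<le> d" and n: "0 < n" and j: "1 \<le> j" "j < d"
  shows "(\<Sum>p\<in>stubs n d. \<Sum>t\<in>stubs n d. of_bool (hit p t j v)) \<le> 
     2 * real (length v) * real (d * n) + (real (d * n))\<^sup>2 * 
       (\<Sum>i<length v. ret n d G (j # take i v) + (if i = 0 then 0 else ret n d G (take i v)))"
proof -
  let ?S = "stubs n d" and ?N = "real (d * n)"
  have d0: "0 < d" using d by simp
  define z where "z i t = walk d G (take i v) (rot d j (G t))" for i t
  have zin: "z i t \<in> ?S" if "t \<in> ?S" for i t
    unfolding z_def using walk_in[OF G d0] bij_betwE[OF bij_step[OF G d0]] that by blast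
  define c where "c p t i = (of_bool (p = z i t) + of_bool (p = G (z i t)) +
            of_bool (z i t = t) + of_bool (z i t = G t) :: real)" for p t i
  have c0: "0 \<le> c p t i" for p t i
    unfolding c_def by (intro add_nonneg_nonneg zero_less_eq_of_bool)
  have "of_bool (hit p t j v) \<le> (\<Sum>i<length v. c p t i)" for p t
  proof (cases "hit p t j v")
    case True
    then obtain i where i: "i < length v" "z i t \<in> {p, t, G p, G t}" by (auto simp: hit_def z_def)
    then have "(1::real) \<le> c p t i" by (auto simp: match_inv[OF G] c_def)
    also have "\<dots> \<le> (\<Sum>i<length v. c p t i)"
      using i c0 by (intro member_le_sum) simp_all
    finally show ?thesis using True by simp
  qed (simp add: c0 sum_nonneg)
  then have "(\<Sum>p\<in>?S. \<Sum>t\<in>?S. of_bool (hit p t j v)) \<le> (\<Sum>p\<in>?S. \<Sum>t\<in>?S. \<Sum>i<length v. c p t i)"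
    by (intro sum_mono)
  also have "\<dots> = (\<Sum>i<length v. \<Sum>t\<in>?S. \<Sum>p\<in>?S. c p t i)"
  proof -
    have "(\<Sum>p\<in>?S. \<Sum>t\<in>?S. \<Sum>i<length v. f p t i) = (\<Sum>i<length v. \<Sum>t\<in>?S. \<Sum>p\<in>?S. f p t i)"
      for f :: "stub \<Rightarrow> stub \<Rightarrow> nat \<Rightarrow> real"
    proof -
      have "(\<Sum>p\<in>?S. \<Sum>t\<in>?S. \<Sum>i<length v. f p t i) = (\<Sum>t\<in>?S. \<Sum>p\<in>?S. \<Sum>i<length v. f p t i)"
        by (rule sum.swap)
      also have "\<dots> = (\<Sum>t\<in>?S. \<Sum>i<length v. \<Sum>p\<in>?S. f p t i)"
        by (intro sum.cong refl sum.swap)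
      also have "\<dots> = (\<Sum>i<length v. \<Sum>t\<in>?S. \<Sum>p\<in>?S. f p t i)" by (rule sum.swap)
      finally show ?thesis .
    qed
    then show ?thesis .
  qed
  also have "\<dots> = (\<Sum>i<length v. \<Sum>t\<in>?S. 2 + ?N * of_bool (z i t = t) + ?N * of_bool (z i t = G t))"
  proof (intro sum.cong refl)
    fix i t assume t: "t \<in> ?S"
    have "(\<Sum>p\<in>?S. of_bool (p = q)) = (1::real)" if "q \<in> ?S" for q
      using that by (simp add: of_bool_def)
    from this[OF zin[OF t]] this[OF match_in[OF G zin[OF t]]]
    show "(\<Sum>p\<in>?S. c p t i) = 2 + ?N * of_bool (z i t = t) + ?N * of_bool (z i t = G t)"
      unfolding c_def
      by (simp add: sum.distrib del: sum_of_bool_eq)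
  qed
  also have "\<dots> \<le> (\<Sum>i<length v. 2 * ?N + ?N * (?N * ret n d G (j # take i v))
      + ?N * (?N * (if i = 0 then 0 else ret n d G (take i v))))"
  proof (intro sum_mono)
    fix i assume "i \<in> {..<length v}"
    have 1: "(\<Sum>t\<in>?S. of_bool (z i t = t)) \<le> ?N * ret n d G (j # take i v)"
      unfolding ret_sum[OF n d0, symmetric] by (intro sum_mono) (auto simp: z_def)
    have 2: "(\<Sum>t\<in>?S. of_bool (z i t = G t)) \<le> ?N * (if i = 0 then 0 else ret n d G (take i v))"
    proof (cases "i = 0")
      case True
      have "(\<Sum>t\<in>?S. of_bool (z i t = G t)) = (\<Sum>t\<in>?S. 0::real)"
        using rot_neq[OF j match_in[OF G]] True by (intro sum.cong) (simp_all add: z_def)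
      then show ?thesis using True by simp
    next
      case False
      have "(\<Sum>t\<in>?S. of_bool (z i t = G t)) \<le> 
         (\<Sum>t\<in>?S. (\<lambda>b. of_bool (fst (walk d G (take i v) b) = fst b) :: real) (rot d j (G t)))"
        by (intro sum_mono) (auto simp: z_def)
      also have "\<dots> = (\<Sum>b\<in>?S. of_bool (fst (walk d G (take i v) b) = fst b))"
        by (rule sum.reindex_bij_betw[OF bij_step[OF G d0]])
      also have "\<dots> = ?N * ret n d G (take i v)" by (rule ret_sum[OF n d0])
      finally show ?thesis using False by simp
    qed
    have "(\<Sum>t\<in>?S. 2 + ?N * of_bool (z i t = t) + ?N * of_bool (z i t = G t)) =
       2 * ?N + ?N * (\<Sum>t\<in>?S. of_bool (z i t = t)) + ?N * (\<Sum>t\<in>?S. of_bool (z i t = G t))"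
      by (simp add: sum.distrib sum_distrib_left del: sum_of_bool_eq sum_mult_of_bool_eq sum_of_bool_mult_eq)
    also have "\<dots> \<le> 2 * ?N + ?N * (?N * ret n d G (j # take i v))
      + ?N * (?N * (if i = 0 then 0 else ret n d G (take i v)))"
      using 1 2 by (intro add_mono mult_left_mono) auto
    finally show "(\<Sum>t\<in>?S. 2 + ?N * of_bool (z i t = t) + ?N * of_bool (z i t = G t)) \<le>
      2 * ?N + ?N * (?N * ret n d G (j # take i v))
      + ?N * (?N * (if i = 0 then 0 else ret n d G (take i v)))" .
  qed
  also have "\<dots> = 2 * real (length v) * ?N + ?N\<^sup>2 * 
       (\<Sum>i<length v. ret n d G (j # take i v) + (if i = 0 then 0 else ret n d G (take i v)))"
    by (simp add: sum.distrib sum_distrib_left power2_eq_square algebra_simps)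
  finally show ?thesis .
qed

text \<open>Every loop found by \<open>hit_count\<close> in the tail after position \<open>m\<close>
  is a block of \<open>w\<close> of length at most \<open>length w - 1\<close>, even for
  \<open>m = 0\<close>, since the end of the walk is never tested. Each of the two kinds of loop is
  bounded by one \<open>subret\<close>, whence the factor 2.\<close>

lemma hit_count_word:
  assumes d: "2 \<le> d" and n: "0 < n" and w: "set w \<subseteq> {1..<d}" and m: "m < length w"
  shows "(\<Sum>p\<in>stubs n d. \<Sum>t\<in>stubs n d. of_bool (hit p t (w ! m) (drop (Suc m) w))) \<le> 
     2 * real (length w) * real (d * n) + 2 * (real (d * n))\<^sup>2 * subret n d G w"
proof -
  let ?v = "drop (Suc m) w" and ?k = "length w"
  have jv: "w ! m # ?v = drop m w" using m by (rule Cons_nth_drop_Suc)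
  have "w ! m \<in> {1..<d}" using w m nth_mem by blast
  then have j: "1 \<le> w ! m" "w ! m < d" by auto
  define B where "B m = (\<Sum>i\<in>{1..<?k}. ret n d G (take i (drop m w)))" for m
  have B0: "0 \<le> B m" for m by (simp add: B_def sum_nonneg ret_nonneg)
  have Bs: "B m \<le> subret n d G w" if "m < ?k" for m
    unfolding subret_def B_def[symmetric] using that B0 by (intro member_le_sum) auto
  have s0: "0 \<le> subret n d G w" by (simp add: subret_def sum_nonneg ret_nonneg)
  have "(\<Sum>i<length ?v. ret n d G (w ! m # take i ?v)) = (\<Sum>i<length ?v. ret n d G (take (Suc i) (drop m w)))"
    by (simp add: jv[symmetric])
  also have "\<dots> = (\<Sum>i\<in>{1..<Suc (length ?v)}. ret n d G (take i (drop m w)))"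
    by (rule sum.reindex_bij_witness[where i="\<lambda>i. i - 1" and j=Suc]) auto
  also have "\<dots> \<le> B m" unfolding B_def using m by (intro sum_mono2) (auto simp: ret_nonneg)
  finally have 1: "(\<Sum>i<length ?v. ret n d G (w ! m # take i ?v)) \<le> subret n d G w" using Bs[OF m] by simp
  have 2: "(\<Sum>i<length ?v. if i = 0 then 0 else ret n d G (take i ?v)) \<le> subret n d G w"
  proof (cases "Suc m < ?k")
    case True
    have "(\<Sum>i<length ?v. if i = 0 then 0 else ret n d G (take i ?v)) = 
         (\<Sum>i\<in>{1..<length ?v}. ret n d G (take i ?v))"
      by (intro sum.mono_neutral_cong_right) auto
    also have "\<dots> \<le> B (Suc m)" unfolding B_def using m by (intro sum_mono2) (auto simp: ret_nonneg)
    finally show ?thesis using Bs[OF True] by simp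
  next
    case False
    then have "length ?v = 0" by simp
    then show ?thesis using s0 by (metis lessThan_0 sum.empty)
  qed
  have "(\<Sum>p\<in>stubs n d. \<Sum>t\<in>stubs n d. of_bool (hit p t (w ! m) ?v)) \<le> 
     2 * real (length ?v) * real (d * n) + (real (d * n))\<^sup>2 * 
       (\<Sum>i<length ?v. ret n d G (w ! m # take i ?v) + (if i = 0 then 0 else ret n d G (take i ?v)))"
    by (rule hit_count[OF d n j])
  also have "\<dots> \<le> 2 * real ?k * real (d * n) + (real (d * n))\<^sup>2 * (subret n d G w + subret n d G w)"
    unfolding sum.distrib using 1 2 by (intro add_mono mult_left_mono mult_right_mono) auto
  finally show ?thesis by (simp add: algebra_simps)
qed

text \<open>One step of the telescoping along a path: \<open>m\<close> steps are taken in \<open>G\<close> and the remaining ones in the rewired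
graph. The edge at \<open>p\<close> is rewired to a uniform stub, so the rest of the path restarts at
an independent uniform stub, unless the walk meets the rewired edges again.\<close>

lemma pivot_estimate:
  fixes \<Phi> :: "nat \<Rightarrow> nat \<Rightarrow> real"
  assumes d: "2 \<le> d" and n: "0 < n" and w: "set w \<subseteq> {1..<d}" and m: "m < length w"
    and \<Phi>: "\<And>x y. 0 \<le> \<Phi> x y" "\<And>x y. \<Phi> x y \<le> 1"
  shows "\<bar>(\<Sum>a\<in>stubs n d. \<Sum>t\<in>stubs n d. let p = walk d G (take m w) a; G' = reswap p t G in
        \<Phi> (fst a) (fst (walk d G' (drop (Suc m) w) (rot d (w ! m) (G' p))))
      - \<Phi> (fst a) (fst (walk d G' (drop (Suc m) w) (rot d (w ! m) (G p)))))
      - (real (d * n))\<^sup>2 * (pavg n d \<Phi> - wavg n d \<Phi> G w)\<bar>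
    \<le> (2 + 4 * real (length w)) * real (d * n) + 4 * (real (d * n))\<^sup>2 * subret n d G w"
proof -
  let ?S = "stubs n d" and ?N = "real (d * n)"
  define v where "v = drop (Suc m) w"
  define j where "j = w ! m"
  define p where "p a = walk d G (take m w) a" for a
  have d0: "0 < d" using d by simp
  have N0: "?N > 0" using d n by simp
  have pin: "p a \<in> ?S" if "a \<in> ?S" for a using walk_in[OF G d0 that] by (simp add: p_def)
  define Y where "Y a t = \<Phi> (fst a) (fst (walk d (reswap (p a) t G) v (rot d j (reswap (p a) t G (p a)))))
      - \<Phi> (fst a) (fst (walk d (reswap (p a) t G) v (rot d j (G (p a)))))" for a t
  \<comment> \<open>The decoupled version of \<open>Y\<close>: both tails run in the old graph, the
    first one restarted across the edge at \<open>t\<close>.\<close>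
  define Y' where "Y' a t = \<Phi> (fst a) (fst (walk d G v (rot d j (G t))))
      - \<Phi> (fst a) (fst (walk d G v (rot d j (G (p a)))))" for a t
  have split: "walk d G w a = walk d G v (rot d j (G (p a)))" for a
  proof -
    have "w = take m w @ j # v" using m by (simp add: j_def v_def Cons_nth_drop_Suc)
    then have "walk d G w a = walk d G (take m w @ j # v) a" by simp
    then show ?thesis by (simp add: walk_append p_def)
  qed
  have b: "bij_betw (\<lambda>t. walk d G v (rot d j (G t))) ?S ?S"
    using bij_walk[OF G d0, of "j # v"] by (simp cong: bij_betw_cong)
  \<comment> \<open>For fixed \<open>a\<close> the restarted tail is a bijection in
    \<open>t\<close>, so its end is exactly uniform and gives \<open>pavg\<close>; the other term is
    constant in \<open>t\<close> and is the walk along \<open>w\<close> itself.\<close>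
  have sumY': "(\<Sum>a\<in>?S. \<Sum>t\<in>?S. Y' a t) = ?N\<^sup>2 * (pavg n d \<Phi> - wavg n d \<Phi> G w)"
  proof -
    have "(\<Sum>t\<in>?S. \<Phi> (fst a) (fst (walk d G v (rot d j (G t))))) = (\<Sum>e\<in>?S. \<Phi> (fst a) (fst e))" for a :: stub
      by (rule sum.reindex_bij_betw[OF b, where g = "\<lambda>e. \<Phi> (fst a) (fst e)"])
    then have "(\<Sum>a\<in>?S. \<Sum>t\<in>?S. Y' a t) = (\<Sum>a\<in>?S. \<Sum>e\<in>?S. \<Phi> (fst a) (fst e))
         - ?N * (\<Sum>a\<in>?S. \<Phi> (fst a) (fst (walk d G w a)))"
      by (simp only: Y'_def sum_subtractf split[symmetric] sum_distrib_left sum_constant card_stubs)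
    then show ?thesis using d n
      by (simp add: pavg_def wavg_def power2_eq_square right_diff_distrib)
  qed
  \<comment> \<open>Two degenerate choices of \<open>t\<close> and two possible collisions, one for
    each tail; the second is a hit with the roles of \<open>p a\<close> and \<open>t\<close>
    exchanged.\<close>
  have diff: "\<bar>Y a t - Y' a t\<bar> \<le> of_bool (t = p a) + of_bool (t = G (p a))
       + of_bool (hit (p a) t j v) + of_bool (hit t (p a) j v)" if "a \<in> ?S" "t \<in> ?S" for a t
  proof -
    have bd: "\<bar>\<Phi> x y - \<Phi> x' y'\<bar> \<le> 1" for x y x' y' using \<Phi>[of x y] \<Phi>[of x' y'] by linarith
    show ?thesis
    proof (cases "t = p a \<or> t = G (p a)")
      case True
      then have "reswap (p a) t G = G" by (rule reswap_triv[OF G])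
      then have "Y a t = 0" by (simp add: Y_def)
      moreover have "\<bar>Y' a t\<bar> \<le> 1" unfolding Y'_def by (rule bd)
      ultimately have "\<bar>Y a t - Y' a t\<bar> \<le> 1" by simp
      also have "\<dots> \<le> of_bool (t = p a) + of_bool (t = G (p a))
       + of_bool (hit (p a) t j v) + of_bool (hit t (p a) j v)" using True by auto
      finally show ?thesis .
    next
      case False
      let ?G' = "reswap (p a) t G"
      have e: "?G' (p a) = G t" using reswap_left[OF G] False pin that by blast
      have 1: "\<bar>\<Phi> (fst a) (fst (walk d ?G' v (rot d j (G t)))) - \<Phi> (fst a) (fst (walk d G v (rot d j (G t))))\<bar>
          \<le> of_bool (hit (p a) t j v)"
      proof (cases "hit (p a) t j v")
        case False
        then have "walk d ?G' v (rot d j (G t)) = walk d G v (rot d j (G t))"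
          by (intro walk_reswap_eq[OF G]) (auto simp: hit_def)
        then show ?thesis by simp
      qed (simp add: bd)
      have 2: "\<bar>\<Phi> (fst a) (fst (walk d ?G' v (rot d j (G (p a))))) - \<Phi> (fst a) (fst (walk d G v (rot d j (G (p a)))))\<bar>
          \<le> of_bool (hit t (p a) j v)"
      proof (cases "hit t (p a) j v")
        case False
        then have "walk d ?G' v (rot d j (G (p a))) = walk d G v (rot d j (G (p a)))"
          by (intro walk_reswap_eq[OF G]) (auto simp: hit_def)
        then show ?thesis by simp
      qed (simp add: bd)
      have gen: "\<bar>(a1 - a2) - (b1 - b2)\<bar> \<le> x1 + x2 + c1 + c2"
        if "\<bar>a1 - b1\<bar> \<le> c1" "\<bar>a2 - b2\<bar> \<le> c2" "0 \<le> x1" "0 \<le> x2" for a1 a2 b1 b2 c1 c2 x1 x2 :: real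
        using that by linarith
      show ?thesis unfolding Y_def Y'_def e by (rule gen[OF 1 2]) auto
    qed
  qed
  have bp: "bij_betw p ?S ?S" unfolding p_def using bij_walk[OF G d0] .
  have dl: "(\<Sum>t\<in>?S. of_bool (t = q)) = (1::real)" if "q \<in> ?S" for q
      using that by (simp add: of_bool_def)
  define h where "h = (\<Sum>p\<in>?S. \<Sum>t\<in>?S. of_bool (hit p t j v) :: real)"
  have h: "h \<le> 2 * real (length w) * ?N + 2 * ?N\<^sup>2 * subret n d G w"
    using hit_count_word[OF d n w m] by (simp add: h_def j_def v_def)
  have "\<bar>(\<Sum>a\<in>?S. \<Sum>t\<in>?S. Y a t) - (\<Sum>a\<in>?S. \<Sum>t\<in>?S. Y' a t)\<bar> \<le> (\<Sum>a\<in>?S. \<Sum>t\<in>?S. \<bar>Y a t - Y' a t\<bar>)"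
    unfolding sum_subtractf[symmetric] by (intro order.trans[OF sum_abs] sum_mono sum_abs)
  also have "\<dots> \<le> (\<Sum>a\<in>?S. \<Sum>t\<in>?S. of_bool (t = p a) + of_bool (t = G (p a))
       + of_bool (hit (p a) t j v) + of_bool (hit t (p a) j v))"
    using diff by (intro sum_mono) auto
  also have "\<dots> = (\<Sum>q\<in>?S. \<Sum>t\<in>?S. of_bool (t = q) + of_bool (t = G q)
       + of_bool (hit q t j v) + of_bool (hit t q j v))"
    using sum.reindex_bij_betw[OF bp, where g = "\<lambda>q. \<Sum>t\<in>?S. of_bool (t = q) + of_bool (t = G q)
       + of_bool (hit q t j v) + of_bool (hit t q j v) :: real"] by simp
  also have "\<dots> = (\<Sum>q\<in>?S. 2 + (\<Sum>t\<in>?S. of_bool (hit q t j v)) + (\<Sum>t\<in>?S. of_bool (hit t q j v)))"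
    by (intro sum.cong refl) (simp add: sum.distrib dl match_in[OF G] del: sum_of_bool_eq)
  also have "\<dots> = 2 * ?N + h + (\<Sum>q\<in>?S. \<Sum>t\<in>?S. of_bool (hit t q j v))"
    by (simp add: sum.distrib h_def del: sum_of_bool_eq)
  also have "\<dots> = 2 * ?N + 2 * h"
    using sum.swap[of "\<lambda>p t. of_bool (hit p t j v) :: real" ?S ?S] by (simp add: h_def del: sum_of_bool_eq)
  finally have "\<bar>(\<Sum>a\<in>?S. \<Sum>t\<in>?S. Y a t) - ?N\<^sup>2 * (pavg n d \<Phi> - wavg n d \<Phi> G w)\<bar> \<le> 2 * ?N + 2 * h"
    unfolding sumY' .
  also have "\<dots> \<le> (2 + 4 * real (length w)) * ?N + 4 * ?N\<^sup>2 * subret n d G w"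
    using h by (simp add: algebra_simps)
  finally show ?thesis by (simp add: Y_def Let_def p_def v_def j_def)
qed

end

section \<open>Rewiring acting on walk averages\<close>

lemma wavg_bounds:
  fixes \<Phi> :: "nat \<Rightarrow> nat \<Rightarrow> real"
  assumes "\<And>x y. 0 \<le> \<Phi> x y" "\<And>x y. \<Phi> x y \<le> 1"
  shows "0 \<le> wavg n d \<Phi> G w" "wavg n d \<Phi> G w \<le> 1"
proof -
  show "0 \<le> wavg n d \<Phi> G w"
    unfolding wavg_def using assms by (intro divide_nonneg_nonneg sum_nonneg) auto
  have "(\<Sum>a\<in>stubs n d. \<Phi> (fst a) (fst (walk d G w a))) \<le> real (card (stubs n d)) * 1"
    using assms by (intro sum_bounded_above) auto
  then show "wavg n d \<Phi> G w \<le> 1"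
    unfolding wavg_def by (intro divide_le_eq_1[THEN iffD2]) (cases "d * n = 0", auto simp del: of_nat_mult)
qed

lemma pavg_bounds:
  fixes \<Phi> :: "nat \<Rightarrow> nat \<Rightarrow> real"
  assumes "\<And>x y. 0 \<le> \<Phi> x y" "\<And>x y. \<Phi> x y \<le> 1"
  shows "0 \<le> pavg n d \<Phi>" "pavg n d \<Phi> \<le> 1"
proof -
  show "0 \<le> pavg n d \<Phi>"
    unfolding pavg_def using assms by (intro divide_nonneg_nonneg sum_nonneg) auto
  have "(\<Sum>a\<in>stubs n d. \<Sum>e\<in>stubs n d. \<Phi> (fst a) (fst e)) \<le> (\<Sum>a\<in>stubs n d. \<Sum>e\<in>stubs n d. 1)"
    using assms by (intro sum_mono) auto
  also have "\<dots> = (real (d * n))\<^sup>2" by (simp add: power2_eq_square)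
  finally show "pavg n d \<Phi> \<le> 1"
    unfolding pavg_def by (intro divide_le_eq_1[THEN iffD2]) (cases "d * n = 0", auto simp del: of_nat_mult)
qed

text \<open>Each of the \<open>length w\<close> edges of the path is refreshed at rate about
  \<open>nu\<close>, after which the end is nearly independent of the start; hence the drift towards
  \<open>pavg\<close>. The change of the average is telescoped over the position at which the walk
  switches from \<open>G\<close> to the rewired graph. The summand at position \<open>m\<close>
  vanishes unless the edge crossed there is rewired, so only pairs touching that edge
  contribute.\<close>

lemma Lrew_wavg:
  fixes \<Phi> :: "nat \<Rightarrow> nat \<Rightarrow> real"
  assumes G: "G \<in> matchings n d" and d: "2 \<le> d" and n: "0 < n" and w: "set w \<subseteq> {1..<d}"
    and \<Phi>: "\<And>x y. 0 \<le> \<Phi> x y" "\<And>x y. \<Phi> x y \<le> 1" and nu: "0 < nu"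
  shows "\<bar>Lrew n d nu (\<lambda>G. wavg n d \<Phi> G w) G - nu * real (length w) * (pavg n d \<Phi> - wavg n d \<Phi> G w)\<bar>
    \<le> nu * real (length w) * ((6 + 8 * real (length w)) / real (d * n) + 8 * subret n d G w)"
proof -
  let ?S = "stubs n d"
  define N where "N = real (d * n)"
  define k where "k = length w"
  define D where "D = pavg n d \<Phi> - wavg n d \<Phi> G w"
  define E where "E = subret n d G w"
  have d0: "0 < d" using d by simp
  have "2 * 1 \<le> d * n" using d n by (intro mult_mono) auto
  then have N: "N \<ge> 2" unfolding N_def by linarith
  have E: "0 \<le> E" by (simp add: E_def subret_def sum_nonneg ret_nonneg)
  have D: "\<bar>D\<bar> \<le> 1" unfolding D_def using wavg_bounds[of \<Phi> n d G w, OF \<Phi>] pavg_bounds[of \<Phi> n d, OF \<Phi>] by linarith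
  define p where "p m a = walk d G (take m w) a" for m a
  define Y where "Y m a G' = \<Phi> (fst a) (fst (walk d G' (drop (Suc m) w) (rot d (w ! m) (G' (p m a)))))
      - \<Phi> (fst a) (fst (walk d G' (drop (Suc m) w) (rot d (w ! m) (G (p m a)))))" for m a G'
  have tel: "\<Phi> (fst a) (fst (walk d G' w a)) - \<Phi> (fst a) (fst (walk d G w a)) = (\<Sum>m<k. Y m a G')" for a G'
  proof -
    \<comment> \<open>\<open>H m\<close> follows \<open>G\<close> for \<open>m\<close> steps and the
      rewired graph afterwards, interpolating between the two walks.\<close>
    define H where "H m = \<Phi> (fst a) (fst (walk d G' (drop m w) (p m a)))" for m
    have "Y m a G' = H m - H (Suc m)" if "m < k" for m
    proof -
      have 1: "drop m w = w ! m # drop (Suc m) w" using that by (simp add: k_def Cons_nth_drop_Suc)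
      have 2: "take (Suc m) w = take m w @ [w ! m]" using that by (simp add: k_def take_Suc_conv_app_nth)
      show ?thesis unfolding H_def 1 p_def 2 by (simp add: Y_def walk_append p_def)
    qed
    then have "(\<Sum>m<k. Y m a G') = H 0 - H k" by (simp add: sum_lessThan_telescope')
    then show ?thesis by (simp add: H_def p_def k_def)
  qed
  define Z where "Z m = (\<Sum>a\<in>?S. \<Sum>t\<in>?S. Y m a (reswap (p m a) t G))" for m
  have Z: "\<bar>Z m - N\<^sup>2 * D\<bar> \<le> (2 + 4 * real k) * N + 4 * N\<^sup>2 * E" if "m < k" for m
    using pivot_estimate[OF G d n w _ \<Phi>, of m] that
    by (simp add: Z_def Y_def p_def N_def D_def E_def k_def Let_def)
  have "(\<Sum>s\<in>?S. \<Sum>t\<in>?S. wavg n d \<Phi> (reswap s t G) w - wavg n d \<Phi> G w) =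
        (\<Sum>s\<in>?S. \<Sum>t\<in>?S. \<Sum>a\<in>?S. \<Sum>m<k. Y m a (reswap s t G)) / N"
    by (simp add: wavg_def diff_divide_distrib[symmetric] sum_subtractf[symmetric] tel sum_divide_distrib[symmetric] N_def
       del: of_nat_mult)
  also have "(\<Sum>s\<in>?S. \<Sum>t\<in>?S. \<Sum>a\<in>?S. \<Sum>m<k. Y m a (reswap s t G)) = 
        (\<Sum>m<k. \<Sum>a\<in>?S. \<Sum>s\<in>?S. \<Sum>t\<in>?S. Y m a (reswap s t G))"
  proof -
    have "(\<Sum>s\<in>?S. \<Sum>t\<in>?S. \<Sum>a\<in>?S. f s t a) = (\<Sum>a\<in>?S. \<Sum>s\<in>?S. \<Sum>t\<in>?S. f s t a)" for f :: "stub \<Rightarrow> stub \<Rightarrow> stub \<Rightarrow> real"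
    proof -
      have "(\<Sum>s\<in>?S. \<Sum>t\<in>?S. \<Sum>a\<in>?S. f s t a) = (\<Sum>s\<in>?S. \<Sum>a\<in>?S. \<Sum>t\<in>?S. f s t a)"
        by (intro sum.cong refl sum.swap)
      also have "\<dots> = (\<Sum>a\<in>?S. \<Sum>s\<in>?S. \<Sum>t\<in>?S. f s t a)" by (rule sum.swap)
      finally show ?thesis .
    qed
    then have "(\<Sum>s\<in>?S. \<Sum>t\<in>?S. \<Sum>a\<in>?S. \<Sum>m<k. Y m a (reswap s t G)) = 
       (\<Sum>a\<in>?S. \<Sum>s\<in>?S. \<Sum>t\<in>?S. \<Sum>m<k. Y m a (reswap s t G))" .
    also have "\<dots> = (\<Sum>a\<in>?S. \<Sum>m<k. \<Sum>s\<in>?S. \<Sum>t\<in>?S. Y m a (reswap s t G))"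
    proof (intro sum.cong refl)
      fix a
      have "(\<Sum>s\<in>?S. \<Sum>t\<in>?S. \<Sum>m<k. Y m a (reswap s t G)) = (\<Sum>s\<in>?S. \<Sum>m<k. \<Sum>t\<in>?S. Y m a (reswap s t G))"
        by (intro sum.cong refl sum.swap)
      then show "(\<Sum>s\<in>?S. \<Sum>t\<in>?S. \<Sum>m<k. Y m a (reswap s t G)) = (\<Sum>m<k. \<Sum>s\<in>?S. \<Sum>t\<in>?S. Y m a (reswap s t G))"
        by (simp add: sum.swap[of _ "{..<k}"])
    qed
    also have "\<dots> = (\<Sum>m<k. \<Sum>a\<in>?S. \<Sum>s\<in>?S. \<Sum>t\<in>?S. Y m a (reswap s t G))" by (rule sum.swap)
    finally show ?thesis .
  qed
  also have "\<dots> = (\<Sum>m<k. 4 * Z m)"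
  proof (intro sum.cong refl)
    fix m assume "m \<in> {..<k}"
    have "(\<Sum>s\<in>?S. \<Sum>t\<in>?S. Y m a (reswap s t G)) = 4 * (\<Sum>t\<in>?S. Y m a (reswap (p m a) t G))"
      if "a \<in> ?S" for a
      by (rule sum_reswap_pivot[OF G]) (simp_all add: p_def walk_in[OF G d0 that] Y_def)
    then show "(\<Sum>a\<in>?S. \<Sum>s\<in>?S. \<Sum>t\<in>?S. Y m a (reswap s t G)) = 4 * Z m"
      unfolding Z_def by (simp add: sum_distrib_left[of 4 _ ?S, symmetric])
  qed
  finally have e: "(\<Sum>s\<in>?S. \<Sum>t\<in>?S. wavg n d \<Phi> (reswap s t G) w - wavg n d \<Phi> G w) = (\<Sum>m<k. 4 * Z m) / N" .
  have "Lrew n d nu (\<lambda>G. wavg n d \<Phi> G w) G = nu / (4 * (N - 1)) * ((\<Sum>m<k. 4 * Z m) / N)"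
    unfolding Lrew_def e N_def ..
  also have "\<dots> = nu / (N * (N - 1)) * (\<Sum>m<k. Z m)"
    unfolding sum_distrib_left[symmetric] using N by (simp add: field_simps)
  finally have L: "Lrew n d nu (\<lambda>G. wavg n d \<Phi> G w) G = nu / (N * (N - 1)) * (\<Sum>m<k. Z m)" .
  have "\<bar>(\<Sum>m<k. Z m) - real k * (N\<^sup>2 * D)\<bar> = \<bar>\<Sum>m<k. Z m - N\<^sup>2 * D\<bar>" by (simp add: sum_subtractf)
  also have "\<dots> \<le> (\<Sum>m<k. \<bar>Z m - N\<^sup>2 * D\<bar>)" by (rule sum_abs)
  also have "\<dots> \<le> (\<Sum>m<k. (2 + 4 * real k) * N + 4 * N\<^sup>2 * E)" by (intro sum_mono Z) auto
  finally have S: "\<bar>(\<Sum>m<k. Z m) - real k * (N\<^sup>2 * D)\<bar> \<le> real k * ((2 + 4 * real k) * N + 4 * N\<^sup>2 * E)" by simp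
  define c where "c = nu / (N * (N - 1))"
  have c0: "c \<ge> 0" using N nu by (simp add: c_def)
  \<comment> \<open>\<open>N - 1\<close> is at least \<open>N / 2\<close> because
    \<open>N \<ge> 2\<close>, and \<open>c * N\<^sup>2 - nu\<close> equals \<open>c * N\<close>:
    replacing \<open>N * (N - 1)\<close> by \<open>N\<^sup>2\<close> costs a term of order
    \<open>1 / N\<close>.\<close>
  have cN: "c * N \<le> 2 * nu / N" "c * N\<^sup>2 \<le> 2 * nu" "\<bar>c * N\<^sup>2 - nu\<bar> \<le> 2 * nu / N"
  proof -
    have "c * N = nu / (N - 1)" using N by (simp add: c_def)
    also have "\<dots> \<le> nu / (N / 2)" using N nu by (intro divide_left_mono) auto
    finally show cN: "c * N \<le> 2 * nu / N" by (simp add: mult.commute)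
    then have "c * N * N \<le> 2 * nu / N * N" using N by (intro mult_right_mono) auto
    then show "c * N\<^sup>2 \<le> 2 * nu" using N by (simp add: power2_eq_square algebra_simps)
    have "c * N\<^sup>2 - nu = c * N" using N by (simp add: c_def power2_eq_square field_simps)
    then show "\<bar>c * N\<^sup>2 - nu\<bar> \<le> 2 * nu / N" using cN c0 N by simp
  qed
  have "\<bar>c * (\<Sum>m<k. Z m) - nu * real k * D\<bar> = \<bar>c * ((\<Sum>m<k. Z m) - real k * (N\<^sup>2 * D)) + (c * N\<^sup>2 - nu) * (real k * D)\<bar>"
    by (simp add: algebra_simps)
  also have "\<dots> \<le> c * \<bar>(\<Sum>m<k. Z m) - real k * (N\<^sup>2 * D)\<bar> + \<bar>c * N\<^sup>2 - nu\<bar> * (real k * \<bar>D\<bar>)"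
    using c0 by (intro order.trans[OF abs_triangle_ineq]) (simp add: abs_mult)
  also have "\<dots> \<le> c * (real k * ((2 + 4 * real k) * N + 4 * N\<^sup>2 * E)) + (2 * nu / N) * (real k * 1)"
    using c0 S D cN(3) nu N by (intro add_mono mult_left_mono mult_mono) auto
  also have "\<dots> = real k * ((2 + 4 * real k) * (c * N) + 4 * (c * N\<^sup>2) * E) + (2 * nu / N) * real k"
    by (simp add: algebra_simps)
  also have "\<dots> \<le> real k * ((2 + 4 * real k) * (2 * nu / N) + 4 * (2 * nu) * E) + (2 * nu / N) * real k"
    using cN E by (intro add_mono mult_left_mono mult_right_mono) auto
  also have "\<dots> = nu * real k * ((6 + 8 * real k) / N + 8 * E)"
    using N by (simp add: field_simps)
  finally show ?thesis unfolding L c_def[symmetric] by (simp add: k_def D_def N_def E_def)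
qed

section \<open>Voter moves acting on walk averages\<close>

definition disc :: "(nat \<Rightarrow> bool) \<Rightarrow> nat \<Rightarrow> nat \<Rightarrow> real" where
  "disc \<eta> x y = of_bool (\<eta> x \<noteq> \<eta> y)"

definition davg :: "nat \<Rightarrow> nat \<Rightarrow> nat \<Rightarrow> matching \<Rightarrow> (nat \<Rightarrow> bool) \<Rightarrow> real" where
  "davg n d k G \<eta> = (\<Sum>w\<in>words d k. wavg n d (disc \<eta>) G w) / (real d - 1) ^ k"

definition ravg :: "nat \<Rightarrow> nat \<Rightarrow> nat \<Rightarrow> matching \<Rightarrow> real" where
  "ravg n d k G = (\<Sum>w\<in>words d k. ret n d G w) / (real d - 1) ^ k"

lemma disc_bounds [simp]: "0 \<le> disc \<eta> x y" "disc \<eta> x y \<le> 1"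
  by (simp_all add: disc_def)

lemma disc_same [simp]: "disc \<eta> x x = 0"
  by (simp add: disc_def)

lemma words_0 [simp]: "words d 0 = {[]}"
  by (auto simp: words_def)

lemma finite_words [simp]: "finite (words d k)"
  unfolding words_def by (rule finite_lists_length_eq) simp

lemma card_words: "1 \<le> d \<Longrightarrow> real (card (words d k)) = (real d - 1) ^ k"
  unfolding words_def by (subst card_lists_length_eq) (auto simp: of_nat_diff)

lemma sum_words_Cons: "(\<Sum>w\<in>words d (Suc k). g w) = (\<Sum>j\<in>{1..<d}. \<Sum>w\<in>words d k. g (j # w))"
proof -
  have "(\<Sum>w\<in>words d (Suc k). g w) = (\<Sum>(j, w)\<in>{1..<d} \<times> words d k. g (j # w))"
    by (rule sum.reindex_bij_witness[where i = "\<lambda>(j, w). j # w" and j = "\<lambda>w. (hd w, tl w)"])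
       (auto simp: words_def length_Suc_conv)
  then show ?thesis by (simp add: sum.cartesian_product)
qed

lemma sum_words_snoc: "(\<Sum>w\<in>words d (Suc k). g w) = (\<Sum>j\<in>{1..<d}. \<Sum>w\<in>words d k. g (w @ [j]))"
proof -
  have "(\<Sum>w\<in>words d (Suc k). g w) = (\<Sum>(j, w)\<in>{1..<d} \<times> words d k. g (w @ [j]))"
    by (rule sum.reindex_bij_witness[where i = "\<lambda>(j, w). w @ [j]" and j = "\<lambda>w. (last w, butlast w)"])
       (auto simp: words_def length_Suc_conv_rev)
  then show ?thesis by (simp add: sum.cartesian_product)
qed

lemma davg_0 [simp]: "davg n d 0 G \<eta> = 0"
  by (simp add: davg_def wavg_def)

lemma davg_bounds:
  assumes "2 \<le> d" shows "0 \<le> davg n d k G \<eta>" "davg n d k G \<eta> \<le> 1"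
proof -
  have b: "0 \<le> wavg n d (disc \<eta>) G w" "wavg n d (disc \<eta>) G w \<le> 1" for w
    using wavg_bounds[of "disc \<eta>"] by auto
  show "0 \<le> davg n d k G \<eta>"
    unfolding davg_def using assms b by (intro divide_nonneg_nonneg sum_nonneg) auto
  have "(\<Sum>w\<in>words d k. wavg n d (disc \<eta>) G w) \<le> real (card (words d k)) * 1"
    using b by (intro sum_bounded_above) auto
  then show "davg n d k G \<eta> \<le> 1"
    unfolding davg_def using assms card_words[of d k]
    by (subst divide_le_eq_1_pos) auto
qed

lemma Lvot_sum: "Lvot n d G (\<lambda>\<eta>. \<Sum>a\<in>A. f a \<eta>) \<eta> = (\<Sum>a\<in>A. Lvot n d G (f a) \<eta>)"
proof -
  have "(\<Sum>x<n. \<Sum>i<d. (\<Sum>a\<in>A. f a (\<eta>(x := \<eta> (vertex_of G x i)))) - (\<Sum>a\<in>A. f a \<eta>)) =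
        (\<Sum>a\<in>A. \<Sum>x<n. \<Sum>i<d. f a (\<eta>(x := \<eta> (vertex_of G x i))) - f a \<eta>)"
    unfolding sum_subtractf[symmetric] by (simp add: sum.swap[of _ _ A])
  then show ?thesis by (simp add: Lvot_def sum_divide_distrib)
qed

lemma Lvot_divide: "Lvot n d G (\<lambda>\<eta>. f \<eta> / c) \<eta> = Lvot n d G f \<eta> / c"
  by (simp add: Lvot_def diff_divide_distrib[symmetric] sum_divide_distrib[symmetric])

text \<open>Only updates at \<open>x\<close> or \<open>y\<close> affect the pair, and for
  \<open>x \<noteq> y\<close> the formula is exact. For \<open>x = y\<close> the discordance is
  constantly 0 while the formula is a sum of two averages in \<open>[0, 1]\<close>, hence the error
  2.\<close>

lemma Lvot_disc:
  assumes d: "0 < d" and xy: "x < n" "y < n"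
  shows "\<bar>Lvot n d G (\<lambda>\<eta>. disc \<eta> x y) \<eta> - ((\<Sum>i<d. disc \<eta> (vertex_of G x i) y) / real d
     + (\<Sum>i<d. disc \<eta> x (vertex_of G y i)) / real d - 2 * disc \<eta> x y)\<bar> \<le> 2 * of_bool (x = y)"
proof (cases "x = y")
  case True
  have b: "0 \<le> (\<Sum>i<d. f i) / real d \<and> (\<Sum>i<d. f i) / real d \<le> 1"
    if "\<And>i. 0 \<le> f i" "\<And>i. f i \<le> 1" for f :: "nat \<Rightarrow> real"
    using that d sum_bounded_above[of "{..<d}" f 1] by (auto intro!: divide_nonneg_nonneg sum_nonneg)
  have "Lvot n d G (\<lambda>\<eta>. disc \<eta> x y) \<eta> = 0" by (simp add: True Lvot_def)
  then show ?thesis 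
    using b[of "\<lambda>i. disc \<eta> (vertex_of G x i) y"] b[of "\<lambda>i. disc \<eta> x (vertex_of G y i)"] True by simp
next
  case False
  define T where "T z = (\<Sum>i<d. disc (\<eta>(z := \<eta> (vertex_of G z i))) x y - disc \<eta> x y)" for z
  have "(\<Sum>z<n. T z) = (\<Sum>z\<in>{x, y}. T z)"
    using xy by (intro sum.mono_neutral_right) (auto simp: T_def disc_def)
  also have "\<dots> = T x + T y" using False by simp
  also have "T x = (\<Sum>i<d. disc \<eta> (vertex_of G x i) y) - real d * disc \<eta> x y"
    using False by (simp add: T_def disc_def sum_subtractf)
  also have "T y = (\<Sum>i<d. disc \<eta> x (vertex_of G y i)) - real d * disc \<eta> x y"
    using False by (simp add: T_def disc_def sum_subtractf)
  finally have "Lvot n d G (\<lambda>\<eta>. disc \<eta> x y) \<eta> = (\<Sum>i<d. disc \<eta> (vertex_of G x i) y) / real d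
     + (\<Sum>i<d. disc \<eta> x (vertex_of G y i)) / real d - 2 * disc \<eta> x y"
    using d by (simp add: Lvot_def T_def field_simps)
  then show ?thesis by simp
qed

text \<open>Seen from a given stub, the \<open>d\<close> stubs of its vertex are that stub and its
  \<open>d - 1\<close> nontrivial rotations. This is the source of the weights \<open>1 / d\<close>
  and \<open>(d - 1) / d\<close>: a voter at the end of a path copies either back along the path or
  away from it.\<close>

lemma sum_vertex_stubs:
  assumes "0 < d" "a \<in> stubs n d"
  shows "(\<Sum>i<d. g (fst a, i)) = g a + (\<Sum>j\<in>{1..<d}. g (rot d j a))"
proof -
  have a: "snd a < d" using assms(2) by (auto simp: stubs_def)
  have "inj_on (\<lambda>j. (snd a + j) mod d) {..<d}"
  proof (rule inj_onI)
    fix i j assume "i \<in> {..<d}" "j \<in> {..<d}" "(snd a + i) mod d = (snd a + j) mod d"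
    then show "i = j" using mod_add_inj[of i d j "snd a"] by (simp add: add.commute)
  qed
  moreover have "(\<lambda>j. (snd a + j) mod d) ` {..<d} \<subseteq> {..<d}" using assms(1) by auto
  ultimately have "bij_betw (\<lambda>j. (snd a + j) mod d) {..<d} {..<d}"
    unfolding bij_betw_def using endo_inj_surj[OF finite_lessThan] by blast
  from sum.reindex_bij_betw[OF this, of "\<lambda>i. g (fst a, i)"]
  have "(\<Sum>i<d. g (fst a, i)) = (\<Sum>j<d. g (rot d j a))" by (simp add: rot_def)
  also have "\<dots> = (\<Sum>j\<in>insert 0 {1..<d}. g (rot d j a))" using assms(1) by (intro sum.cong) auto
  also have "\<dots> = g (rot d 0 a) + (\<Sum>j\<in>{1..<d}. g (rot d j a))" by simp
  also have "rot d 0 a = a" using a by (simp add: rot_def)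
  finally show ?thesis .
qed

lemma rot_rot: assumes "a \<in> stubs n d" "j \<le> d" shows "rot d (d - j) (rot d j a) = a"
proof -
  have "((snd a + j) mod d + (d - j)) mod d = (snd a + j + (d - j)) mod d" by (rule mod_add_left_eq)
  also have "snd a + j + (d - j) = snd a + d" using assms(2) by simp
  also have "(snd a + d) mod d = snd a" using assms(1) by (auto simp: stubs_def)
  finally show ?thesis by (simp only: rot_def fst_conv snd_conv prod.collapse)
qed

lemma sum_stubs: "(\<Sum>a\<in>stubs n d. g (fst a)) = real d * (\<Sum>x<n. g x :: real)"
proof -
  have "(\<Sum>a\<in>stubs n d. g (fst a)) = (\<Sum>x<n. \<Sum>i<d. g x)"
    unfolding stubs_def by (simp add: sum.cartesian_product' split_def del: sum_constant)
  then show ?thesis by (simp add: sum_distrib_left)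
qed

lemma pavg_eq: "0 < n \<Longrightarrow> 0 < d \<Longrightarrow> pavg n d (\<lambda>x y. of_bool (x = y)) = 1 / real n"
proof -
  assume *: "0 < n" "0 < d"
  have "(\<Sum>a\<in>stubs n d. \<Sum>e\<in>stubs n d. of_bool (fst a = fst e) :: real) =
     real d * (\<Sum>x<n. \<Sum>e\<in>stubs n d. of_bool (x = fst e))" by (rule sum_stubs)
  also have "\<dots> = real d * (\<Sum>x<n. real d * (\<Sum>y<n. of_bool (x = y)))"
    by (simp only: sum_stubs[of "\<lambda>y. of_bool (_ = y)"])
  also have "\<dots> = real d * real d * real n"
    by (simp add: of_bool_def)
  finally show ?thesis using * by (simp add: pavg_def power2_eq_square del: sum_of_bool_eq)
qed

context
  fixes n d :: nat and G :: matching
  assumes G: "G \<in> matchings n d" and n: "0 < n" and d: "2 \<le> d"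
begin

text \<open>Copying along a uniform stub preserves the uniform law on vertices, because
  \<open>G\<close> permutes the stubs; the expected change of the global discordance therefore
  cancels. What remains is the diagonal \<open>x = y\<close>, of weight
  \<open>1 / n\<close>.\<close>

lemma Lvot_pavg: "\<bar>Lvot n d G (\<lambda>\<eta>. pavg n d (disc \<eta>)) \<eta>\<bar> \<le> 2 / real n"
proof -
  let ?S = "stubs n d" and ?N = "real (d * n)"
  have d0: "0 < d" using d by simp
  have fin: "fst a < n" if "a \<in> ?S" for a using that by (auto simp: stubs_def)
  have key: "(\<Sum>a\<in>?S. (\<Sum>i<d. \<psi> (vertex_of G (fst a) i)) / real d) = (\<Sum>a\<in>?S. \<psi> (fst a))" for \<psi> :: "nat \<Rightarrow> real"
  proof -
    have "(\<Sum>a\<in>?S. (\<Sum>i<d. \<psi> (vertex_of G (fst a) i)) / real d) = (\<Sum>x<n. \<Sum>i<d. \<psi> (vertex_of G x i))"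
      using d0 by (subst sum_stubs[of "\<lambda>x. (\<Sum>i<d. \<psi> (vertex_of G x i)) / real d"]) (simp add: sum_divide_distrib[symmetric])
    also have "\<dots> = (\<Sum>b\<in>?S. \<psi> (fst (G b)))"
      by (simp add: stubs_def sum.cartesian_product vertex_of_def split_def)
    also have "\<dots> = (\<Sum>a\<in>?S. \<psi> (fst a))"
      by (rule sum.reindex_bij_betw[OF bij_match[OF G], of "\<lambda>a. \<psi> (fst a)"])
    finally show ?thesis .
  qed
  define M where "M a e = (\<Sum>i<d. disc \<eta> (vertex_of G (fst a) i) (fst e)) / real d
     + (\<Sum>i<d. disc \<eta> (fst a) (vertex_of G (fst e) i)) / real d - 2 * disc \<eta> (fst a) (fst e)" for a e :: stub
  have M0: "(\<Sum>a\<in>?S. \<Sum>e\<in>?S. M a e) = 0"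
  proof -
    have "(\<Sum>a\<in>?S. \<Sum>e\<in>?S. (\<Sum>i<d. disc \<eta> (vertex_of G (fst a) i) (fst e)) / real d) = 
       (\<Sum>a\<in>?S. \<Sum>e\<in>?S. disc \<eta> (fst a) (fst e))"
      by (subst sum.swap, subst (2) sum.swap) (simp only: key[of "\<lambda>x. disc \<eta> x (fst _)"])
    moreover have "(\<Sum>a\<in>?S. \<Sum>e\<in>?S. (\<Sum>i<d. disc \<eta> (fst a) (vertex_of G (fst e) i)) / real d) = 
       (\<Sum>a\<in>?S. \<Sum>e\<in>?S. disc \<eta> (fst a) (fst e))"
      by (simp only: key)
    ultimately show ?thesis unfolding M_def by (simp add: sum.distrib sum_subtractf sum_distrib_left[symmetric])
  qed
  have "Lvot n d G (\<lambda>\<eta>. pavg n d (disc \<eta>)) \<eta> = (\<Sum>a\<in>?S. \<Sum>e\<in>?S. Lvot n d G (\<lambda>\<eta>. disc \<eta> (fst a) (fst e)) \<eta>) / ?N\<^sup>2"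
    unfolding pavg_def by (simp only: Lvot_divide Lvot_sum)
  also have "\<dots> = (\<Sum>a\<in>?S. \<Sum>e\<in>?S. Lvot n d G (\<lambda>\<eta>. disc \<eta> (fst a) (fst e)) \<eta> - M a e) / ?N\<^sup>2"
    by (simp add: sum_subtractf M0)
  also have "\<bar>\<dots>\<bar> \<le> (\<Sum>a\<in>?S. \<Sum>e\<in>?S. 2 * of_bool (fst a = fst e)) / ?N\<^sup>2"
    unfolding abs_divide M_def abs_power2 
    by (intro divide_right_mono order.trans[OF sum_abs] sum_mono Lvot_disc[OF d0 fin fin]) simp_all
  also have "\<dots> = 2 * pavg n d (\<lambda>x y. of_bool (x = y))"
    by (simp add: pavg_def sum_distrib_left del: sum_mult_of_bool_eq sum_of_bool_eq)
  finally show ?thesis using pavg_eq[OF n d0] by simp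
qed

text \<open>The start vertex copies along one of its \<open>d\<close> stubs: through the first edge
  of the path this removes the first letter, through any other stub it prepends a letter. Each word
  of length \<open>k\<close> arises by removal from \<open>d - 1\<close> words.\<close>

lemma sum_start_step:
  "(\<Sum>w\<in>words d (Suc k). \<Sum>a\<in>stubs n d. \<Sum>i<d. \<Phi> (vertex_of G (fst a) i) (fst (walk d G w a))) =
   real (d * n) * ((real d - 1) * (\<Sum>w\<in>words d k. wavg n d \<Phi> G w) + (\<Sum>w\<in>words d (Suc (Suc k)). wavg n d \<Phi> G w))"
proof -
  let ?S = "stubs n d" and ?N = "real (d * n)"
  have d0: "0 < d" using d by simp
  define f where "f w = (\<Sum>a\<in>?S. \<Phi> (fst a) (fst (walk d G w a)))" for w
  have f: "f w = ?N * wavg n d \<Phi> G w" for w using n d by (simp add: f_def wavg_def)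
  have "(\<Sum>i<d. \<Phi> (vertex_of G (fst a) i) z) = \<Phi> (fst (G a)) z + (\<Sum>j\<in>{1..<d}. \<Phi> (fst (G (rot d j a))) z)"
    if "a \<in> ?S" for a z
    using sum_vertex_stubs[OF d0 that, of "\<lambda>b. \<Phi> (fst (G b)) z"] by (simp add: vertex_of_def)
  then have "(\<Sum>a\<in>?S. \<Sum>i<d. \<Phi> (vertex_of G (fst a) i) (fst (walk d G w a))) =
     (\<Sum>a\<in>?S. \<Phi> (fst (G a)) (fst (walk d G w a))) + 
     (\<Sum>j\<in>{1..<d}. \<Sum>a\<in>?S. \<Phi> (fst (G (rot d j a))) (fst (walk d G w a)))" for w
    by (subst (2) sum.swap) (simp add: sum.distrib)
  \<comment> \<open>The rotation by \<open>d - j\<close> undoes that by \<open>j\<close> and is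
    again an admissible letter, so the lengthened path starts at \<open>G (rot d j a)\<close> and is
    coded by \<open>(d - j) # w\<close>.\<close>
  moreover have "(\<Sum>a\<in>?S. \<Phi> (fst (G (rot d j a))) (fst (walk d G w a))) = f ((d - j) # w)" if "j \<in> {1..<d}" for j w
  proof -
    have b: "bij_betw (\<lambda>a. G (rot d j a)) ?S ?S"
      using bij_betw_trans[OF bij_rot[OF d0] bij_match[OF G]] by (simp add: o_def)
    have "f ((d - j) # w) = (\<Sum>a\<in>?S. \<Phi> (fst (G (rot d j a))) (fst (walk d G ((d - j) # w) (G (rot d j a)))))"
      unfolding f_def by (rule sum.reindex_bij_betw[OF b, symmetric])
    also have "\<dots> = (\<Sum>a\<in>?S. \<Phi> (fst (G (rot d j a))) (fst (walk d G w a)))"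
      using that by (intro sum.cong refl) (simp add: match_inv[OF G] rot_rot)
    finally show ?thesis by simp
  qed
  ultimately have "(\<Sum>w\<in>words d (Suc k). \<Sum>a\<in>stubs n d. \<Sum>i<d. \<Phi> (vertex_of G (fst a) i) (fst (walk d G w a))) =
     (\<Sum>w\<in>words d (Suc k). \<Sum>a\<in>?S. \<Phi> (fst (G a)) (fst (walk d G w a))) + (\<Sum>w\<in>words d (Suc k). \<Sum>j\<in>{1..<d}. f ((d - j) # w))"
    by (simp add: sum.distrib)
  also have "(\<Sum>w\<in>words d (Suc k). \<Sum>j\<in>{1..<d}. f ((d - j) # w)) = (\<Sum>j\<in>{1..<d}. \<Sum>w\<in>words d (Suc k). f ((d - j) # w))"
    by (rule sum.swap)
  also have "\<dots> = (\<Sum>j\<in>{1..<d}. \<Sum>w\<in>words d (Suc k). f (j # w))"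
    by (rule sum.reindex_bij_witness[where i = "\<lambda>j. d - j" and j = "\<lambda>j. d - j"]) auto
  also have "\<dots> = (\<Sum>w\<in>words d (Suc (Suc k)). f w)" by (rule sum_words_Cons[symmetric])
  also have "(\<Sum>w\<in>words d (Suc k). \<Sum>a\<in>?S. \<Phi> (fst (G a)) (fst (walk d G w a))) = 
     (\<Sum>j\<in>{1..<d}. \<Sum>w\<in>words d k. \<Sum>a\<in>?S. \<Phi> (fst (G a)) (fst (walk d G w (rot d j (G a)))))"
    by (simp add: sum_words_Cons)
  also have "\<dots> = (\<Sum>j\<in>{1..<d}. \<Sum>w\<in>words d k. f w)"
  proof (intro sum.cong refl)
    fix j w
    show "(\<Sum>a\<in>?S. \<Phi> (fst (G a)) (fst (walk d G w (rot d j (G a))))) = f w"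
      using sum.reindex_bij_betw[OF bij_step[OF G d0, of j], of "\<lambda>b. \<Phi> (fst b) (fst (walk d G w b))"]
      by (simp add: f_def)
  qed
  also have "\<dots> = (real d - 1) * (\<Sum>w\<in>words d k. f w)" using d by (simp add: of_nat_diff)
  finally show ?thesis by (simp add: f sum_distrib_left algebra_simps)
qed

text \<open>At the far end the last letter \<open>l\<close> only selects a stub, so the path of
  \<open>w @ [l]\<close> ends at the vertex of \<open>G (walk d G w a)\<close>. That stub leads back
  and shortens the path; the other \<open>d - 1\<close> stubs lengthen it, and \<open>l\<close> is
  carried along as a dummy last letter.\<close>

lemma sum_end_step:
  "(\<Sum>w\<in>words d (Suc k). \<Sum>a\<in>stubs n d. \<Sum>i<d. \<Phi> (fst a) (vertex_of G (fst (walk d G w a)) i)) =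
   real (d * n) * ((real d - 1) * (\<Sum>w\<in>words d k. wavg n d \<Phi> G w) + (\<Sum>w\<in>words d (Suc (Suc k)). wavg n d \<Phi> G w))"
proof -
  let ?S = "stubs n d" and ?N = "real (d * n)"
  have d0: "0 < d" using d by simp
  define f where "f w = (\<Sum>a\<in>?S. \<Phi> (fst a) (fst (walk d G w a)))" for w
  have f: "f w = ?N * wavg n d \<Phi> G w" for w using n d by (simp add: f_def wavg_def)
  have e: "(\<Sum>a\<in>?S. \<Sum>i<d. \<Phi> (fst a) (vertex_of G (fst (walk d G (w @ [l]) a)) i)) =
      f w + (\<Sum>j\<in>{1..<d}. f ((w @ [j]) @ [l]))" for w l
  proof -
    have "(\<Sum>i<d. \<Phi> (fst a) (vertex_of G (fst (walk d G (w @ [l]) a)) i)) = 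
       \<Phi> (fst a) (fst (walk d G w a)) + (\<Sum>j\<in>{1..<d}. \<Phi> (fst a) (fst (walk d G ((w @ [j]) @ [l]) a)))"
      if "a \<in> ?S" for a
      using sum_vertex_stubs[OF d0 match_in[OF G walk_in[OF G d0 that]], of "\<lambda>b. \<Phi> (fst a) (fst (G b))" w]
      by (simp add: vertex_of_def walk_append match_inv[OF G])
    then have "(\<Sum>a\<in>?S. \<Sum>i<d. \<Phi> (fst a) (vertex_of G (fst (walk d G (w @ [l]) a)) i)) = 
       f w + (\<Sum>a\<in>?S. \<Sum>j\<in>{1..<d}. \<Phi> (fst a) (fst (walk d G ((w @ [j]) @ [l]) a)))"
      by (simp add: sum.distrib f_def)
    also have "(\<Sum>a\<in>?S. \<Sum>j\<in>{1..<d}. \<Phi> (fst a) (fst (walk d G ((w @ [j]) @ [l]) a))) = (\<Sum>j\<in>{1..<d}. f ((w @ [j]) @ [l]))"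
      unfolding f_def by (rule sum.swap)
    finally show ?thesis .
  qed
  have "(\<Sum>w\<in>words d (Suc k). \<Sum>a\<in>?S. \<Sum>i<d. \<Phi> (fst a) (vertex_of G (fst (walk d G w a)) i)) =
     (\<Sum>l\<in>{1..<d}. \<Sum>w\<in>words d k. f w + (\<Sum>j\<in>{1..<d}. f ((w @ [j]) @ [l])))"
    by (simp only: sum_words_snoc e)
  also have "\<dots> = (\<Sum>l\<in>{1..<d}. \<Sum>w\<in>words d k. f w) + (\<Sum>l\<in>{1..<d}. \<Sum>j\<in>{1..<d}. \<Sum>w\<in>words d k. f ((w @ [j]) @ [l]))"
    by (simp only: sum.distrib sum.swap[of _ "words d k"])
  also have "(\<Sum>l\<in>{1..<d}. \<Sum>j\<in>{1..<d}. \<Sum>w\<in>words d k. f ((w @ [j]) @ [l])) = (\<Sum>w\<in>words d (Suc (Suc k)). f w)"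
    by (simp only: sum_words_snoc)
  also have "(\<Sum>l\<in>{1..<d}. \<Sum>w\<in>words d k. f w) = (real d - 1) * (\<Sum>w\<in>words d k. f w)" using d by (simp add: of_nat_diff)
  finally show ?thesis by (simp add: f sum_distrib_left algebra_simps)
qed

text \<open>Dividing by \<open>(d - 1) ^ Suc k\<close> turns the two step formulas into the weights
  \<open>1 / d\<close> and \<open>(d - 1) / d\<close>; both ends contribute the same, hence the
  factor 2. The only error comes from paths whose end vertices coincide.\<close>

lemma Lvot_davg:
  "\<bar>Lvot n d G (davg n d (Suc k) G) \<eta> - 2 * (davg n d k G \<eta> / real d
      + (real d - 1) / real d * davg n d (Suc (Suc k)) G \<eta> - davg n d (Suc k) G \<eta>)\<bar> \<le> 2 * ravg n d (Suc k) G"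
proof -
  let ?S = "stubs n d" and ?W = "words d (Suc k)"
  define N where "N = real (d * n)"
  have d0: "0 < d" using d by simp
  have N: "N > 0" using n d0 by (simp add: N_def)
  define q where "q = real d - 1"
  have q: "q > 0" using d by (simp add: q_def)
  have fin: "fst a < n" if "a \<in> ?S" for a using that by (auto simp: stubs_def)
  define Q where "Q k = (\<Sum>w\<in>words d k. wavg n d (disc \<eta>) G w)" for k
  have Q: "Q k = q ^ k * davg n d k G \<eta>" for k using q by (simp add: davg_def Q_def q_def)
  define U where "U w a = (\<Sum>i<d. disc \<eta> (vertex_of G (fst a) i) (fst (walk d G w a)))" for w a
  define V where "V w a = (\<Sum>i<d. disc \<eta> (fst a) (vertex_of G (fst (walk d G w a)) i))" for w a
  define L where "L w a = Lvot n d G (\<lambda>\<eta>. disc \<eta> (fst a) (fst (walk d G w a))) \<eta>" for w a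
  define c where "c w a = disc \<eta> (fst a) (fst (walk d G w a))" for w a
  have err: "\<bar>L w a - (U w a / real d + V w a / real d - 2 * c w a)\<bar> \<le> 2 * of_bool (fst a = fst (walk d G w a))"
    if "a \<in> ?S" for w a
    unfolding L_def U_def V_def c_def by (rule Lvot_disc[OF d0 fin[OF that] fin[OF walk_in[OF G d0 that]]])
  have U: "(\<Sum>w\<in>?W. \<Sum>a\<in>?S. U w a) = N * (q * Q k + Q (Suc (Suc k)))"
    unfolding U_def sum_start_step by (simp add: N_def q_def Q_def)
  have V: "(\<Sum>w\<in>?W. \<Sum>a\<in>?S. V w a) = N * (q * Q k + Q (Suc (Suc k)))"
    unfolding V_def sum_end_step by (simp add: N_def q_def Q_def)
  have c: "(\<Sum>w\<in>?W. \<Sum>a\<in>?S. c w a) = N * Q (Suc k)"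
    using n d by (simp add: c_def Q_def wavg_def N_def sum_divide_distrib[symmetric])
  have Leq: "Lvot n d G (davg n d (Suc k) G) \<eta> = (\<Sum>w\<in>?W. \<Sum>a\<in>?S. L w a) / N / q ^ Suc k"
    unfolding davg_def wavg_def L_def N_def q_def
    by (simp only: Lvot_divide Lvot_sum sum_divide_distrib)
  have "\<bar>(\<Sum>w\<in>?W. \<Sum>a\<in>?S. L w a - (U w a / real d + V w a / real d - 2 * c w a))\<bar>
       \<le> (\<Sum>w\<in>?W. \<Sum>a\<in>?S. 2 * of_bool (fst a = fst (walk d G w a)))"
    by (intro order.trans[OF sum_abs] sum_mono err)
  also have "\<dots> = 2 * N * (\<Sum>w\<in>?W. ret n d G w)"
    using n d by (simp add: ret_def wavg_def N_def sum_divide_distrib[symmetric] sum_distrib_left[symmetric]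
        del: sum_mult_of_bool_eq sum_of_bool_eq)
  also have "\<dots> = 2 * N * q ^ Suc k * ravg n d (Suc k) G" using q by (simp add: ravg_def q_def)
  also have "(\<Sum>w\<in>?W. \<Sum>a\<in>?S. L w a - (U w a / real d + V w a / real d - 2 * c w a)) = 
     (\<Sum>w\<in>?W. \<Sum>a\<in>?S. L w a) - ((\<Sum>w\<in>?W. \<Sum>a\<in>?S. U w a) / real d + (\<Sum>w\<in>?W. \<Sum>a\<in>?S. V w a) / real d
       - 2 * (\<Sum>w\<in>?W. \<Sum>a\<in>?S. c w a))"
    by (simp add: sum_subtractf sum.distrib sum_divide_distrib sum_distrib_left)
  also have "\<dots> = N * q ^ Suc k * (Lvot n d G (davg n d (Suc k) G) \<eta> - 2 * (davg n d k G \<eta> / real d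
      + q / real d * davg n d (Suc (Suc k)) G \<eta> - davg n d (Suc k) G \<eta>))"
    unfolding Leq U V c Q using N q d0 by (simp add: field_simps)
  finally have "N * q ^ Suc k * \<bar>Lvot n d G (davg n d (Suc k) G) \<eta> - 2 * (davg n d k G \<eta> / real d
      + q / real d * davg n d (Suc (Suc k)) G \<eta> - davg n d (Suc k) G \<eta>)\<bar> \<le> N * q ^ Suc k * (2 * ravg n d (Suc k) G)"
    using N q by (simp add: abs_mult mult.assoc mult.left_commute)
  then show ?thesis using N q by (simp add: q_def)
qed

end

section \<open>The continued fraction\<close>

context
  fixes d :: nat and nu :: real
  assumes d: "3 \<le> d" and nu: "0 < nu"
begin

lemma beta_facts: "1 < beta_d d" "(beta_d d)\<^sup>2 = real d - 1" "0 < rho_d d" "rho_d d * real d = 2 * beta_d d"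
  using d by (auto simp: beta_d_def rho_d_def)

text \<open>In this form \<open>1 / beta_d d\<close> is visibly a fixed point of
  \<open>x \<mapsto> 1 / (a - x)\<close> when the \<open>nu\<close> term is dropped; it serves as
  barrier for all truncations.\<close>

lemma cf_coef_eq: "cf_coef d nu i = beta_d d + 1 / beta_d d + real i * nu / rho_d d"
proof -
  have "2 / rho_d d = real d / beta_d d" using d by (simp add: rho_d_def beta_d_def)
  also have "\<dots> = ((beta_d d)\<^sup>2 + 1) / beta_d d" using beta_facts(2) by simp
  also have "\<dots> = beta_d d + 1 / beta_d d" using beta_facts(1) by (simp add: field_simps power2_eq_square)
  finally show ?thesis by (simp add: cf_coef_def add_divide_distrib)
qed

text \<open>The bound \<open>1 / beta_d d\<close> on the level below cancels the same term of the
  coefficient, so it reproduces itself. The summand \<open>m * nu / rho_d d\<close> is kept because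
  its growth in \<open>m\<close> later forces the last corrector coefficient to be small.\<close>

lemma cf_trunc_bounds:
  "0 \<le> cf_trunc (cf_coef d nu) m k \<and> cf_trunc (cf_coef d nu) m k \<le> 1 / (beta_d d + real m * nu / rho_d d)"
proof (induction k arbitrary: m)
  case 0
  show ?case using beta_facts nu by simp
next
  case (Suc k)
  let ?b = "beta_d d" and ?x = "cf_trunc (cf_coef d nu) (Suc m) k"
  have "?b \<le> ?b + real (Suc m) * nu / rho_d d" "0 \<le> real m * nu / rho_d d"
    using beta_facts nu by (auto intro!: divide_nonneg_nonneg simp del: of_nat_Suc)
  then have "1 / (?b + real (Suc m) * nu / rho_d d) \<le> 1 / ?b"
    using beta_facts(1) by (intro divide_left_mono) auto
  then have "?x \<le> 1 / ?b" using Suc[of "Suc m"] by linarith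
  then have "?b + real m * nu / rho_d d \<le> cf_coef d nu m - ?x"
    unfolding cf_coef_eq by linarith
  moreover have "0 < ?b + real m * nu / rho_d d" using \<open>0 \<le> real m * nu / rho_d d\<close> beta_facts(1) by linarith
  ultimately show ?case by (auto intro!: divide_left_mono mult_pos_pos)
qed

lemma cf_denominator_pos: "0 < cf_coef d nu m - cf_trunc (cf_coef d nu) (Suc m) k"
proof -
  let ?b = "beta_d d"
  have "?b \<le> ?b + real (Suc m) * nu / rho_d d" "0 \<le> real m * nu / rho_d d"
    using beta_facts nu by (auto intro!: divide_nonneg_nonneg simp del: of_nat_Suc)
  then have "1 / (?b + real (Suc m) * nu / rho_d d) \<le> 1 / ?b"
    using beta_facts(1) by (intro divide_left_mono) auto
  then have "cf_trunc (cf_coef d nu) (Suc m) k \<le> 1 / ?b" using cf_trunc_bounds[of "Suc m" k] by linarith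
  then show ?thesis unfolding cf_coef_eq using \<open>0 \<le> real m * nu / rho_d d\<close> beta_facts(1) by linarith
qed

text \<open>One more level replaces the innermost 0 by a nonnegative number, and each level is
  increasing in the one below it as long as denominators stay positive.\<close>

lemma cf_trunc_mono: "cf_trunc (cf_coef d nu) m k \<le> cf_trunc (cf_coef d nu) m (Suc k)"
proof (induction k arbitrary: m)
  case 0
  show ?case using cf_trunc_bounds[of m 1] by simp
next
  case (Suc k)
  show ?case
    using Suc[of "Suc m"] cf_denominator_pos[of m k] cf_denominator_pos[of m "Suc k"]
    by (subst (1 2) cf_trunc.simps, intro divide_left_mono) auto
qed

lemma cf_trunc_tendsto_Delta: "(\<lambda>N. cf_trunc (cf_coef d nu) 1 N) \<longlonglongrightarrow> Delta d nu"
proof -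
  have inc: "incseq (cf_trunc (cf_coef d nu) 1)" by (rule incseq_SucI) (rule cf_trunc_mono)
  have "\<forall>N. cf_trunc (cf_coef d nu) 1 N \<le> 1 / (beta_d d + real 1 * nu / rho_d d)"
    using cf_trunc_bounds[of 1] by simp
  from incseq_convergent[OF inc this] obtain L where L: "cf_trunc (cf_coef d nu) 1 \<longlonglongrightarrow> L" by metis
  then have "Delta d nu = L" unfolding Delta_def by (rule limI)
  then show ?thesis using L by simp
qed

text \<open>The barrier passes to the limit, and \<open>d \<ge> 3\<close> gives
  \<open>beta_d d > 1\<close>, so \<open>Delta d nu \<le> 1 / beta_d d < beta_d d\<close>.\<close>

lemma theta_pos: "0 < theta d nu"
proof -
  let ?b = "beta_d d"
  have "1 / (?b + real 1 * nu / rho_d d) \<le> 1 / ?b"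
    using beta_facts nu by (intro divide_left_mono) (auto intro!: mult_pos_pos add_pos_pos)
  then have "cf_trunc (cf_coef d nu) 1 N \<le> 1 / ?b" for N
    using cf_trunc_bounds[of 1 N] by linarith
  then have "Delta d nu \<le> 1 / ?b" by (intro LIMSEQ_le_const2[OF cf_trunc_tendsto_Delta]) auto
  also have "\<dots> < 1" using beta_facts(1) by simp
  finally have "Delta d nu < ?b" using beta_facts(1) by linarith
  then show ?thesis using beta_facts(1) by (simp add: theta_def)
qed

text \<open>The recursion says that the total coefficient of the \<open>k\<close>-th defect
  vanishes. With \<open>c (Suc K) = 0\<close> it is solved through ratios of successive
  coefficients: inserting \<open>c k = beta_d d * x k * c (k - 1)\<close> turns it into
  \<open>x k * (a k - x (Suc k)) = 1\<close>, which is the continued fraction.\<close>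

lemma corrector_coefficients:
  assumes K: "1 \<le> K"
  shows "\<exists>c. (real d - 1) * (2 / real d) * c 0 = 1 \<and> 2 / real d * c 1 = cf_trunc (cf_coef d nu) 1 K / beta_d d \<and>
     (\<forall>k\<in>{1..K}. 2 / real d * c (Suc k) + (real d - 1) * (2 / real d) * c (k - 1) = (2 + nu * real k) * c k) \<and>
     c (Suc K) = 0 \<and> 0 \<le> c K \<and> c K \<le> 1 / (nu * real K)"
proof -
  define b where "b = beta_d d"
  define r where "r = rho_d d"
  define a where "a = cf_coef d nu"
  \<comment> \<open>The depth \<open>Suc K - k\<close> makes all \<open>x k\<close> share one
    truncated tail: it is 0 at \<open>k = Suc K\<close>, which gives \<open>c (Suc K) = 0\<close>,
    and \<open>K\<close> at \<open>k = 1\<close>.\<close>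
  define x where "x k = cf_trunc a k (Suc K - k)" for k
  \<comment> \<open>The prefactor is dictated by the normalisation of \<open>c 0\<close>, since
    \<open>(d - 1) * (2 / d)\<close> equals \<open>b * r\<close>.\<close>
  define c where "c k = 1 / (b * r) * (\<Prod>j\<in>{1..k}. b * x j)" for k
  have b1: "1 < b" and b2: "b * b = real d - 1" and r0: "0 < r" and rd: "2 / real d = r / b"
    using beta_facts d by (auto simp: b_def r_def power2_eq_square field_simps)
  have c0: "(real d - 1) * (2 / real d) * c 0 = 1"
    unfolding b2[symmetric] rd using b1 r0 by (simp add: c_def)
  have cS: "c (Suc k) = b * x (Suc k) * c k" for k by (simp add: c_def)
  have x_rec: "x k * (a k - x (Suc k)) = 1" if "k \<in> {1..K}" for k
  proof -
    have "Suc K - k = Suc (Suc K - Suc k)" using that by auto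
    then have "x k = 1 / (a k - x (Suc k))" by (simp add: x_def)
    moreover have "a k - x (Suc k) > 0" unfolding x_def a_def by (rule cf_denominator_pos)
    ultimately show ?thesis by simp
  qed
  have rec: "2 / real d * c (Suc k) + (real d - 1) * (2 / real d) * c (k - 1) = (2 + nu * real k) * c k"
    if k: "k \<in> {1..K}" for k
  proof -
    obtain l where l: "k = Suc l" using k by (cases k) auto
    have 1: "c k = b * x k * c (k - 1)" using cS[of l] l by simp
    have "2 / real d * c (Suc k) + (real d - 1) * (2 / real d) * c (k - 1) = r * x (Suc k) * c k + r * b * c (k - 1)"
      unfolding rd cS b2[symmetric] using b1 by simp
    also have "b * c (k - 1) = c k * (a k - x (Suc k))"
      unfolding 1 using x_rec[OF k] by (simp add: algebra_simps) (metis distrib_left mult.assoc mult.commute mult.right_neutral)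
    then have "r * b * c (k - 1) = r * (c k * (a k - x (Suc k)))" by simp
    also have "r * x (Suc k) * c k + r * (c k * (a k - x (Suc k))) = r * a k * c k" by (simp add: algebra_simps)
    also have "r * a k = 2 + nu * real k" using r0 by (simp add: a_def cf_coef_def r_def)
    finally show ?thesis .
  qed
  have x0: "0 \<le> x k" and xb: "b * x k \<le> 1" for k
  proof -
    show "0 \<le> x k" using cf_trunc_bounds[of k] by (simp add: x_def a_def)
    have "0 \<le> real k * nu / r" using nu r0 by simp
    then have "1 / (b + real k * nu / r) \<le> 1 / b" using b1 by (intro divide_left_mono) (auto intro!: mult_pos_pos)
    then have "x k \<le> 1 / b" using cf_trunc_bounds[of k "Suc K - k"] by (simp add: x_def a_def b_def r_def)
    then show "b * x k \<le> 1" using b1 by (simp add: field_simps)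
  qed
  \<comment> \<open>All factors of the product but the last are at most 1; the last one contains
    \<open>x K \<le> r / (nu * K)\<close>.\<close>
  have cK: "c K \<le> 1 / (nu * real K)"
  proof -
    obtain l where l: "K = Suc l" using K by (cases K) auto
    have p: "(\<Prod>j\<in>{1..l}. b * x j) \<le> 1" using x0 xb b1 by (intro prod_le_1) auto
    have p0: "0 \<le> (\<Prod>j\<in>{1..l}. b * x j)" using x0 b1 by (intro prod_nonneg) auto
    have "x K \<le> 1 / (b + real K * nu / r)"
      using cf_trunc_bounds[of K "Suc K - K"] by (simp add: x_def a_def b_def r_def)
    also have "\<dots> \<le> 1 / (real K * nu / r)"
      using b1 nu r0 K by (intro divide_left_mono) (auto intro!: mult_pos_pos add_pos_pos divide_pos_pos)
    finally have xK: "x K \<le> r / (nu * real K)" by (simp add: mult.commute)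
    have "c K = 1 / r * x K * (\<Prod>j\<in>{1..l}. b * x j)" using b1 l by (simp add: c_def)
    also have "\<dots> \<le> 1 / r * x K * 1" using p p0 x0 r0 by (intro mult_left_mono) auto
    also have "\<dots> \<le> 1 / r * (r / (nu * real K)) * 1" using xK r0 by (intro mult_left_mono mult_right_mono) auto
    finally show ?thesis using r0 by simp
  qed
  have "c 1 = 1 / r * x 1" using b1 by (simp add: c_def)
  then have c1: "2 / real d * c 1 = cf_trunc (cf_coef d nu) 1 K / beta_d d"
    unfolding rd using r0 K by (simp add: x_def a_def b_def)
  have "0 \<le> c K" unfolding c_def using x0 b1 r0 by (intro mult_nonneg_nonneg prod_nonneg) auto
  moreover have "c (Suc K) = 0" by (simp add: cS x_def)
  ultimately show ?thesis using c0 c1 rec cK by (intro exI[of _ c]) blast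
qed

end

section \<open>Generator and semigroup\<close>

lemma finite_matchings [simp]: "finite (matchings n d)"
proof (rule finite_imageD)
  show "finite ((\<lambda>G. restrict G (stubs n d)) ` matchings n d)"
    by (rule finite_subset[OF _ finite_PiE[of "stubs n d" "\<lambda>_. stubs n d"]])
       (auto simp: matchings_def PiE_def Pi_def extensional_def)
  show "inj_on (\<lambda>G. restrict G (stubs n d)) (matchings n d)"
  proof (rule inj_onI)
    fix G H assume *: "G \<in> matchings n d" "H \<in> matchings n d" "restrict G (stubs n d) = restrict H (stubs n d)"
    show "G = H"
    proof
      fix s
      show "G s = H s"
        using match_out[OF *(1), of s] match_out[OF *(2), of s] fun_cong[OF *(3), of s] by (cases "s \<in> stubs n d") auto
    qed
  qed
qed

lemma finite_opinions [simp]: "finite (opinions n)"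
proof (rule finite_imageD)
  show "finite (Collect ` opinions n)"
    by (rule finite_subset[of _ "Pow {..<n}"]) (auto simp: opinions_def not_less[symmetric])
  show "inj_on Collect (opinions n)" by (auto simp: inj_on_def)
qed

lemma finite_vstates [simp]: "finite (vstates n d)"
  by (simp add: vstates_def)

text \<open>Several moves may lead to the same state, so the rates are resummed over moves instead
  of targets; this loses nothing because all moves stay inside \<open>vstates\<close>.\<close>

lemma sum_rate:
  assumes G: "G \<in> matchings n d" and \<eta>: "\<eta> \<in> opinions n"
  shows "(\<Sum>b\<in>vstates n d. rate n d nu (G, \<eta>) b * g b) =
     nu / 4 * (1 / (real (d * n) - 1)) * (\<Sum>s\<in>stubs n d. \<Sum>t\<in>stubs n d. if s \<noteq> t \<and> G s \<noteq> t then g (rewire G s t, \<eta>) else 0)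
     + (\<Sum>x<n. \<Sum>i<d. g (G, \<eta>(x := \<eta> (vertex_of G x i)))) / real d"
proof -
  let ?S = "vstates n d" and ?B = "stubs n d"
  let ?c = "nu / 4 * (1 / (real (d * n) - 1))"
  have r: "rate n d nu (G, \<eta>) b * g b = (\<Sum>s\<in>?B. \<Sum>t\<in>?B. if b = (rewire G s t, \<eta>) then if s \<noteq> t \<and> G s \<noteq> t then ?c * g b else 0 else 0)
     + (\<Sum>x<n. \<Sum>i<d. if b = (G, \<eta>(x := \<eta> (vertex_of G x i))) then g b / real d else 0)" for b
  proof -
    obtain G' \<eta>' where b: "b = (G', \<eta>')" by (cases b)
    have 1: "(if \<eta>' = \<eta> then (\<Sum>s\<in>?B. \<Sum>t\<in>?B. if s \<noteq> t \<and> G s \<noteq> t \<and> rewire G s t = G' then ?c else 0) else 0) * g b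
       = (\<Sum>s\<in>?B. \<Sum>t\<in>?B. if b = (rewire G s t, \<eta>) then if s \<noteq> t \<and> G s \<noteq> t then ?c * g b else 0 else 0)"
      unfolding b by (auto simp: sum_distrib_right intro!: sum.cong sum.neutral)
    have 2: "(if G' = G then (\<Sum>x<n. \<Sum>i<d. if \<eta>(x := \<eta> (vertex_of G x i)) = \<eta>' then 1 / real d else 0) else 0) * g b
       = (\<Sum>x<n. \<Sum>i<d. if b = (G, \<eta>(x := \<eta> (vertex_of G x i))) then g b / real d else 0)"
      unfolding b by (auto simp: sum_distrib_right intro!: sum.cong sum.neutral)
    show ?thesis unfolding 1[symmetric] 2[symmetric] by (simp add: rate_def b distrib_right)
  qed
  have in1: "(rewire G s t, \<eta>) \<in> ?S" if "s \<in> ?B" "t \<in> ?B" "s \<noteq> t" "G s \<noteq> t" for s t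
    using reswap_matching[OF G match_in[OF G that(1)] that(2)] \<eta> rewire_eq_reswap[OF G that]
    by (simp add: vstates_def)
  have in2: "(G, \<eta>(x := \<eta> (vertex_of G x i))) \<in> ?S" if "x < n" for x i
    using that \<eta> G by (auto simp: vstates_def opinions_def)
  have "(\<Sum>b\<in>?S. rate n d nu (G, \<eta>) b * g b) =
     (\<Sum>b\<in>?S. \<Sum>s\<in>?B. \<Sum>t\<in>?B. if b = (rewire G s t, \<eta>) then if s \<noteq> t \<and> G s \<noteq> t then ?c * g b else 0 else 0)
     + (\<Sum>b\<in>?S. \<Sum>x<n. \<Sum>i<d. if b = (G, \<eta>(x := \<eta> (vertex_of G x i))) then g b / real d else 0)"
    by (simp only: r sum.distrib)
  also have "(\<Sum>b\<in>?S. \<Sum>s\<in>?B. \<Sum>t\<in>?B. if b = (rewire G s t, \<eta>) then if s \<noteq> t \<and> G s \<noteq> t then ?c * g b else 0 else 0) =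
     (\<Sum>s\<in>?B. \<Sum>t\<in>?B. \<Sum>b\<in>?S. if b = (rewire G s t, \<eta>) then if s \<noteq> t \<and> G s \<noteq> t then ?c * g b else 0 else 0)"
    by (simp only: sum.swap[of _ ?B ?S])
  also have "\<dots> = (\<Sum>s\<in>?B. \<Sum>t\<in>?B. ?c * (if s \<noteq> t \<and> G s \<noteq> t then g (rewire G s t, \<eta>) else 0))"
    using in1 by (intro sum.cong refl) (auto simp: sum.delta)
  also have "(\<Sum>b\<in>?S. \<Sum>x<n. \<Sum>i<d. if b = (G, \<eta>(x := \<eta> (vertex_of G x i))) then g b / real d else 0) =
     (\<Sum>x<n. \<Sum>i<d. \<Sum>b\<in>?S. if b = (G, \<eta>(x := \<eta> (vertex_of G x i))) then g b / real d else 0)"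
    by (simp only: sum.swap[of _ "{..<n}" ?S] sum.swap[of _ "{..<d}" ?S])
  also have "\<dots> = (\<Sum>x<n. \<Sum>i<d. g (G, \<eta>(x := \<eta> (vertex_of G x i))) / real d)"
    using in2 by (intro sum.cong refl) (auto simp: sum.delta)
  finally show ?thesis by (simp only: sum_distrib_left sum_divide_distrib)
qed

definition Lgen :: "nat \<Rightarrow> nat \<Rightarrow> real \<Rightarrow> (vstate \<Rightarrow> real) \<Rightarrow> vstate \<Rightarrow> real" where
  "Lgen n d nu f a = (\<Sum>b\<in>vstates n d. gen n d nu a b * f b)"

text \<open>The diagonal of \<open>gen\<close> subtracts the total rate including self-rates, so
  voter updates that copy an equal opinion drop out. The excluded stub pairs can be put back because
  they rewire trivially, and replacing \<open>s\<close> by \<open>G s\<close> turns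
  \<open>rewire\<close> into conjugation, which leaves unrestricted sums over stubs.\<close>

lemma Lgen_eq:
  assumes a: "(G, \<eta>) \<in> vstates n d"
  shows "Lgen n d nu f (G, \<eta>) = Lrew n d nu (\<lambda>G. f (G, \<eta>)) G + Lvot n d G (\<lambda>\<eta>. f (G, \<eta>)) \<eta>"
proof -
  let ?S = "vstates n d" and ?B = "stubs n d" and ?a = "(G, \<eta>)"
  have G: "G \<in> matchings n d" and \<eta>: "\<eta> \<in> opinions n" using a by (auto simp: vstates_def)
  have "Lgen n d nu f ?a = (\<Sum>b\<in>?S. rate n d nu ?a b * f b) - (\<Sum>b\<in>?S. if ?a = b then (\<Sum>c\<in>?S. rate n d nu ?a c) * f b else 0)"
    unfolding Lgen_def gen_def by (simp add: left_diff_distrib sum_subtractf if_distrib[of "\<lambda>x. x * _"] cong: if_cong)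
  also have "(\<Sum>b\<in>?S. if ?a = b then (\<Sum>c\<in>?S. rate n d nu ?a c) * f b else 0) = (\<Sum>c\<in>?S. rate n d nu ?a c) * f ?a"
    using a by (simp add: sum.delta)
  finally have "Lgen n d nu f ?a = (\<Sum>b\<in>?S. rate n d nu ?a b * (f b - f ?a))"
    by (simp add: sum_subtractf right_diff_distrib sum_distrib_right)
  also have "\<dots> = nu / 4 * (1 / (real (d * n) - 1)) * (\<Sum>s\<in>?B. \<Sum>t\<in>?B. if s \<noteq> t \<and> G s \<noteq> t then f (rewire G s t, \<eta>) - f ?a else 0)
     + (\<Sum>x<n. \<Sum>i<d. f (G, \<eta>(x := \<eta> (vertex_of G x i))) - f ?a) / real d" by (rule sum_rate[OF G \<eta>])
  also have "(\<Sum>s\<in>?B. \<Sum>t\<in>?B. if s \<noteq> t \<and> G s \<noteq> t then f (rewire G s t, \<eta>) - f ?a else 0) =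
     (\<Sum>s\<in>?B. \<Sum>t\<in>?B. f (reswap (G s) t G, \<eta>) - f ?a)"
  proof (intro sum.cong refl)
    fix s t assume st: "s \<in> ?B" "t \<in> ?B"
    show "(if s \<noteq> t \<and> G s \<noteq> t then f (rewire G s t, \<eta>) - f ?a else 0) = f (reswap (G s) t G, \<eta>) - f ?a"
      using rewire_eq_reswap[OF G st] reswap_triv[OF G, of t "G s"] by (auto simp: match_inv[OF G])
  qed
  also have "\<dots> = (\<Sum>s\<in>?B. \<Sum>t\<in>?B. f (reswap s t G, \<eta>) - f ?a)"
    by (rule sum.reindex_bij_betw[OF bij_match[OF G], of "\<lambda>s. \<Sum>t\<in>?B. f (reswap s t G, \<eta>) - f ?a"])
  finally show ?thesis by (simp only: Lrew_def Lvot_def times_divide_times_eq mult_1_right)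
qed

section \<open>The matrix exponential and its forward equation\<close>

definition semigr :: "nat \<Rightarrow> nat \<Rightarrow> real \<Rightarrow> real \<Rightarrow> (vstate \<Rightarrow> real) \<Rightarrow> vstate \<Rightarrow> real" where
  "semigr n d nu t f a = (\<Sum>b\<in>vstates n d. trans_prob n d nu t a b * f b)"

context
  fixes S :: "'s set" and Q :: "'s \<Rightarrow> 's \<Rightarrow> real"
  assumes S: "finite S"
begin

text \<open>The sum of all absolute entries serves as a crude matrix norm; the resulting geometric
  bound makes the exponential series converge at every time.\<close>

lemma mpow_bound:
  assumes "a \<in> S" shows "\<bar>mpow S Q k a b\<bar> \<le> (\<Sum>a\<in>S. \<Sum>b\<in>S. \<bar>Q a b\<bar>) ^ k"
  using assms
proof (induction k arbitrary: a)
  case (Suc k)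
  let ?q = "\<Sum>a\<in>S. \<Sum>b\<in>S. \<bar>Q a b\<bar>"
  have "\<bar>mpow S Q (Suc k) a b\<bar> \<le> (\<Sum>c\<in>S. \<bar>Q a c\<bar> * \<bar>mpow S Q k c b\<bar>)"
    by (simp add: abs_mult[symmetric])
  also have "\<dots> \<le> (\<Sum>c\<in>S. \<bar>Q a c\<bar> * ?q ^ k)" using Suc.IH by (intro sum_mono mult_left_mono) auto
  also have "\<dots> = (\<Sum>c\<in>S. \<bar>Q a c\<bar>) * ?q ^ k" by (simp add: sum_distrib_right)
  also have "(\<Sum>c\<in>S. \<bar>Q a c\<bar>) \<le> ?q"
    using S Suc.prems by (intro member_le_sum[of a S "\<lambda>a. \<Sum>c\<in>S. \<bar>Q a c\<bar>"]) (auto intro: sum_nonneg)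
  then have "(\<Sum>c\<in>S. \<bar>Q a c\<bar>) * ?q ^ k \<le> ?q * ?q ^ k"
    by (intro mult_right_mono zero_le_power sum_nonneg) auto
  finally show ?case by simp
qed simp

text \<open>\<open>mpow\<close> peels off the first factor. Peeling off the last one puts the
  generator next to the test function, so that the derivative of \<open>semigr\<close> is again a
  \<open>semigr\<close>.\<close>

lemma mpow_Suc_right:
  assumes "a \<in> S" "b \<in> S" shows "mpow S Q (Suc k) a b = (\<Sum>c\<in>S. mpow S Q k a c * Q c b)"
  using assms(1)
proof (induction k arbitrary: a)
  case 0
  have "(\<Sum>c\<in>S. Q a c * (if c = b then 1 else 0)) = Q a b" 
    using S assms(2) by (simp add: if_distrib[of "\<lambda>x. _ * x"] cong: if_cong)
  moreover have "(\<Sum>c\<in>S. (if a = c then 1 else 0) * Q c b) = Q a b"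
    using S 0 by (simp add: if_distrib[of "\<lambda>x. x * _"] cong: if_cong)
  ultimately show ?case by simp
next
  case (Suc k)
  have "mpow S Q (Suc (Suc k)) a b = (\<Sum>c\<in>S. Q a c * (\<Sum>e\<in>S. mpow S Q k c e * Q e b))"
    using Suc.IH by (simp only: mpow.simps(2)[of S Q "Suc k"] cong: sum.cong)
  also have "\<dots> = (\<Sum>e\<in>S. (\<Sum>c\<in>S. Q a c * mpow S Q k c e) * Q e b)"
    by (simp add: sum_distrib_left sum_distrib_right mult.assoc) (rule sum.swap)
  finally show ?case by simp
qed

lemma mpow_series_summable:
  assumes "a \<in> S" shows "summable (\<lambda>k. mpow S Q k a b / fact k * t ^ k)"
proof (rule summable_comparison_test')
  let ?q = "\<Sum>a\<in>S. \<Sum>b\<in>S. \<bar>Q a b\<bar>"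
  show "summable (\<lambda>k. inverse (fact k) * (?q * \<bar>t\<bar>) ^ k)" by (rule summable_exp)
  fix k :: nat
  show "norm (mpow S Q k a b / fact k * t ^ k) \<le> inverse (fact k) * (?q * \<bar>t\<bar>) ^ k"
    using mpow_bound[OF assms, of k b]
    by (simp add: abs_mult power_mult_distrib divide_inverse power_abs mult_right_mono mult_left_mono mult.commute mult.left_commute)
qed

lemma mpow_series_deriv:
  assumes a: "a \<in> S" and b: "b \<in> S"
  shows "((\<lambda>t. \<Sum>k. mpow S Q k a b / fact k * t ^ k) has_real_derivative
     (\<Sum>c\<in>S. (\<Sum>k. mpow S Q k a c / fact k * t ^ k) * Q c b)) (at t)"
proof -
  have "((\<lambda>t. \<Sum>k. mpow S Q k a b / fact k * t ^ k) has_real_derivative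
     (\<Sum>k. diffs (\<lambda>k. mpow S Q k a b / fact k) k * t ^ k)) (at t)"
    by (rule termdiffs_strong_converges_everywhere) (rule mpow_series_summable[OF a])
  also have "(\<Sum>k. diffs (\<lambda>k. mpow S Q k a b / fact k) k * t ^ k) = 
      (\<Sum>k. \<Sum>c\<in>S. mpow S Q k a c / fact k * t ^ k * Q c b)"
  proof (rule suminf_cong)
    fix k
    have "diffs (\<lambda>k. mpow S Q k a b / fact k) k = mpow S Q (Suc k) a b / fact k"
      by (simp add: diffs_def field_simps del: mpow.simps of_nat_Suc)
    then have "diffs (\<lambda>k. mpow S Q k a b / fact k) k * t ^ k = mpow S Q (Suc k) a b / fact k * t ^ k" by simp
    also have "\<dots> = (\<Sum>c\<in>S. mpow S Q k a c / fact k * t ^ k * Q c b)"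
      unfolding mpow_Suc_right[OF a b] by (simp add: sum_divide_distrib sum_distrib_right sum_distrib_left mult_ac)
    finally show "diffs (\<lambda>k. mpow S Q k a b / fact k) k * t ^ k = (\<Sum>c\<in>S. mpow S Q k a c / fact k * t ^ k * Q c b)" .
  qed
  also have "\<dots> = (\<Sum>c\<in>S. \<Sum>k. mpow S Q k a c / fact k * t ^ k * Q c b)"
    by (intro suminf_sum summable_mult2 mpow_series_summable[OF a])
  also have "\<dots> = (\<Sum>c\<in>S. (\<Sum>k. mpow S Q k a c / fact k * t ^ k) * Q c b)"
    by (intro sum.cong refl suminf_mult2[symmetric] mpow_series_summable[OF a])
  finally show ?thesis .
qed

end

lemma trans_prob_series: "trans_prob n d nu t a b = (\<Sum>k. mpow (vstates n d) (gen n d nu) k a b / fact k * t ^ k)"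
  by (simp add: trans_prob_def mult.commute)

lemma semigr_deriv:
  assumes "a \<in> vstates n d"
  shows "((\<lambda>t. semigr n d nu t f a) has_real_derivative semigr n d nu t (Lgen n d nu f) a) (at t)"
proof -
  let ?S = "vstates n d"
  have "((\<lambda>t. semigr n d nu t f a) has_real_derivative 
     (\<Sum>b\<in>?S. (\<Sum>c\<in>?S. trans_prob n d nu t a c * gen n d nu c b) * f b)) (at t)"
    unfolding semigr_def trans_prob_series
    by (intro DERIV_sum DERIV_cmult_right mpow_series_deriv assms) auto
  also have "(\<Sum>b\<in>?S. (\<Sum>c\<in>?S. trans_prob n d nu t a c * gen n d nu c b) * f b) = semigr n d nu t (Lgen n d nu f) a"
    unfolding semigr_def Lgen_def
    by (simp add: sum_distrib_left sum_distrib_right mult.assoc) (rule sum.swap)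
  finally show ?thesis .
qed

lemma semigr_0: assumes "a \<in> vstates n d" shows "semigr n d nu 0 f a = f a"
proof -
  have "trans_prob n d nu 0 a b = (if a = b then 1 else 0)" for b
    unfolding trans_prob_series using powser_zero[of "\<lambda>k. mpow (vstates n d) (gen n d nu) k a b / fact k"] by simp
  then show ?thesis using assms by (simp add: semigr_def if_distrib[of "\<lambda>x. x * _"] cong: if_cong)
qed

lemma Lgen_const: "a \<in> vstates n d \<Longrightarrow> Lgen n d nu (\<lambda>_. c) a = 0"
  by (cases a) (simp add: Lgen_eq Lrew_def Lvot_def)

text \<open>The generator kills constants, so the total mass has zero derivative and keeps its value
  at time 0.\<close>

lemma semigr_1: assumes "a \<in> vstates n d" shows "semigr n d nu t (\<lambda>_. 1) a = 1"
proof -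
  have z: "semigr n d nu t (Lgen n d nu (\<lambda>_. 1)) a = 0" for t
    by (simp add: semigr_def Lgen_const)
  have "semigr n d nu t (\<lambda>_. 1) a = semigr n d nu 0 (\<lambda>_. 1) a"
    by (rule DERIV_isconst_all) (use semigr_deriv[OF assms, of nu "\<lambda>_. 1"] z in simp)
  then show ?thesis using semigr_0[OF assms] by simp
qed

lemma semigr_cong: "(\<And>b. b \<in> vstates n d \<Longrightarrow> f b = g b) \<Longrightarrow> semigr n d nu t f a = semigr n d nu t g a"
  by (simp add: semigr_def)

section \<open>Two-time laws\<close>

text \<open>Needed because \<open>init_law\<close> divides by the number of matchings. The stubs are
  enumerated and the numbers \<open>2 * m\<close> and \<open>2 * m + 1\<close> are paired.\<close>

lemma matching_exists:
  assumes "even (d * n)" shows "matchings n d \<noteq> {}"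
proof -
  obtain h where h: "bij_betw h (stubs n d) {0..<d * n}"
    using ex_bij_betw_finite_nat[of "stubs n d"] by auto
  define g where "g = the_inv_into (stubs n d) h"
  have g: "g k \<in> stubs n d" "h (g k) = k" if "k < d * n" for k
    using h that unfolding g_def bij_betw_def
    by (auto intro!: the_inv_into_into[OF _ _ order_refl] f_the_inv_into_f)
  have gh: "g (h s) = s" and hn: "h s < d * n" if "s \<in> stubs n d" for s
    using h that unfolding g_def bij_betw_def by (auto intro!: the_inv_into_f_f)
  define p where "p k = (if even k then k + 1 else k - 1)" for k :: nat
  have p: "p k < d * n" "p k \<noteq> k" "p (p k) = k" if "k < d * n" for k
  proof -
    have "k + 1 \<noteq> d * n" if "even k" using assms that by (metis even_plus_one_iff)
    then show "p k < d * n" using \<open>k < d * n\<close> by (auto simp: p_def)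
    show "p k \<noteq> k" "p (p k) = k" by (auto simp: p_def elim: oddE)
  qed
  define G where "G s = (if s \<in> stubs n d then g (p (h s)) else s)" for s
  have "G s \<in> stubs n d" "G s \<noteq> s" "G (G s) = s" if "s \<in> stubs n d" for s
    using that g p[OF hn[OF that]] gh[OF that] hn[OF that] by (auto simp: G_def) (metis g(2))
  then have "G \<in> matchings n d" by (auto simp: matchings_def G_def)
  then show ?thesis by blast
qed

lemma sum_opinions: "(\<Sum>\<eta>\<in>opinions n. \<Prod>x<n. if \<eta> x then u else 1 - u) = (1 :: real)"
proof -
  have "(\<Sum>\<eta>\<in>opinions n. \<Prod>x<n. if \<eta> x then u else 1 - u) = (\<Sum>A\<in>Pow {..<n}. \<Prod>x<n. if x \<in> A then u else 1 - u)"
    by (rule sum.reindex_bij_witness[where i = "\<lambda>A x. x \<in> A" and j = Collect])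
       (auto simp: opinions_def not_less[symmetric] subset_iff)
  also have "\<dots> = (\<Sum>A\<in>Pow {..<n}. u ^ card A * (1 - u) ^ card ({..<n} - A))"
  proof (rule sum.cong[OF refl])
    fix A :: "nat set" assume "A \<in> Pow {..<n}"
    then have A: "A \<subseteq> {..<n}" "finite A" using finite_subset by auto
    have "(\<Prod>x<n. if x \<in> A then u else 1 - u) = (\<Prod>x\<in>A. if x \<in> A then u else 1 - u) * (\<Prod>x\<in>{..<n} - A. if x \<in> A then u else 1 - u)"
      using A by (subst prod.subset_diff[of A]) (auto simp: mult.commute)
    also have "\<dots> = u ^ card A * (1 - u) ^ card ({..<n} - A)"
      by (simp cong: prod.cong_simp)
    finally show "(\<Prod>x<n. if x \<in> A then u else 1 - u) = u ^ card A * (1 - u) ^ card ({..<n} - A)" .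
  qed
  also have "\<dots> = (\<Prod>x<n. u + (1 - u))"
    using prod_add[of "{..<n}" "\<lambda>_. u" "\<lambda>_. 1 - u"] by simp
  finally show ?thesis by simp
qed

lemma sum_init_law:
  assumes "even (d * n)" shows "(\<Sum>a\<in>vstates n d. init_law n d u a) = 1"
proof -
  have c: "card (matchings n d) \<noteq> 0" using matching_exists[OF assms] by simp
  have "(\<Sum>a\<in>vstates n d. init_law n d u a) =
     (\<Sum>(G, \<eta>)\<in>matchings n d \<times> opinions n. 1 / real (card (matchings n d)) * (\<Prod>x<n. if \<eta> x then u else 1 - u))"
    unfolding vstates_def by (rule sum.cong) (auto simp: init_law_def)
  also have "\<dots> = (\<Sum>G\<in>matchings n d. 1 / real (card (matchings n d)) * (\<Sum>\<eta>\<in>opinions n. \<Prod>x<n. if \<eta> x then u else 1 - u))"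
    by (simp add: sum.cartesian_product[symmetric] sum_distrib_left sum_divide_distrib)
  also have "\<dots> = 1" using c by (simp add: sum_opinions)
  finally show ?thesis .
qed

section \<open>From finite-dimensional laws to expectations\<close>

locale voter =
  fixes n d :: nat and nu u :: real and M :: "'w measure" and X :: "real \<Rightarrow> 'w \<Rightarrow> vstate"
  assumes proc: "is_voter_process n d nu u M X" and ev: "even (d * n)"
begin

sublocale prob_space M
  using proc by (simp add: is_voter_process_def)

lemma X_joint: "(\<lambda>(t, \<omega>). X t \<omega>) \<in> (borel :: real measure) \<Otimes>\<^sub>M M \<rightarrow>\<^sub>M count_space UNIV"
  using proc by (simp add: is_voter_process_def)

lemma X_meas [measurable]: "X t \<in> M \<rightarrow>\<^sub>M count_space UNIV"
  using measurable_compose[OF measurable_Pair1' X_joint, of t] by simp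

text \<open>The defining condition has \<open>t 0 = 0\<close>, so the law at the times
  \<open>s\<close> and \<open>t\<close> is read off with the initial state as an additional
  coordinate.\<close>

lemma fdd3:
  assumes "0 \<le> s" "s \<le> t"
  shows "measure M {\<omega>\<in>space M. X 0 \<omega> = a0 \<and> X s \<omega> = a \<and> X t \<omega> = b} = 
    init_law n d u a0 * (trans_prob n d nu s a0 a * trans_prob n d nu (t - s) a b)"
proof -
  define tt where "tt j = (if j = 0 then 0 else if j = 1 then s else t)" for j :: nat
  define aa where "aa j = (if j = 0 then a0 else if j = 1 then a else b)" for j :: nat
  have "tt 0 = 0 \<and> (\<forall>j<2. tt j \<le> tt (Suc j))"
    using assms by (auto simp: tt_def less_2_cases_iff)
  then have "measure M {\<omega>\<in>space M. \<forall>j\<le>2. X (tt j) \<omega> = aa j} = 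
     init_law n d u (aa 0) * (\<Prod>j<2. trans_prob n d nu (tt (Suc j) - tt j) (aa j) (aa (Suc j)))"
    using proc unfolding is_voter_process_def by blast
  moreover have "(\<forall>j\<le>2. X (tt j) \<omega> = aa j) \<longleftrightarrow> X 0 \<omega> = a0 \<and> X s \<omega> = a \<and> X t \<omega> = b" for \<omega>
  proof -
    have "{..2::nat} = {0, 1, 2}" by auto
    then have "(\<forall>j\<le>2. P j) \<longleftrightarrow> P 0 \<and> P 1 \<and> P 2" for P :: "nat \<Rightarrow> bool"
      by (metis (no_types, lifting) atMost_iff insert_iff empty_iff)
    then show ?thesis by (simp add: tt_def aa_def)
  qed
  moreover have "(\<Prod>j<2::nat. f j) = f 0 * f 1" for f :: "nat \<Rightarrow> real" by (simp add: numeral_2_eq_2)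
  ultimately show ?thesis by (simp add: tt_def aa_def)
qed

text \<open>The type of states is infinite and the process may leave \<open>vstates\<close> on a
  null set. The probabilities of the triples over \<open>vstates\<close> sum to 1, so up to a null
  set the integrand is a finite combination of indicators, and its expectation factors through the
  semigroup.\<close>

lemma expectation_two_times:
  assumes st: "0 \<le> s" "s \<le> t"
  shows "expectation (\<lambda>\<omega>. g (X s \<omega>) * f (X t \<omega>) :: real) = 
    (\<Sum>a0\<in>vstates n d. init_law n d u a0 * semigr n d nu s (\<lambda>a. g a * semigr n d nu (t - s) f a) a0)"
proof -
  let ?S = "vstates n d"
  define P where "P = ?S \<times> ?S \<times> ?S"
  define A where "A p = {\<omega>\<in>space M. X 0 \<omega> = fst p \<and> X s \<omega> = fst (snd p) \<and> X t \<omega> = snd (snd p)}" for p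
  have A[measurable]: "A p \<in> sets M" for p unfolding A_def by measurable
  have fin: "finite P" by (simp add: P_def)
  have pr: "prob (A (a0, a, b)) = init_law n d u a0 * (trans_prob n d nu s a0 a * trans_prob n d nu (t - s) a b)" for a0 a b
    unfolding A_def using fdd3[OF st] by simp
  have sumP: "(\<Sum>p\<in>P. prob (A p) * F p) = (\<Sum>a0\<in>?S. \<Sum>a\<in>?S. \<Sum>b\<in>?S. prob (A (a0, a, b)) * F (a0, a, b))" for F
    unfolding P_def sum.cartesian_product by (simp add: split_def)
  have disj: "disjoint_family_on A P" by (auto simp: disjoint_family_on_def A_def prod_eq_iff)
  have gen: "(\<Sum>p\<in>P. prob (A p) * (g (fst (snd p)) * f (snd (snd p)))) = 
    (\<Sum>a0\<in>?S. init_law n d u a0 * semigr n d nu s (\<lambda>a. g a * semigr n d nu (t - s) f a) a0)" for g f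
    unfolding sumP pr semigr_def by (simp add: sum_distrib_left mult_ac)
  have "prob (\<Union>p\<in>P. A p) = (\<Sum>p\<in>P. prob (A p))"
    using fin disj by (intro finite_measure_finite_Union) auto
  also have "\<dots> = (\<Sum>a0\<in>?S. init_law n d u a0 * semigr n d nu s (\<lambda>a. 1 * semigr n d nu (t - s) (\<lambda>_. 1) a) a0)"
    unfolding gen[symmetric] by simp
  also have "\<dots> = (\<Sum>a0\<in>?S. init_law n d u a0)"
    using semigr_cong[of n d "semigr n d nu (t - s) (\<lambda>_. 1)" "\<lambda>_. 1"] by (simp add: semigr_1)
  also have "\<dots> = 1" by (rule sum_init_law[OF ev])
  finally have "AE \<omega> in M. \<omega> \<in> (\<Union>p\<in>P. A p)" using fin by (subst prob_eq_1[symmetric]) auto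
  then have ae: "AE \<omega> in M. g (X s \<omega>) * f (X t \<omega>) = (\<Sum>p\<in>P. indicator (A p) \<omega> * (g (fst (snd p)) * f (snd (snd p))))"
  proof eventually_elim
    case (elim \<omega>)
    then obtain q where q: "q \<in> P" "\<omega> \<in> A q" by blast
    have X: "X s \<omega> = fst (snd q)" "X t \<omega> = snd (snd q)" using q by (auto simp: A_def)
    have Ap: "\<omega> \<in> A p \<longleftrightarrow> p = q" for p using q unfolding A_def by (auto simp: prod_eq_iff)
    have "(\<Sum>p\<in>P. indicator (A p) \<omega> * (g (fst (snd p)) * f (snd (snd p)))) = 
       (\<Sum>p\<in>P. if p = q then g (X s \<omega>) * f (X t \<omega>) else 0)"
      by (intro sum.cong refl) (simp add: indicator_def Ap X)
    then show ?case using q fin by simp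
  qed
  have "expectation (\<lambda>\<omega>. g (X s \<omega>) * f (X t \<omega>)) = 
     expectation (\<lambda>\<omega>. \<Sum>p\<in>P. indicator (A p) \<omega> * (g (fst (snd p)) * f (snd (snd p))))"
    by (rule integral_cong_AE[OF _ _ ae]) 
       (auto intro!: borel_measurable_times measurable_compose[OF X_meas] borel_measurable_sum)
  also have "\<dots> = (\<Sum>p\<in>P. prob (A p) * (g (fst (snd p)) * f (snd (snd p))))"
  proof -
    have "integrable M (\<lambda>\<omega>. indicator (A p) \<omega> * c :: real)" for p c
      by (intro integrable_mult_left integrable_real_indicator) (simp_all add: emeasure_eq_measure)
    then show ?thesis by (subst Bochner_Integration.integral_sum) simp_all
  qed
  finally show ?thesis unfolding gen .
qed

text \<open>At each fixed time the process lies in \<open>vstates\<close> only almost surely, and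
  elsewhere a function may be unbounded. The cut-off gives everywhere bounded integrands with the
  same expectations.\<close>

definition onS :: "(vstate \<Rightarrow> real) \<Rightarrow> vstate \<Rightarrow> real" where
  "onS f a = (if a \<in> vstates n d then f a else 0)"

lemma expectation_onS:
  fixes f g :: "vstate \<Rightarrow> real"
  assumes st: "0 \<le> s" "s \<le> t"
  shows "expectation (\<lambda>\<omega>. onS g (X s \<omega>) * onS f (X t \<omega>)) = expectation (\<lambda>\<omega>. g (X s \<omega>) * f (X t \<omega>))"
  unfolding expectation_two_times[OF st]
  by (intro sum.cong refl arg_cong2[where f = "(*)"] semigr_cong)
     (auto simp: onS_def intro!: semigr_cong)

lemma abs_onS_le: "(\<And>a. a \<in> vstates n d \<Longrightarrow> \<bar>f a\<bar> \<le> B) \<Longrightarrow> 0 \<le> B \<Longrightarrow> \<bar>onS f a\<bar> \<le> B"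
  by (simp add: onS_def)

lemma expectation_two_times_bound:
  fixes f g :: "vstate \<Rightarrow> real"
  assumes st: "0 \<le> s" "s \<le> t" and g: "\<And>a. a \<in> vstates n d \<Longrightarrow> \<bar>g a\<bar> \<le> B" "0 \<le> B"
    and f: "\<And>a. a \<in> vstates n d \<Longrightarrow> \<bar>f a\<bar> \<le> C" "0 \<le> C"
  shows "\<bar>expectation (\<lambda>\<omega>. g (X s \<omega>) * f (X t \<omega>))\<bar> \<le> B * C"
proof -
  have b: "\<bar>onS g a * onS f b\<bar> \<le> B * C" for a b
    unfolding abs_mult using abs_onS_le[of g B] abs_onS_le[of f C] f g by (intro mult_mono) auto
  have m: "(\<lambda>\<omega>. onS g (X s \<omega>) * onS f (X t \<omega>)) \<in> borel_measurable M"
    by (intro borel_measurable_times measurable_compose[OF X_meas]) auto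
  have i: "integrable M (\<lambda>\<omega>. onS g (X s \<omega>) * onS f (X t \<omega>))"
    using b m by (intro integrable_const_bound[where B = "B * C"]) auto
  have "\<bar>expectation (\<lambda>\<omega>. onS g (X s \<omega>) * onS f (X t \<omega>))\<bar> \<le> expectation (\<lambda>\<omega>. \<bar>onS g (X s \<omega>) * onS f (X t \<omega>)\<bar>)"
    by (rule integral_abs_bound)
  also have "\<dots> \<le> expectation (\<lambda>\<omega>. B * C)"
    using b i by (intro integral_mono) auto
  finally show ?thesis by (simp add: expectation_onS[OF st] prob_space)
qed

text \<open>By the forward equation the integrand is \<open>1 / \<gamma>\<close> times the
  derivative in \<open>t\<close> of the expectation of \<open>g (X (\<gamma> * s) \<omega>) * f (X
  (\<gamma> * t) \<omega>)\<close>. The integral is therefore a difference of boundary values, and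
  the acceleration of time supplies the gain.\<close>

lemma forward_integral_bound:
  assumes "0 < \<gamma>" "0 \<le> s" "s \<le> T" and g: "\<And>a. a \<in> vstates n d \<Longrightarrow> \<bar>g a\<bar> \<le> B" "0 \<le> B"
    and f: "\<And>a. a \<in> vstates n d \<Longrightarrow> \<bar>f a\<bar> \<le> C" "0 \<le> C"
  shows "\<bar>LINT t:{s..T}|lborel. expectation (\<lambda>\<omega>. g (X (\<gamma> * s) \<omega>) * Lgen n d nu f (X (\<gamma> * t) \<omega>))\<bar> \<le> 2 * B * C / \<gamma>"
proof -
  let ?S = "vstates n d"
  define \<Psi> where "\<Psi> f t = (\<Sum>a0\<in>?S. init_law n d u a0 * semigr n d nu (\<gamma> * s) (\<lambda>a. g a * semigr n d nu (\<gamma> * t - \<gamma> * s) f a) a0)" for f t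
  have E: "expectation (\<lambda>\<omega>. g (X (\<gamma> * s) \<omega>) * f (X (\<gamma> * t) \<omega>)) = \<Psi> f t" if "s \<le> t" for f t
    unfolding \<Psi>_def using assms that by (intro expectation_two_times) auto
  have D1: "((\<lambda>t. semigr n d nu (\<gamma> * t - \<gamma> * s) f a) has_real_derivative \<gamma> * semigr n d nu (\<gamma> * t - \<gamma> * s) (Lgen n d nu f) a) (at t)"
    if "a \<in> ?S" for a f t
  proof -
    have "((\<lambda>t. \<gamma> * t - \<gamma> * s) has_real_derivative \<gamma>) (at t)" by (auto intro!: derivative_eq_intros)
    from DERIV_chain2[where f = "\<lambda>t. semigr n d nu t f a", OF semigr_deriv[OF that] this]
    show ?thesis by (simp add: mult.commute)
  qed
  have D: "(\<Psi> f has_real_derivative \<gamma> * \<Psi> (Lgen n d nu f) t) (at t)" for f t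
  proof -
    have "((\<lambda>t. \<Sum>a0\<in>?S. init_law n d u a0 * (\<Sum>a\<in>?S. trans_prob n d nu (\<gamma> * s) a0 a * (g a * semigr n d nu (\<gamma> * t - \<gamma> * s) f a)))
      has_real_derivative (\<Sum>a0\<in>?S. init_law n d u a0 * (\<Sum>a\<in>?S. trans_prob n d nu (\<gamma> * s) a0 a * 
         (g a * (\<gamma> * semigr n d nu (\<gamma> * t - \<gamma> * s) (Lgen n d nu f) a))))) (at t)"
      by (intro DERIV_sum DERIV_cmult D1)
    then show ?thesis
      unfolding \<Psi>_def semigr_def[of n d nu "\<gamma> * s"] sum_distrib_left
      by (simp only: mult.left_commute[of \<gamma>])
  qed
  have cont: "continuous_on {s..T} (\<Psi> (Lgen n d nu f))"
    by (rule DERIV_continuous_on, rule has_field_derivative_at_within, rule D)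
  have "(LINT t:{s..T}|lborel. \<Psi> (Lgen n d nu f) t) = \<Psi> f T / \<gamma> - \<Psi> f s / \<gamma>"
    unfolding set_lebesgue_integral_def
  proof (rule integral_FTC_atLeastAtMost[OF \<open>s \<le> T\<close> _ cont])
    fix t
    have "((\<lambda>t. \<Psi> f t / \<gamma>) has_real_derivative \<gamma> * \<Psi> (Lgen n d nu f) t / \<gamma>) (at t)"
      by (rule DERIV_cdivide[OF D])
    also have "\<gamma> * \<Psi> (Lgen n d nu f) t / \<gamma> = \<Psi> (Lgen n d nu f) t" using assms(1) by simp
    finally show "((\<lambda>t. \<Psi> f t / \<gamma>) has_vector_derivative \<Psi> (Lgen n d nu f) t) (at t within {s..T})"
      unfolding has_real_derivative_iff_has_vector_derivative by (rule has_vector_derivative_at_within)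
  qed
  moreover have "(LINT t:{s..T}|lborel. expectation (\<lambda>\<omega>. g (X (\<gamma> * s) \<omega>) * Lgen n d nu f (X (\<gamma> * t) \<omega>))) = 
      (LINT t:{s..T}|lborel. \<Psi> (Lgen n d nu f) t)"
    by (intro set_lebesgue_integral_cong) (auto simp: E)
  moreover have "\<bar>\<Psi> f t\<bar> \<le> B * C" if "s \<le> t" for t
    unfolding E[OF that, symmetric] using assms that by (intro expectation_two_times_bound) auto
  from this[of s] this[of T] have "\<bar>\<Psi> f T - \<Psi> f s\<bar> \<le> 2 * B * C" using assms by (simp add: abs_le_iff)
  ultimately show ?thesis
    using assms(1) by (simp add: diff_divide_distrib[symmetric] divide_right_mono)
qed

end

section \<open>Second moments of time integrals\<close>

context voter
begin

context
  fixes \<gamma> T :: real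
  assumes \<gamma>: "0 < \<gamma>" and T: "0 < T"
begin

abbreviation (input) "L \<equiv> restrict_space lborel {0..T}"

lemma L_finite: "finite_measure L"
  using T by (intro finite_measureI) (simp add: emeasure_restrict_space space_restrict_space)

lemma L_integral: "(\<integral>s. f s \<partial>L) = (LINT s:{0..T}|lborel. f s)" for f :: "real \<Rightarrow> real"
  unfolding set_lebesgue_integral_def by (subst integral_restrict_space) auto

lemma meas_id_L: "(\<lambda>s. s) \<in> L \<rightarrow>\<^sub>M (borel :: real measure)"
  using measurable_restrict_space1[of "\<lambda>s::real. s" lborel borel "{0..T}"] by simp

lemma X_time_meas:
  assumes "\<tau> \<in> N \<rightarrow>\<^sub>M (borel :: real measure)" "\<xi> \<in> N \<rightarrow>\<^sub>M M"
  shows "(\<lambda>p. h (X (\<gamma> * \<tau> p) (\<xi> p)) :: real) \<in> borel_measurable N"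
proof -
  have "(\<lambda>p. (\<gamma> * \<tau> p, \<xi> p)) \<in> N \<rightarrow>\<^sub>M (borel :: real measure) \<Otimes>\<^sub>M M"
    using assms by (intro measurable_Pair borel_measurable_times) auto
  from measurable_compose[OF this X_joint] have "(\<lambda>p. X (\<gamma> * \<tau> p) (\<xi> p)) \<in> N \<rightarrow>\<^sub>M count_space UNIV"
    by simp
  from measurable_compose[OF this, of h borel] show ?thesis by simp
qed

lemma bounded_integrable:
  assumes "finite_measure N" "f \<in> borel_measurable N" "\<And>x. \<bar>f x :: real\<bar> \<le> B"
  shows "integrable N f"
  using assms by (intro finite_measure.integrable_const_bound[where B = B]) auto

lemma integral_first_moment:
  assumes h: "\<And>a. \<bar>h a :: real\<bar> \<le> B"
  shows "integrable M (\<lambda>\<omega>. LINT s:{0..T}|lborel. h (X (\<gamma> * s) \<omega>))"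
    and "expectation (\<lambda>\<omega>. LINT s:{0..T}|lborel. h (X (\<gamma> * s) \<omega>)) = 
       (LINT s:{0..T}|lborel. expectation (\<lambda>\<omega>. h (X (\<gamma> * s) \<omega>)))"
proof -
  interpret L: finite_measure L by (rule L_finite)
  interpret LM: pair_sigma_finite L M ..
  have m: "(\<lambda>p. h (X (\<gamma> * fst p) (snd p))) \<in> borel_measurable (L \<Otimes>\<^sub>M M)"
    by (rule X_time_meas) (auto intro: measurable_compose[OF measurable_fst meas_id_L])
  have i: "integrable (L \<Otimes>\<^sub>M M) (\<lambda>p. h (X (\<gamma> * fst p) (snd p)))"
    by (rule bounded_integrable[OF finite_measure_pair_measure[OF finite_measure_axioms L_finite] m]) (rule h)
  then have i': "integrable (L \<Otimes>\<^sub>M M) (\<lambda>(s, \<omega>). h (X (\<gamma> * s) \<omega>))" by (simp add: split_def)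
  show "integrable M (\<lambda>\<omega>. LINT s:{0..T}|lborel. h (X (\<gamma> * s) \<omega>))"
    using LM.integrable_snd[OF i'] by (simp add: L_integral)
  show "expectation (\<lambda>\<omega>. LINT s:{0..T}|lborel. h (X (\<gamma> * s) \<omega>)) = 
       (LINT s:{0..T}|lborel. expectation (\<lambda>\<omega>. h (X (\<gamma> * s) \<omega>)))"
    using LM.Fubini_integral[OF i'] by (simp add: L_integral)
qed

text \<open>The square of a time integral is a double integral symmetric in \<open>s\<close> and
  \<open>t\<close>, hence twice the integral over \<open>s \<le> t\<close>. Absolute values enter
  only after the whole inner integral over the later time has been formed, so the cancellation in
  \<open>t\<close> is kept.\<close>

lemma integral_second_moment:
  assumes h: "\<And>a. \<bar>h a :: real\<bar> \<le> B"
    and D: "\<And>s. 0 \<le> s \<Longrightarrow> s \<le> T \<Longrightarrow> 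
       \<bar>LINT t:{s..T}|lborel. expectation (\<lambda>\<omega>. h (X (\<gamma> * s) \<omega>) * h (X (\<gamma> * t) \<omega>))\<bar> \<le> D"
  shows "integrable M (\<lambda>\<omega>. (LINT s:{0..T}|lborel. h (X (\<gamma> * s) \<omega>))\<^sup>2)"
    and "expectation (\<lambda>\<omega>. (LINT s:{0..T}|lborel. h (X (\<gamma> * s) \<omega>))\<^sup>2) \<le> 2 * D * T"
proof -
  interpret L: finite_measure L by (rule L_finite)
  interpret LL: pair_sigma_finite L L ..
  have LLf: "finite_measure (L \<Otimes>\<^sub>M L)" by (rule finite_measure_pair_measure[OF L_finite L_finite])
  interpret LLi: finite_measure "L \<Otimes>\<^sub>M L" by (rule LLf)
  interpret LLM: pair_sigma_finite "L \<Otimes>\<^sub>M L" M ..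
  define \<phi> where "\<phi> s t = expectation (\<lambda>\<omega>. h (X (\<gamma> * s) \<omega>) * h (X (\<gamma> * t) \<omega>))" for s t
  have hh: "\<bar>h a * h b\<bar> \<le> B * B" for a b
    unfolding abs_mult using h[of a] h[of b] by (intro mult_mono) auto
  have m: "(\<lambda>q. h (X (\<gamma> * fst (fst q)) (snd q)) * h (X (\<gamma> * snd (fst q)) (snd q))) \<in> borel_measurable ((L \<Otimes>\<^sub>M L) \<Otimes>\<^sub>M M)"
    by (intro borel_measurable_times X_time_meas measurable_snd
        measurable_compose[OF measurable_compose[OF measurable_fst measurable_fst] meas_id_L]
        measurable_compose[OF measurable_compose[OF measurable_fst measurable_snd] meas_id_L])
  have "integrable ((L \<Otimes>\<^sub>M L) \<Otimes>\<^sub>M M) (\<lambda>q. h (X (\<gamma> * fst (fst q)) (snd q)) * h (X (\<gamma> * snd (fst q)) (snd q)))"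
    by (rule bounded_integrable[OF finite_measure_pair_measure[OF finite_measure_axioms LLf] m]) (rule hh)
  then have i: "integrable ((L \<Otimes>\<^sub>M L) \<Otimes>\<^sub>M M) (\<lambda>(p, \<omega>). h (X (\<gamma> * fst p) \<omega>) * h (X (\<gamma> * snd p) \<omega>))"
    by (simp add: split_def)
  have sq: "(\<integral>p. h (X (\<gamma> * fst p) \<omega>) * h (X (\<gamma> * snd p) \<omega>) \<partial>(L \<Otimes>\<^sub>M L)) = (LINT s:{0..T}|lborel. h (X (\<gamma> * s) \<omega>))\<^sup>2"
    if "\<omega> \<in> space M" for \<omega>
  proof -
    have ms: "(\<lambda>p. h (X (\<gamma> * fst p) \<omega>) * h (X (\<gamma> * snd p) \<omega>)) \<in> borel_measurable (L \<Otimes>\<^sub>M L)"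
      using that by (intro borel_measurable_times X_time_meas measurable_const
        measurable_compose[OF measurable_fst meas_id_L]
        measurable_compose[OF measurable_snd meas_id_L])
    have "integrable (L \<Otimes>\<^sub>M L) (\<lambda>p. h (X (\<gamma> * fst p) \<omega>) * h (X (\<gamma> * snd p) \<omega>))"
      by (rule bounded_integrable[OF LLf ms]) (rule hh)
    from LL.integral_fst'[OF this] show ?thesis
      by (simp add: L_integral power2_eq_square)
  qed
  have "integrable M (\<lambda>\<omega>. \<integral>p. h (X (\<gamma> * fst p) \<omega>) * h (X (\<gamma> * snd p) \<omega>) \<partial>(L \<Otimes>\<^sub>M L))"
    using LLM.integrable_snd[OF i] .
  then show int: "integrable M (\<lambda>\<omega>. (LINT s:{0..T}|lborel. h (X (\<gamma> * s) \<omega>))\<^sup>2)"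
    by (rule Bochner_Integration.integrable_cong[THEN iffD1, OF refl, rotated]) (rule sq)
  have \<phi>i: "integrable (L \<Otimes>\<^sub>M L) (\<lambda>p. \<phi> (fst p) (snd p))"
    using LLM.integrable_fst[OF i] by (simp add: \<phi>_def)
  have mf: "fst \<in> borel_measurable (L \<Otimes>\<^sub>M L)" "snd \<in> borel_measurable (L \<Otimes>\<^sub>M L)"
    using measurable_compose[OF measurable_fst[of L L] meas_id_L] measurable_compose[OF measurable_snd[of L L] meas_id_L] by simp_all
  note [measurable] = mf borel_measurable_integrable[OF \<phi>i]
  have "(\<lambda>p. \<phi> (fst p) (snd p) * of_bool (fst p \<le> snd p)) \<in> borel_measurable (L \<Otimes>\<^sub>M L)"
    "(\<lambda>p. \<phi> (fst p) (snd p) * of_bool (fst p < snd p)) \<in> borel_measurable (L \<Otimes>\<^sub>M L)"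
    "(\<lambda>p. \<phi> (fst p) (snd p) * of_bool (snd p < fst p)) \<in> borel_measurable (L \<Otimes>\<^sub>M L)" by measurable
  then have int1: "integrable (L \<Otimes>\<^sub>M L) (\<lambda>p. \<phi> (fst p) (snd p) * of_bool (fst p \<le> snd p))"
    and int2: "integrable (L \<Otimes>\<^sub>M L) (\<lambda>p. \<phi> (fst p) (snd p) * of_bool (fst p < snd p))"
    and int3: "integrable (L \<Otimes>\<^sub>M L) (\<lambda>p. \<phi> (fst p) (snd p) * of_bool (snd p < fst p))"
    by (auto intro!: Bochner_Integration.integrable_bound[OF \<phi>i])
  define K where "K s = (LINT t:{s..T}|lborel. \<phi> s t)" for s
  have K1: "(\<integral>t. \<phi> s t * of_bool (s \<le> t) \<partial>L) = K s" if "s \<in> space L" for s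
    unfolding L_integral K_def set_lebesgue_integral_def using that
    by (intro Bochner_Integration.integral_cong refl) (auto simp: indicator_def space_restrict_space)
  \<comment> \<open>The strict and the non-strict order differ in the single point \<open>s\<close>,
    a null set, so both halves of the square have the same inner integral.\<close>
  have K2: "(\<integral>t. \<phi> s t * of_bool (s < t) \<partial>L) = K s" if "s \<in> space L" for s
    unfolding L_integral K_def set_lebesgue_integral_def using that
    by (intro integral_discrete_difference[of "{s}"]) (auto simp: indicator_def space_restrict_space)
  have \<phi>c: "\<phi> s t = \<phi> t s" for s t by (simp add: \<phi>_def mult.commute)
  have "expectation (\<lambda>\<omega>. (LINT s:{0..T}|lborel. h (X (\<gamma> * s) \<omega>))\<^sup>2) = 
     expectation (\<lambda>\<omega>. \<integral>p. h (X (\<gamma> * fst p) \<omega>) * h (X (\<gamma> * snd p) \<omega>) \<partial>(L \<Otimes>\<^sub>M L))"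
    by (intro Bochner_Integration.integral_cong refl) (simp add: sq)
  also have "\<dots> = (\<integral>p. \<phi> (fst p) (snd p) \<partial>(L \<Otimes>\<^sub>M L))"
    using LLM.Fubini_integral[OF i] by (simp add: \<phi>_def)
  also have "\<dots> = (\<integral>p. \<phi> (fst p) (snd p) * of_bool (fst p \<le> snd p) + \<phi> (fst p) (snd p) * of_bool (snd p < fst p) \<partial>(L \<Otimes>\<^sub>M L))"
    by (intro Bochner_Integration.integral_cong refl) (auto simp: of_bool_def)
  also have "\<dots> = (\<integral>p. \<phi> (fst p) (snd p) * of_bool (fst p \<le> snd p) \<partial>(L \<Otimes>\<^sub>M L))
      + (\<integral>p. \<phi> (fst p) (snd p) * of_bool (snd p < fst p) \<partial>(L \<Otimes>\<^sub>M L))"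
    using int1 int3 by simp
  also have "(\<integral>p. \<phi> (fst p) (snd p) * of_bool (snd p < fst p) \<partial>(L \<Otimes>\<^sub>M L)) = 
     (\<integral>p. \<phi> (fst p) (snd p) * of_bool (fst p < snd p) \<partial>(L \<Otimes>\<^sub>M L))"
    using LL.integral_product_swap[OF borel_measurable_integrable[OF int3]] by (simp add: split_def \<phi>c)
  also have "(\<integral>p. \<phi> (fst p) (snd p) * of_bool (fst p \<le> snd p) \<partial>(L \<Otimes>\<^sub>M L)) = (\<integral>s. K s \<partial>L)"
    unfolding LL.integral_fst'[OF int1, symmetric] by (intro Bochner_Integration.integral_cong refl) (simp add: K1)
  also have "(\<integral>p. \<phi> (fst p) (snd p) * of_bool (fst p < snd p) \<partial>(L \<Otimes>\<^sub>M L)) = (\<integral>s. K s \<partial>L)"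
    unfolding LL.integral_fst'[OF int2, symmetric] by (intro Bochner_Integration.integral_cong refl) (simp add: K2)
  finally have "expectation (\<lambda>\<omega>. (LINT s:{0..T}|lborel. h (X (\<gamma> * s) \<omega>))\<^sup>2) = 2 * (\<integral>s. K s \<partial>L)" by simp
  also have "(\<integral>s. K s \<partial>L) \<le> (\<integral>s. D \<partial>L)"
  proof (rule integral_mono)
    have "integrable L (\<lambda>s. \<integral>t. \<phi> s t * of_bool (s \<le> t) \<partial>L)" using LL.integrable_fst'[OF int1] by simp
    then show "integrable L K"
      by (rule Bochner_Integration.integrable_cong[THEN iffD1, OF refl, rotated]) (rule K1)
    show "K s \<le> D" if "s \<in> space L" for s
      using D[of s] that by (simp add: K_def \<phi>_def space_restrict_space abs_le_iff)
  qed simp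
  also have "(\<integral>s. D \<partial>L) = D * T" using T by (simp add: measure_restrict_space space_restrict_space mult.commute)
  finally show "expectation (\<lambda>\<omega>. (LINT s:{0..T}|lborel. h (X (\<gamma> * s) \<omega>))\<^sup>2) \<le> 2 * D * T" by simp
qed

text \<open>In the second moment the earlier factor \<open>Lgen n d nu F\<close> is merely bounded
  by \<open>B\<close>, while the later one is integrated by the forward equation and leaves
  \<open>C / \<gamma>\<close>. The first moment takes the constant 1 as earlier factor.\<close>

lemma corrector_moments:
  fixes F :: "vstate \<Rightarrow> real"
  assumes F: "\<And>a. a \<in> vstates n d \<Longrightarrow> \<bar>F a\<bar> \<le> C" "0 \<le> C"
    and LF: "\<And>a. a \<in> vstates n d \<Longrightarrow> \<bar>Lgen n d nu F a\<bar> \<le> B" "0 \<le> B"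
  shows "integrable M (\<lambda>\<omega>. (LINT s:{0..T}|lborel. onS (Lgen n d nu F) (X (\<gamma> * s) \<omega>))\<^sup>2)"
    and "expectation (\<lambda>\<omega>. (LINT s:{0..T}|lborel. onS (Lgen n d nu F) (X (\<gamma> * s) \<omega>))\<^sup>2) \<le> 4 * B * C * T / \<gamma>"
    and "\<bar>LINT s:{0..T}|lborel. expectation (\<lambda>\<omega>. Lgen n d nu F (X (\<gamma> * s) \<omega>))\<bar> \<le> 2 * C / \<gamma>"
proof -
  have b: "\<bar>onS (Lgen n d nu F) a\<bar> \<le> B" for a using LF by (intro abs_onS_le)
  have D: "\<bar>LINT t:{s..T}|lborel. expectation (\<lambda>\<omega>. onS (Lgen n d nu F) (X (\<gamma> * s) \<omega>) * onS (Lgen n d nu F) (X (\<gamma> * t) \<omega>))\<bar> \<le> 2 * B * C / \<gamma>"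
    if "0 \<le> s" "s \<le> T" for s
  proof -
    have "(LINT t:{s..T}|lborel. expectation (\<lambda>\<omega>. onS (Lgen n d nu F) (X (\<gamma> * s) \<omega>) * onS (Lgen n d nu F) (X (\<gamma> * t) \<omega>))) = 
      (LINT t:{s..T}|lborel. expectation (\<lambda>\<omega>. Lgen n d nu F (X (\<gamma> * s) \<omega>) * Lgen n d nu F (X (\<gamma> * t) \<omega>)))"
      using \<gamma> that by (intro set_lebesgue_integral_cong) (auto simp: expectation_onS)
    then show ?thesis
      using forward_integral_bound[OF \<gamma> that, of "Lgen n d nu F" B F C] F LF by simp
  qed
  show "integrable M (\<lambda>\<omega>. (LINT s:{0..T}|lborel. onS (Lgen n d nu F) (X (\<gamma> * s) \<omega>))\<^sup>2)"
    by (rule integral_second_moment(1)[OF b D])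
  show "expectation (\<lambda>\<omega>. (LINT s:{0..T}|lborel. onS (Lgen n d nu F) (X (\<gamma> * s) \<omega>))\<^sup>2) \<le> 4 * B * C * T / \<gamma>"
    using integral_second_moment(2)[OF b D] by (simp add: mult_ac)
  show "\<bar>LINT s:{0..T}|lborel. expectation (\<lambda>\<omega>. Lgen n d nu F (X (\<gamma> * s) \<omega>))\<bar> \<le> 2 * C / \<gamma>"
    using forward_integral_bound[OF \<gamma> order_refl less_imp_le[OF T], of "\<lambda>_. 1" 1 F C] F by simp
qed

end
end

section \<open>Observables and occupation averages\<close>

text \<open>\<open>pavg\<close> draws the two vertices independently and with replacement, so the
  density of discordant pairs is exactly twice the product of the two opinion densities.\<close>

lemma O_obs_pavg:
  assumes "0 < n" "0 < d"
  shows "O_obs n (G, \<eta>) * (1 - O_obs n (G, \<eta>)) = pavg n d (disc \<eta>) / 2"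
proof -
  define b :: "nat \<Rightarrow> real" where "b x = of_bool (\<eta> x)" for x
  define s where "s = (\<Sum>x<n. b x)"
  have disc: "disc \<eta> x y = b x + b y - 2 * (b x * b y)" for x y by (simp add: disc_def b_def)
  have "(\<Sum>a\<in>stubs n d. \<Sum>e\<in>stubs n d. disc \<eta> (fst a) (fst e)) =
     real d * (\<Sum>x<n. \<Sum>e\<in>stubs n d. disc \<eta> x (fst e))" by (rule sum_stubs)
  also have "\<dots> = real d * (\<Sum>x<n. real d * (\<Sum>y<n. disc \<eta> x y))"
    by (simp only: sum_stubs[of "\<lambda>y. disc \<eta> _ y"])
  also have "\<dots> = (real d)\<^sup>2 * (\<Sum>x<n. \<Sum>y<n. disc \<eta> x y)"
    by (simp add: sum_distrib_left power2_eq_square mult.assoc)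
  also have "(\<Sum>x<n. \<Sum>y<n. disc \<eta> x y) = (\<Sum>x<n. real n * b x + s - 2 * b x * s)"
    by (intro sum.cong refl) (simp add: disc sum.distrib sum_subtractf sum_distrib_left s_def mult.assoc)
  also have "\<dots> = 2 * real n * s - 2 * s * s"
    by (simp add: sum.distrib sum_subtractf sum_distrib_left[symmetric] sum_distrib_right[symmetric] s_def)
  finally have "pavg n d (disc \<eta>) = (real d)\<^sup>2 * (2 * real n * s - 2 * s * s) / (real (d * n))\<^sup>2"
    by (simp add: pavg_def)
  also have "\<dots> = 2 * (s / real n * (1 - s / real n))"
    using assms by (simp add: power2_eq_square field_simps)
  finally have "pavg n d (disc \<eta>) = 2 * (s / real n * (1 - s / real n))" .
  moreover have "O_obs n (G, \<eta>) = s / real n"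
    by (simp add: O_obs_def s_def b_def of_bool_def)
  ultimately show ?thesis by simp
qed

text \<open>\<open>D_obs\<close> sees a discordant edge from its end with opinion 1 and compensates
  by the factor 2; \<open>davg\<close> sees it from both ends, and reindexing by \<open>G\<close>
  identifies the two halves. A word of length 1 leads to the vertex across the first edge, whatever
  its letter.\<close>

lemma D_obs_davg:
  assumes G: "G \<in> matchings n d" and d: "2 \<le> d"
  shows "D_obs n d (G, \<eta>) = davg n d 1 G \<eta>"
proof -
  let ?S = "stubs n d"
  define b :: "nat \<Rightarrow> real" where "b x = of_bool (\<eta> x)" for x
  have disc: "disc \<eta> x y = b x * (1 - b y) + b y * (1 - b x)" for x y by (simp add: disc_def b_def)
  have w: "wavg n d (disc \<eta>) G [j] = (\<Sum>a\<in>?S. disc \<eta> (fst a) (fst (G a))) / real (d * n)" for j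
    by (simp add: wavg_def)
  have "davg n d 1 G \<eta> = (\<Sum>a\<in>?S. disc \<eta> (fst a) (fst (G a))) / real (d * n)"
    using d by (simp add: davg_def sum_words_Cons[where d = d and k = 0, simplified] w of_nat_diff)
  also have "(\<Sum>a\<in>?S. disc \<eta> (fst a) (fst (G a))) = 
      (\<Sum>a\<in>?S. b (fst a) * (1 - b (fst (G a)))) + (\<Sum>a\<in>?S. b (fst (G a)) * (1 - b (fst a)))"
    by (simp add: disc sum.distrib)
  also have "(\<Sum>a\<in>?S. b (fst (G a)) * (1 - b (fst a))) = (\<Sum>a\<in>?S. b (fst a) * (1 - b (fst (G a))))"
    using sum.reindex_bij_betw[OF bij_match[OF G], of "\<lambda>a. b (fst a) * (1 - b (fst (G a)))"]
    by (simp add: match_inv[OF G])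
  also have "(\<Sum>a\<in>?S. b (fst a) * (1 - b (fst (G a)))) = 
     (\<Sum>x<n. (if \<eta> x then 1 else 0) * (\<Sum>i<d. if \<eta> (vertex_of G x i) then 0 else 1))"
  proof -
    have "(\<Sum>a\<in>?S. b (fst a) * (1 - b (fst (G a)))) = (\<Sum>x<n. \<Sum>i<d. b x * (1 - b (vertex_of G x i)))"
      by (simp add: stubs_def sum.cartesian_product vertex_of_def split_def)
    also have "\<dots> = (\<Sum>x<n. b x * (\<Sum>i<d. 1 - b (vertex_of G x i)))" by (simp only: sum_distrib_left)
    also have "\<dots> = (\<Sum>x<n. (if \<eta> x then 1 else 0) * (\<Sum>i<d. if \<eta> (vertex_of G x i) then 0 else 1))"
      by (intro sum.cong refl arg_cong2[where f = "(*)"]) (auto simp: b_def)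
    finally show ?thesis .
  qed
  finally show ?thesis by (simp add: D_obs_def)
qed

lemma O_obs_bounds: "0 \<le> O_obs n a" "O_obs n a \<le> 1"
proof -
  have "(\<Sum>x<n. if snd a x then 1 else 0) \<le> real (card {..<n}) * (1::real)" by (intro sum_bounded_above) auto
  then show "0 \<le> O_obs n a" "O_obs n a \<le> 1"
    by (auto simp: O_obs_def split_def divide_le_eq_1 intro!: divide_nonneg_nonneg sum_nonneg)
qed

lemma D_obs_bounds: "0 \<le> D_obs n d a" "D_obs n d a \<le> 2"
proof -
  let ?f = "\<lambda>x. (if snd a x then 1 else 0) * (\<Sum>i<d. if snd a (vertex_of (fst a) x i) then 0 else 1) :: real"
  have s: "(\<Sum>i<d. if snd a (vertex_of (fst a) x i) then 0 else 1 :: real) \<le> real (card {..<d}) * 1" for x 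
    by (intro sum_bounded_above) auto
  have "?f x \<le> real d" for x using s[of x] by (auto intro!: sum_nonneg)
  then have "(\<Sum>x<n. ?f x) \<le> real (card {..<n}) * real d" by (intro sum_bounded_above) auto
  then have "2 / real (d * n) * (\<Sum>x<n. ?f x) \<le> 2 / real (d * n) * real (d * n)"
    by (intro mult_left_mono) (auto simp: mult.commute)
  also have "\<dots> \<le> 2" by simp
  finally show "D_obs n d a \<le> 2" by (simp add: D_obs_def split_def)
  show "0 \<le> D_obs n d a" unfolding D_obs_def split_def by (intro mult_nonneg_nonneg sum_nonneg divide_nonneg_nonneg) auto
qed

section \<open>Averages over all words of a given length\<close>

lemma ret_le_1: "ret n d G w \<le> 1"
  unfolding ret_def by (rule wavg_bounds) auto

lemma subret_bounds: "0 \<le> subret n d G w" "subret n d G w \<le> (real (length w))\<^sup>2"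
proof -
  show "0 \<le> subret n d G w" by (simp add: subret_def sum_nonneg ret_nonneg)
  have "subret n d G w \<le> (\<Sum>m<length w. \<Sum>i\<in>{1..<length w}. 1)"
    unfolding subret_def by (intro sum_mono ret_le_1)
  also have "\<dots> \<le> real (length w) * real (length w)" by (simp add: mult_left_mono)
  finally show "subret n d G w \<le> (real (length w))\<^sup>2" by (simp add: power2_eq_square)
qed

definition savg :: "nat \<Rightarrow> nat \<Rightarrow> nat \<Rightarrow> matching \<Rightarrow> real" where
  "savg n d k G = (\<Sum>w\<in>words d k. subret n d G w) / (real d - 1) ^ k"

lemma word_average_bounds:
  assumes "2 \<le> d" "\<And>w. w \<in> words d k \<Longrightarrow> 0 \<le> f w \<and> f w \<le> (C :: real)"
  shows "0 \<le> (\<Sum>w\<in>words d k. f w) / (real d - 1) ^ k" "(\<Sum>w\<in>words d k. f w) / (real d - 1) ^ k \<le> C"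
proof -
  show "0 \<le> (\<Sum>w\<in>words d k. f w) / (real d - 1) ^ k"
    using assms by (intro divide_nonneg_nonneg sum_nonneg) auto
  have "(\<Sum>w\<in>words d k. f w) \<le> real (card (words d k)) * C" using assms by (intro sum_bounded_above) auto
  then show "(\<Sum>w\<in>words d k. f w) / (real d - 1) ^ k \<le> C"
    using assms(1) card_words[of d k] by (subst pos_divide_le_eq) (auto simp: mult.commute)
qed

lemma ravg_bounds: assumes "2 \<le> d" shows "0 \<le> ravg n d k G" "ravg n d k G \<le> 1"
  unfolding ravg_def using word_average_bounds[OF assms] ret_nonneg ret_le_1 by blast+

lemma savg_bounds: assumes "2 \<le> d" shows "0 \<le> savg n d k G" "savg n d k G \<le> (real k)\<^sup>2"
proof -
  have "0 \<le> subret n d G w \<and> subret n d G w \<le> (real k)\<^sup>2" if "w \<in> words d k" for w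
    using subret_bounds[of n d G w] that by (simp add: words_def)
  then show "0 \<le> savg n d k G" "savg n d k G \<le> (real k)\<^sup>2"
    unfolding savg_def using word_average_bounds[OF assms] by blast+
qed

lemma Lrew_sum: "Lrew n d nu (\<lambda>G. \<Sum>a\<in>A. f a G) G = (\<Sum>a\<in>A. Lrew n d nu (f a) G)"
proof -
  have "(\<Sum>s\<in>stubs n d. \<Sum>t\<in>stubs n d. (\<Sum>a\<in>A. f a (reswap s t G)) - (\<Sum>a\<in>A. f a G)) =
        (\<Sum>a\<in>A. \<Sum>s\<in>stubs n d. \<Sum>t\<in>stubs n d. f a (reswap s t G) - f a G)"
    unfolding sum_subtractf[symmetric] by (simp add: sum.swap[of _ _ A])
  then show ?thesis by (simp add: Lrew_def sum_distrib_left)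
qed

lemma Lrew_divide: "Lrew n d nu (\<lambda>G. f G / c) G = Lrew n d nu f G / c"
  by (simp add: Lrew_def diff_divide_distrib[symmetric] sum_divide_distrib[symmetric])

lemma Lrew_davg:
  assumes G: "G \<in> matchings n d" and d: "2 \<le> d" and n: "0 < n" and nu: "0 < nu"
  shows "\<bar>Lrew n d nu (\<lambda>G. davg n d k G \<eta>) G - nu * real k * (pavg n d (disc \<eta>) - davg n d k G \<eta>)\<bar>
    \<le> nu * real k * ((6 + 8 * real k) / real (d * n) + 8 * savg n d k G)"
proof -
  define q where "q = (real d - 1) ^ k"
  have q: "q > 0" using d by (simp add: q_def)
  have c: "real (card (words d k)) = q" using card_words[of d k] d by (simp add: q_def)
  let ?L = "\<lambda>w. Lrew n d nu (\<lambda>G. wavg n d (disc \<eta>) G w) G"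
  let ?R = "\<lambda>w. nu * real k * (pavg n d (disc \<eta>) - wavg n d (disc \<eta>) G w)"
  have 1: "\<bar>?L w - ?R w\<bar> \<le> nu * real k * ((6 + 8 * real k) / real (d * n) + 8 * subret n d G w)"
    if "w \<in> words d k" for w
    using Lrew_wavg[OF G d n _ _ _ nu, of w "disc \<eta>"] that by (simp add: words_def)
  have "\<bar>(\<Sum>w\<in>words d k. ?L w - ?R w)\<bar> \<le> (\<Sum>w\<in>words d k. nu * real k * ((6 + 8 * real k) / real (d * n) + 8 * subret n d G w))"
    by (intro order.trans[OF sum_abs] sum_mono 1)
  also have "\<dots> = q * (nu * real k * ((6 + 8 * real k) / real (d * n) + 8 * savg n d k G))"
  proof -
    have "(\<Sum>w\<in>words d k. nu * real k * ((6 + 8 * real k) / real (d * n) + 8 * subret n d G w)) =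
      nu * real k * (q * ((6 + 8 * real k) / real (d * n)) + 8 * (\<Sum>w\<in>words d k. subret n d G w))"
      by (simp only: sum_distrib_left[symmetric] sum.distrib sum_constant c)
    also have "(\<Sum>w\<in>words d k. subret n d G w) = q * savg n d k G"
      using q unfolding savg_def q_def[symmetric] by simp
    finally show ?thesis by (simp add: algebra_simps)
  qed
  also have "(\<Sum>w\<in>words d k. ?L w - ?R w) = q * (Lrew n d nu (\<lambda>G. davg n d k G \<eta>) G - nu * real k * (pavg n d (disc \<eta>) - davg n d k G \<eta>))"
    using q by (simp add: davg_def Lrew_sum Lrew_divide sum_subtractf sum_distrib_left[symmetric] c q_def[symmetric] right_diff_distrib)
  finally show ?thesis using q by (simp add: abs_mult)
qed

section \<open>Expected occupation integrals\<close>

context voter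
begin

text \<open>The expected time integral of \<open>f\<close> along the accelerated process, written as
  one integral over time and \<open>\<omega>\<close> so that linearity and monotonicity are those of
  the integral. The cut-off \<open>onS\<close> makes every \<open>f\<close> integrable, since
  \<open>vstates\<close> is finite.\<close>

definition occ :: "real \<Rightarrow> real \<Rightarrow> (vstate \<Rightarrow> real) \<Rightarrow> real" where
  "occ \<gamma> T f = (\<integral>p. onS f (X (\<gamma> * fst p) (snd p)) \<partial>(restrict_space lborel {0..T} \<Otimes>\<^sub>M M))"

context
  fixes \<gamma> T :: real
  assumes \<gamma>: "0 < \<gamma>" and T: "0 < T"
begin

lemma onS_bounded: "\<exists>B. \<forall>a. \<bar>onS f a\<bar> \<le> B"
  by (rule exI[of _ "\<Sum>a\<in>vstates n d. \<bar>f a\<bar>"])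
     (auto simp: onS_def intro!: member_le_sum[of _ _ "\<lambda>a. \<bar>f a\<bar>"] sum_nonneg)

lemma bounded_occ_integrable:
  fixes h :: "vstate \<Rightarrow> real"
  assumes "\<And>a. \<bar>h a\<bar> \<le> B"
  shows "integrable (restrict_space lborel {0..T} \<Otimes>\<^sub>M M) (\<lambda>p. h (X (\<gamma> * fst p) (snd p)))"
proof -
  have m: "(\<lambda>p. h (X (\<gamma> * fst p) (snd p))) \<in> borel_measurable (restrict_space lborel {0..T} \<Otimes>\<^sub>M M)"
    by (rule X_time_meas[OF \<gamma> T measurable_compose[OF measurable_fst meas_id_L[OF \<gamma> T]] measurable_snd])
  show ?thesis
    by (rule bounded_integrable[OF \<gamma> T finite_measure_pair_measure[OF finite_measure_axioms L_finite[OF \<gamma> T]] m]) (rule assms)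
qed

lemma occ_integrable: "integrable (restrict_space lborel {0..T} \<Otimes>\<^sub>M M) (\<lambda>p. onS f (X (\<gamma> * fst p) (snd p)))"
  using onS_bounded[of f] bounded_occ_integrable by blast

lemma occ_add: "occ \<gamma> T (\<lambda>a. f a + g a) = occ \<gamma> T f + occ \<gamma> T g"
  unfolding occ_def Bochner_Integration.integral_add[OF occ_integrable occ_integrable, symmetric]
  by (intro Bochner_Integration.integral_cong refl) (simp add: onS_def)

lemma occ_cmult: "occ \<gamma> T (\<lambda>a. c * f a) = c * occ \<gamma> T f"
  unfolding occ_def integral_mult_right_zero[symmetric]
  by (intro Bochner_Integration.integral_cong refl) (simp add: onS_def)

lemma occ_sum: "finite A \<Longrightarrow> occ \<gamma> T (\<lambda>a. \<Sum>i\<in>A. f i a) = (\<Sum>i\<in>A. occ \<gamma> T (f i))"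
proof (induction A rule: finite_induct)
  case empty
  show ?case by (simp add: occ_def onS_def)
qed (simp add: occ_add)

lemma occ_mono: "(\<And>a. a \<in> vstates n d \<Longrightarrow> f a \<le> g a) \<Longrightarrow> occ \<gamma> T f \<le> occ \<gamma> T g"
  unfolding occ_def by (intro integral_mono occ_integrable) (simp add: onS_def)

lemma occ_Fubini:
  fixes h :: "vstate \<Rightarrow> real"
  assumes h: "\<And>a. \<bar>h a\<bar> \<le> B"
  shows "(\<integral>p. h (X (\<gamma> * fst p) (snd p)) \<partial>(restrict_space lborel {0..T} \<Otimes>\<^sub>M M)) =
    (LINT s:{0..T}|lborel. expectation (\<lambda>\<omega>. h (X (\<gamma> * s) \<omega>)))"
proof -
  interpret L: finite_measure "restrict_space lborel {0..T}" by (rule L_finite[OF \<gamma> T])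
  interpret LM: pair_sigma_finite "restrict_space lborel {0..T}" M ..
  show ?thesis
    using LM.integral_fst'[OF bounded_occ_integrable[of h B, OF h]] by (simp add: L_integral[OF \<gamma> T])
qed

lemma occ_eq: "occ \<gamma> T f = (LINT s:{0..T}|lborel. expectation (\<lambda>\<omega>. f (X (\<gamma> * s) \<omega>)))"
proof -
  obtain B where B: "\<And>a. \<bar>onS f a\<bar> \<le> B" using onS_bounded by blast
  have "expectation (\<lambda>\<omega>. onS f (X (\<gamma> * s) \<omega>)) = expectation (\<lambda>\<omega>. f (X (\<gamma> * s) \<omega>))" if "s \<in> {0..T}" for s
  proof -
    have "onS (\<lambda>_. 1) a * onS f a = onS f a" for a by (simp add: onS_def)
    moreover have "0 \<le> \<gamma> * s" using \<gamma> that by simp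
    ultimately show ?thesis using expectation_onS[of "\<gamma> * s" "\<gamma> * s" "\<lambda>_. 1" f] by (simp only: mult_1 order_refl)
  qed
  then show ?thesis unfolding occ_def occ_Fubini[of "onS f" B, OF B] by (intro set_lebesgue_integral_cong) auto
qed

lemma occ_abs_const: "0 \<le> c \<Longrightarrow> occ \<gamma> T (\<lambda>_. c) \<le> c * T"
  using T by (simp add: occ_eq prob_space set_lebesgue_integral_def mult.commute)

lemma occ_Lgen:
  assumes "\<And>a. a \<in> vstates n d \<Longrightarrow> \<bar>F a\<bar> \<le> C" "0 \<le> C"
  shows "\<bar>occ \<gamma> T (Lgen n d nu F)\<bar> \<le> 2 * C / \<gamma>"
proof -
  \<comment> \<open>Finiteness of the state space supplies some bound, possibly growing with
    \<open>n\<close>; the resulting estimate contains only \<open>C\<close>.\<close>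
  have "\<bar>Lgen n d nu F a\<bar> \<le> (\<Sum>a\<in>vstates n d. \<bar>Lgen n d nu F a\<bar>)" if "a \<in> vstates n d" for a
    using that by (intro member_le_sum) auto
  then show ?thesis
    unfolding occ_eq 
    by (intro corrector_moments(3)[OF \<gamma> T, where B = "\<Sum>a\<in>vstates n d. \<bar>Lgen n d nu F a\<bar>"] assms sum_nonneg) auto
qed

lemma first_moment_abs:
  fixes r :: "vstate \<Rightarrow> real"
  assumes r: "\<And>a. \<bar>r a\<bar> \<le> B"
  shows "integrable M (\<lambda>\<omega>. \<bar>LINT s:{0..T}|lborel. r (X (\<gamma> * s) \<omega>)\<bar>)"
    "expectation (\<lambda>\<omega>. \<bar>LINT s:{0..T}|lborel. r (X (\<gamma> * s) \<omega>)\<bar>) \<le> occ \<gamma> T (\<lambda>a. \<bar>r a\<bar>)"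
proof -
  have r': "\<bar>\<bar>r a\<bar>\<bar> \<le> B" for a using r by simp
  show i: "integrable M (\<lambda>\<omega>. \<bar>LINT s:{0..T}|lborel. r (X (\<gamma> * s) \<omega>)\<bar>)"
    using integral_first_moment(1)[OF \<gamma> T, of r B, OF r] by simp
  have "expectation (\<lambda>\<omega>. \<bar>LINT s:{0..T}|lborel. r (X (\<gamma> * s) \<omega>)\<bar>) \<le> 
     expectation (\<lambda>\<omega>. LINT s:{0..T}|lborel. \<bar>r (X (\<gamma> * s) \<omega>)\<bar>)"
  proof (rule integral_mono[OF i integral_first_moment(1)[OF \<gamma> T, of "\<lambda>a. \<bar>r a\<bar>" B, OF r']])
    fix \<omega>
    show "\<bar>LINT s:{0..T}|lborel. r (X (\<gamma> * s) \<omega>)\<bar> \<le> (LINT s:{0..T}|lborel. \<bar>r (X (\<gamma> * s) \<omega>)\<bar>)"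
      unfolding L_integral[OF \<gamma> T, symmetric] by (rule integral_abs_bound)
  qed
  also have "\<dots> = occ \<gamma> T (\<lambda>a. \<bar>r a\<bar>)"
    unfolding integral_first_moment(2)[OF \<gamma> T, of "\<lambda>a. \<bar>r a\<bar>" B, OF r'] occ_eq ..
  finally show "expectation (\<lambda>\<omega>. \<bar>LINT s:{0..T}|lborel. r (X (\<gamma> * s) \<omega>)\<bar>) \<le> occ \<gamma> T (\<lambda>a. \<bar>r a\<bar>)" .
qed

text \<open>Rewiring pulls the return frequency of a word back to \<open>1 / n\<close> up to returns of strictly shorter words, which
gives decay by induction on the length without any use of the stationary law.\<close>

lemma occ_ret_step:
  assumes n: "0 < n" and d: "2 \<le> d" and nu: "0 < nu" and w: "set w \<subseteq> {1..<d}" "w \<noteq> []"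
  shows "occ \<gamma> T (\<lambda>a. ret n d (fst a) w) \<le> (7 + 8 * real (length w)) / real n * T
     + 8 * (\<Sum>m<length w. \<Sum>i\<in>{1..<length w}. occ \<gamma> T (\<lambda>a. ret n d (fst a) (take i (drop m w))))
     + 2 / (\<gamma> * nu)"
proof -
  define k where "k = real (length w)"
  have k: "1 \<le> k" using w by (cases w) (auto simp: k_def)
  have nk: "0 < nu * k" using nu k by simp
  \<comment> \<open>The drift estimate \<open>Lrew_wavg\<close> is solved for the return frequency
    and divided by \<open>nu * k\<close>. The 7 is the 6 of that estimate plus 1 from the value
    \<open>1 / n\<close> of \<open>pavg\<close>.\<close>
  have pt: "ret n d (fst a) w \<le> (7 + 8 * k) / real n + (8 * subret n d (fst a) w
       + (- 1 / (nu * k)) * Lgen n d nu (\<lambda>a. ret n d (fst a) w) a)"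
    if "a \<in> vstates n d" for a
  proof -
    obtain G \<eta> where a: "a = (G, \<eta>)" by (cases a)
    have G: "G \<in> matchings n d" using that a by (auto simp: vstates_def)
    define Lr where "Lr = Lgen n d nu (\<lambda>a. ret n d (fst a) w) a"
    have "Lr = Lrew n d nu (\<lambda>G. ret n d G w) G"
      unfolding Lr_def a by (subst Lgen_eq) (use that a in \<open>auto simp: Lvot_def\<close>)
    then have "\<bar>Lr - nu * k * (1 / real n - ret n d G w)\<bar> \<le> nu * k * ((6 + 8 * k) / real (d * n) + 8 * subret n d G w)"
      using Lrew_wavg[OF G d n w(1) _ _ nu, of "\<lambda>x y. of_bool (x = y)"] d
      by (simp add: ret_def k_def pavg_eq[OF n])
    then have "nu * k * ret n d G w \<le> nu * k * (1 / real n + ((6 + 8 * k) / real (d * n) + 8 * subret n d G w)) - Lr"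
      by (simp add: abs_le_iff algebra_simps)
    also have "\<dots> = nu * k * (1 / real n + ((6 + 8 * k) / real (d * n) + 8 * subret n d G w) + (-1 / (nu * k)) * Lr)"
    proof -
      have e: "nu * k * ((-1 / (nu * k)) * Lr) = - Lr" using nk by (metis less_irrefl mult_minus1 nonzero_mult_div_cancel_left times_divide_eq_left times_divide_eq_right)
      show ?thesis by (simp only: distrib_left e diff_conv_add_uminus)
    qed
    finally have 1: "ret n d G w \<le> 1 / real n + ((6 + 8 * k) / real (d * n) + 8 * subret n d G w) + (-1 / (nu * k)) * Lr"
      using nk by (simp only: mult_le_cancel_left_pos)
    have "(6 + 8 * k) / real (d * n) \<le> (6 + 8 * k) / real n"
      using k n d by (intro divide_left_mono) auto
    then have "1 / real n + (6 + 8 * k) / real (d * n) \<le> (7 + 8 * k) / real n"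
      by (simp add: add_divide_distrib)
    then show ?thesis using 1 by (simp add: a Lr_def)
  qed
  have "occ \<gamma> T (\<lambda>a. ret n d (fst a) w) \<le> occ \<gamma> T (\<lambda>a. (7 + 8 * k) / real n + (8 * subret n d (fst a) w
       + (- 1 / (nu * k)) * Lgen n d nu (\<lambda>a. ret n d (fst a) w) a))"
    by (rule occ_mono) (rule pt)
  also have "\<dots> = occ \<gamma> T (\<lambda>a. (7 + 8 * k) / real n) + (8 * occ \<gamma> T (\<lambda>a. subret n d (fst a) w)
       + (- 1 / (nu * k)) * occ \<gamma> T (Lgen n d nu (\<lambda>a. ret n d (fst a) w)))"
    by (simp only: occ_add occ_cmult)
  also have "occ \<gamma> T (\<lambda>a. (7 + 8 * k) / real n) \<le> (7 + 8 * k) / real n * T"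
    using k by (intro occ_abs_const) auto
  also have "(- 1 / (nu * k)) * occ \<gamma> T (Lgen n d nu (\<lambda>a. ret n d (fst a) w)) \<le> 2 / (\<gamma> * nu)"
  proof -
    have "\<bar>occ \<gamma> T (Lgen n d nu (\<lambda>a. ret n d (fst a) w))\<bar> \<le> 2 * 1 / \<gamma>"
      by (rule occ_Lgen) (auto simp: ret_nonneg ret_le_1)
    then have "(- 1 / (nu * k)) * occ \<gamma> T (Lgen n d nu (\<lambda>a. ret n d (fst a) w)) \<le> 1 / (nu * k) * (2 / \<gamma>)"
    proof -
      have "(- 1 / (nu * k)) * x = 1 / (nu * k) * (- x)" for x by simp
      moreover have "- occ \<gamma> T (Lgen n d nu (\<lambda>a. ret n d (fst a) w)) \<le> 2 / \<gamma>"
        using \<open>\<bar>occ \<gamma> T (Lgen n d nu (\<lambda>a. ret n d (fst a) w))\<bar> \<le> 2 * 1 / \<gamma>\<close> by linarith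
      ultimately show ?thesis using nk by (simp only:) (intro mult_left_mono, auto)
    qed
    also have "\<dots> \<le> 1 / nu * (2 / \<gamma>)"
      using nu k \<gamma> by (intro mult_right_mono divide_left_mono) auto
    finally show ?thesis by (simp add: mult.commute)
  qed
  also have "occ \<gamma> T (\<lambda>a. subret n d (fst a) w) = 
     (\<Sum>m<length w. \<Sum>i\<in>{1..<length w}. occ \<gamma> T (\<lambda>a. ret n d (fst a) (take i (drop m w))))"
    unfolding subret_def by (simp add: occ_sum)
  finally show ?thesis by (simp add: k_def)
qed

end
end

section \<open>The corrector\<close>

definition corrector :: "nat \<Rightarrow> nat \<Rightarrow> (nat \<Rightarrow> real) \<Rightarrow> nat \<Rightarrow> vstate \<Rightarrow> real" where
  "corrector n d c K a = (\<Sum>k\<in>{1..K}. c k * (pavg n d (disc (snd a)) - davg n d k (fst a) (snd a)))"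

text \<open>Three sources of error at level \<open>k\<close>: coinciding end vertices under voter
  moves, collisions and degenerate pairs under rewiring, and the drift of the global discordance
  itself.\<close>

definition loop_err :: "nat \<Rightarrow> nat \<Rightarrow> real \<Rightarrow> nat \<Rightarrow> matching \<Rightarrow> real" where
  "loop_err n d nu k G = 2 * ravg n d k G + nu * real k * ((6 + 8 * real k) / real n + 8 * savg n d k G) + 2 / real n"

lemma loop_err_bounds:
  assumes "2 \<le> d" "0 < n" "0 < nu"
  shows "0 \<le> loop_err n d nu k G" "loop_err n d nu k G \<le> 4 + nu * real k * (6 + 8 * real k + 8 * (real k)\<^sup>2)"
proof -
  note b = ravg_bounds[OF assms(1), of n k G] savg_bounds[OF assms(1), of n k G]
  show "0 \<le> loop_err n d nu k G" unfolding loop_err_def using assms b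
    by (intro add_nonneg_nonneg mult_nonneg_nonneg divide_nonneg_nonneg) auto
  have f: "c / real n \<le> c" if "0 \<le> c" for c :: real
    using divide_left_mono[of 1 "real n" c] assms(2) that by simp
  have "loop_err n d nu k G \<le> 2 * 1 + nu * real k * ((6 + 8 * real k) + 8 * (real k)\<^sup>2) + 2"
    unfolding loop_err_def using assms b f[of "6 + 8 * real k"] f[of 2]
    by (intro add_mono mult_left_mono mult_nonneg_nonneg) auto
  then show "loop_err n d nu k G \<le> 4 + nu * real k * (6 + 8 * real k + 8 * (real k)\<^sup>2)" by simp
qed

lemma pavg_davg_diff_bound:
  assumes "2 \<le> d" shows "\<bar>pavg n d (disc \<eta>) - davg n d k G \<eta>\<bar> \<le> 1"
  using davg_bounds[OF assms, of n k G \<eta>] pavg_bounds[of "disc \<eta>" n d] by (simp add: abs_le_iff)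

lemma Lgen_sum_cmult: "Lgen n d nu (\<lambda>a. \<Sum>k\<in>A. c k * f k a) a = (\<Sum>k\<in>A. c k * Lgen n d nu (f k) a)"
  unfolding Lgen_def by (simp add: sum_distrib_left mult.left_commute) (rule sum.swap)

lemma Lgen_diff: "Lgen n d nu (\<lambda>a. f a - g a) a = Lgen n d nu f a - Lgen n d nu g a"
  unfolding Lgen_def by (simp add: right_diff_distrib sum_subtractf)

text \<open>Passing to the defects makes the system homogeneous: the rewiring drift is already a
  multiple of the defect, and in the voter part \<open>pavg\<close> cancels because the weights
  \<open>1 / d\<close> and \<open>(d - 1) / d\<close> sum to 1.\<close>

lemma Lgen_level:
  assumes a: "(G, \<eta>) \<in> vstates n d" and d: "2 \<le> d" and n: "0 < n" and nu: "0 < nu"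
  defines "E \<equiv> \<lambda>k. pavg n d (disc \<eta>) - davg n d k G \<eta>"
  shows "\<bar>Lgen n d nu (\<lambda>a. pavg n d (disc (snd a)) - davg n d (Suc k) (fst a) (snd a)) (G, \<eta>)
     - (2 / real d * E k + (real d - 1) * (2 / real d) * E (Suc (Suc k)) - (2 + nu * real (Suc k)) * E (Suc k))\<bar>
    \<le> loop_err n d nu (Suc k) G"
proof -
  have G: "G \<in> matchings n d" using a by (auto simp: vstates_def)
  define A where "A = pavg n d (disc \<eta>)"
  define k1 where "k1 = real (Suc k)"
  have A: "Lgen n d nu (\<lambda>a. pavg n d (disc (snd a))) (G, \<eta>) = Lvot n d G (\<lambda>\<eta>. pavg n d (disc \<eta>)) \<eta>"
    using a by (simp add: Lgen_eq Lrew_def)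
  have D: "Lgen n d nu (\<lambda>a. davg n d (Suc k) (fst a) (snd a)) (G, \<eta>) = 
     Lrew n d nu (\<lambda>G. davg n d (Suc k) G \<eta>) G + Lvot n d G (davg n d (Suc k) G) \<eta>"
    using a by (simp add: Lgen_eq)
  have 1: "\<bar>Lvot n d G (\<lambda>\<eta>. pavg n d (disc \<eta>)) \<eta>\<bar> \<le> 2 / real n" by (rule Lvot_pavg[OF G n d])
  have "\<bar>Lrew n d nu (\<lambda>G. davg n d (Suc k) G \<eta>) G - nu * k1 * E (Suc k)\<bar>
    \<le> nu * k1 * ((6 + 8 * k1) / real (d * n) + 8 * savg n d (Suc k) G)"
    unfolding E_def k1_def by (rule Lrew_davg[OF G d n nu])
  also have "\<dots> \<le> nu * k1 * ((6 + 8 * k1) / real n + 8 * savg n d (Suc k) G)"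
    using nu d n by (intro mult_left_mono add_right_mono divide_left_mono) (auto simp: k1_def)
  finally have 2: "\<bar>Lrew n d nu (\<lambda>G. davg n d (Suc k) G \<eta>) G - nu * k1 * E (Suc k)\<bar>
    \<le> nu * k1 * ((6 + 8 * k1) / real n + 8 * savg n d (Suc k) G)" .
  have "2 * (davg n d k G \<eta> / real d + (real d - 1) / real d * davg n d (Suc (Suc k)) G \<eta> - davg n d (Suc k) G \<eta>)
    = 2 * E (Suc k) - 2 / real d * E k - (real d - 1) * (2 / real d) * E (Suc (Suc k))"
    using d by (simp add: E_def field_simps)
  then have 3: "\<bar>Lvot n d G (davg n d (Suc k) G) \<eta> - (2 * E (Suc k) - 2 / real d * E k - (real d - 1) * (2 / real d) * E (Suc (Suc k)))\<bar>
    \<le> 2 * ravg n d (Suc k) G" using Lvot_davg[OF G n d, of k \<eta>] by simp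
  have "\<bar>x - (y + z) - (p + q - (2 + m) * e)\<bar> \<le> 2 * r + s + t"
    if "\<bar>x\<bar> \<le> t" "\<bar>y - m * e\<bar> \<le> s" "\<bar>z - (2 * e - p - q)\<bar> \<le> 2 * r" for x y z p q m e r s t :: real
    using that by (simp add: abs_le_iff algebra_simps)
  from this[OF 1 2 3] show ?thesis
    unfolding Lgen_diff A D loop_err_def k1_def .
qed

text \<open>Summation by parts moves the three-term operator from the defects to the coefficients,
  where the recursion kills the interior. Level 0 leaves \<open>2 / d * c 1\<close> times
  \<open>pavg\<close>; level 1 leaves minus the first defect, by the normalisation of
  \<open>c 0\<close>; level \<open>Suc K\<close> is the cost of truncation, at most
  \<open>2 * c K\<close> because defects are bounded by 1.\<close>

lemma Lgen_corrector:
  assumes a: "(G, \<eta>) \<in> vstates n d" and d: "2 \<le> d" and n: "0 < n" and nu: "0 < nu" and K: "1 \<le> K"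
    and c0: "(real d - 1) * (2 / real d) * c 0 = 1"
    and rec: "\<And>k. k \<in> {1..K} \<Longrightarrow> 2 / real d * c (Suc k) + (real d - 1) * (2 / real d) * c (k - 1) = (2 + nu * real k) * c k"
    and cK: "c (Suc K) = 0" "0 \<le> c K"
  shows "\<bar>Lgen n d nu (corrector n d c K) (G, \<eta>) - (davg n d 1 G \<eta> - (1 - 2 / real d * c 1) * pavg n d (disc \<eta>))\<bar>
    \<le> 2 * c K + (\<Sum>k\<in>{1..K}. \<bar>c k\<bar> * loop_err n d nu k G)"
proof -
  define p where "p = 2 / real d"
  define q where "q = (real d - 1) * (2 / real d)"
  define E where "E k = pavg n d (disc \<eta>) - davg n d k G \<eta>" for k
  define Y where "Y k = Lgen n d nu (\<lambda>a. pavg n d (disc (snd a)) - davg n d k (fst a) (snd a)) (G, \<eta>)" for k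
  define Z where "Z k = p * E (k - 1) + q * E (Suc k) - (2 + nu * real k) * E k" for k
  have YZ: "\<bar>Y k - Z k\<bar> \<le> loop_err n d nu k G" if "k \<in> {1..K}" for k
  proof -
    obtain l where "k = Suc l" using \<open>k \<in> {1..K}\<close> by (cases k) auto
    then show ?thesis using Lgen_level[OF a d n nu, of l] unfolding Y_def Z_def p_def q_def E_def by simp
  qed
  have cZ: "c k * Z k = p * (c k * E (k - 1) - c (Suc k) * E k) + q * (c k * E (Suc k) - c (k - 1) * E k)"
    if "k \<in> {1..K}" for k
  proof -
    have "c k * ((2 + nu * real k) * E k) = (p * c (Suc k) + q * c (k - 1)) * E k"
      using rec[OF that] by (simp add: p_def q_def)
    then show ?thesis by (simp add: Z_def algebra_simps)
  qed
  have t1: "(\<Sum>k\<in>{1..m}. c k * E (k - 1) - c (Suc k) * E k) = c 1 * E 0 - c (Suc m) * E m" for m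
    by (induction m) auto
  have t2: "(\<Sum>k\<in>{1..m}. c k * E (Suc k) - c (k - 1) * E k) = c m * E (Suc m) - c 0 * E 1" for m
    by (induction m) auto
  have "(\<Sum>k\<in>{1..K}. c k * Z k) = 
      (\<Sum>k\<in>{1..K}. p * (c k * E (k - 1) - c (Suc k) * E k) + q * (c k * E (Suc k) - c (k - 1) * E k))"
    by (rule sum.cong[OF refl cZ])
  also have "\<dots> = p * (c 1 * E 0) + q * (c K * E (Suc K) - c 0 * E 1)"
    unfolding sum.distrib sum_distrib_left[symmetric] t1 t2 by (simp add: cK)
  also have "\<dots> = p * c 1 * E 0 - E 1 + q * c K * E (Suc K)"
  proof -
    have "q * c 0 = 1" using c0 by (simp only: q_def)
    then show ?thesis by (simp add: right_diff_distrib mult.assoc[symmetric])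
  qed
  finally have Zsum: "(\<Sum>k\<in>{1..K}. c k * Z k) = p * c 1 * E 0 - E 1 + q * c K * E (Suc K)" .
  have E0: "E 0 = pavg n d (disc \<eta>)" by (simp add: E_def)
  have L: "Lgen n d nu (corrector n d c K) (G, \<eta>) = (\<Sum>k\<in>{1..K}. c k * Y k)"
    unfolding corrector_def Lgen_sum_cmult Y_def ..
  have "\<bar>(\<Sum>k\<in>{1..K}. c k * Y k) - (\<Sum>k\<in>{1..K}. c k * Z k)\<bar> = \<bar>\<Sum>k\<in>{1..K}. c k * (Y k - Z k)\<bar>"
    by (simp add: sum_subtractf right_diff_distrib)
  also have "\<dots> \<le> (\<Sum>k\<in>{1..K}. \<bar>c k\<bar> * loop_err n d nu k G)"
    by (intro order.trans[OF sum_abs] sum_mono) (auto simp: abs_mult intro!: mult_left_mono YZ)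
  finally have 1: "\<bar>(\<Sum>k\<in>{1..K}. c k * Y k) - (\<Sum>k\<in>{1..K}. c k * Z k)\<bar> \<le> (\<Sum>k\<in>{1..K}. \<bar>c k\<bar> * loop_err n d nu k G)" .
  have q: "0 \<le> q" "q \<le> 2" using d by (auto simp: q_def field_simps)
  have "\<bar>q * c K * E (Suc K)\<bar> = q * c K * \<bar>E (Suc K)\<bar>" using q cK by (simp add: abs_mult)
  also have "\<dots> \<le> 2 * c K * 1" using q cK pavg_davg_diff_bound[OF d] unfolding E_def
    by (intro mult_mono mult_nonneg_nonneg) auto
  finally have 2: "\<bar>q * c K * E (Suc K)\<bar> \<le> 2 * c K" by simp
  have "davg n d 1 G \<eta> - (1 - 2 / real d * c 1) * pavg n d (disc \<eta>) = p * c 1 * E 0 - E 1"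
    unfolding E0 by (simp add: E_def p_def algebra_simps)
  then show ?thesis using 1 2 unfolding L Zsum by linarith
qed

section \<open>Deviation probability in terms of a corrector\<close>

context voter
begin

text \<open>The deviation splits into \<open>1 / (2 * \<theta>)\<close> times the time integral of
  \<open>Lgen n d nu F\<close>, small in mean square, and the integral of a remainder, small in
  mean. Both are put into one integrable majorant, to which Markov's inequality applies.\<close>

lemma deviation_bound:
  fixes F :: "vstate \<Rightarrow> real"
  assumes n: "0 < n" and d: "2 \<le> d" and th: "0 < \<theta>" and T: "0 < T" and \<epsilon>: "0 < \<epsilon>" and \<delta>: "0 < \<delta>"
    and F: "\<And>a. a \<in> vstates n d \<Longrightarrow> \<bar>F a\<bar> \<le> C" "0 \<le> C"
    and LF: "\<And>a. a \<in> vstates n d \<Longrightarrow> \<bar>Lgen n d nu F a\<bar> \<le> B" "0 \<le> B"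
  defines "\<gamma> \<equiv> real n / (2 * \<theta>)"
  shows "measure M {\<omega> \<in> space M. \<epsilon> < \<bar>\<gamma> / real n * (LINT s:{0..T}|lborel. D_obs n d (X (\<gamma> * s) \<omega>))
       - (LINT s:{0..T}|lborel. O_obs n (X (\<gamma> * s) \<omega>) * (1 - O_obs n (X (\<gamma> * s) \<omega>)))\<bar>}
    \<le> (\<delta> + 4 * B * C * T / (\<gamma> * \<delta>) + 
        occ \<gamma> T (\<lambda>a. \<bar>davg n d 1 (fst a) (snd a) - \<theta> * pavg n d (disc (snd a)) - Lgen n d nu F a\<bar>)) / (2 * \<theta> * \<epsilon>)"
proof -
  have \<gamma>: "0 < \<gamma>" using n th by (simp add: \<gamma>_def)
  have gn: "\<gamma> / real n = 1 / (2 * \<theta>)" using n by (simp add: \<gamma>_def)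
  define O2 where "O2 a = O_obs n a * (1 - O_obs n a)" for a
  define h where "h = onS (Lgen n d nu F)"
  \<comment> \<open>By the choice of \<open>\<gamma>\<close> the prefactor of \<open>D_obs\<close>
    is \<open>1 / (2 * \<theta>)\<close>, and \<open>O2\<close> is half of \<open>pavg\<close>; on
    \<open>vstates\<close> this is thus
    \<open>(davg - \<theta> * pavg - Lgen F) / (2 * \<theta>)\<close>.\<close>
  define r where "r a = D_obs n d a / (2 * \<theta>) - O2 a - h a / (2 * \<theta>)" for a
  have hB: "\<bar>h a\<bar> \<le> B" for a unfolding h_def using LF by (intro abs_onS_le)
  have DB: "\<bar>D_obs n d a\<bar> \<le> 2" for a using D_obs_bounds[of n d a] by simp
  have OB: "\<bar>O2 a\<bar> \<le> 1" for a
    using O_obs_bounds[of n a] by (simp add: O2_def abs_mult mult_le_one)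
  have rB: "\<bar>r a\<bar> \<le> 2 / (2 * \<theta>) + 1 + B / (2 * \<theta>)" for a
  proof -
    have "\<bar>r a\<bar> \<le> \<bar>D_obs n d a / (2 * \<theta>)\<bar> + \<bar>O2 a\<bar> + \<bar>h a / (2 * \<theta>)\<bar>" unfolding r_def by linarith
    also have "\<dots> \<le> 2 / (2 * \<theta>) + 1 + B / (2 * \<theta>)"
      unfolding abs_divide using DB[of a] hB[of a] OB[of a] th by (intro add_mono divide_mono) auto
    finally show ?thesis .
  qed
  define Ih where "Ih \<omega> = (LINT s:{0..T}|lborel. h (X (\<gamma> * s) \<omega>))" for \<omega>
  define Ir where "Ir \<omega> = (LINT s:{0..T}|lborel. r (X (\<gamma> * s) \<omega>))" for \<omega>
  define V where "V \<omega> = \<gamma> / real n * (LINT s:{0..T}|lborel. D_obs n d (X (\<gamma> * s) \<omega>))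
       - (LINT s:{0..T}|lborel. O2 (X (\<gamma> * s) \<omega>))" for \<omega>
  have V: "V \<omega> = Ih \<omega> / (2 * \<theta>) + Ir \<omega>" if "\<omega> \<in> space M" for \<omega>
  proof -
    have i: "integrable (restrict_space lborel {0..T}) (\<lambda>s. f (X (\<gamma> * s) \<omega>))" if "\<And>a. \<bar>f a\<bar> \<le> b" for f :: "vstate \<Rightarrow> real" and b
    proof -
      have "(\<lambda>_. \<omega>) \<in> restrict_space lborel {0..T} \<rightarrow>\<^sub>M M" using \<open>\<omega> \<in> space M\<close> by (rule measurable_const)
      from X_time_meas[OF \<gamma> T meas_id_L[OF \<gamma> T] this, of f]
      have m: "(\<lambda>s. f (X (\<gamma> * s) \<omega>)) \<in> borel_measurable (restrict_space lborel {0..T})" .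
      show ?thesis
        using bounded_integrable[OF \<gamma> T L_finite[OF \<gamma> T] m, of b] that by simp
    qed
    note ii = i[of "D_obs n d" 2, OF DB] i[of O2 1, OF OB] i[of h B, OF hB]
    let ?L = "restrict_space lborel {0..T}"
    have "(\<integral>s. r (X (\<gamma> * s) \<omega>) \<partial>?L) = (\<integral>s. D_obs n d (X (\<gamma> * s) \<omega>) \<partial>?L) / (2 * \<theta>)
        - (\<integral>s. O2 (X (\<gamma> * s) \<omega>) \<partial>?L) - (\<integral>s. h (X (\<gamma> * s) \<omega>) \<partial>?L) / (2 * \<theta>)"
    proof -
      have i1: "integrable ?L (\<lambda>s. D_obs n d (X (\<gamma> * s) \<omega>) / (2 * \<theta>))" by (intro integrable_divide ii)
      have i3: "integrable ?L (\<lambda>s. h (X (\<gamma> * s) \<omega>) / (2 * \<theta>))" by (intro integrable_divide ii)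
      show ?thesis
        unfolding r_def Bochner_Integration.integral_diff[OF Bochner_Integration.integrable_diff[OF i1 ii(2)] i3]
          Bochner_Integration.integral_diff[OF i1 ii(2)] by simp
    qed
    then show ?thesis
      unfolding V_def Ih_def Ir_def L_integral[OF \<gamma> T, symmetric] gn by simp
  qed
  define U where "U \<omega> = (\<delta> + (Ih \<omega>)\<^sup>2 / \<delta>) / (2 * \<theta>) + \<bar>Ir \<omega>\<bar>" for \<omega>
  \<comment> \<open>Trades the mean of \<open>\<bar>Ih \<omega>\<bar>\<close> for its second moment;
    \<open>\<delta>\<close> stays free and is matched to the target precision at the end.\<close>
  have abs_sq: "\<bar>x\<bar> \<le> \<delta> + x\<^sup>2 / \<delta>" for x :: real
  proof -
    have "0 \<le> \<bar>x\<bar>\<^sup>2 - 2 * \<bar>x\<bar> * \<delta> + \<delta>\<^sup>2"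
      using zero_le_power2[of "\<bar>x\<bar> - \<delta>"] by (simp only: power2_diff algebra_simps)
    moreover have "0 \<le> \<bar>x\<bar> * \<delta>" using \<delta> by simp
    ultimately have "\<bar>x\<bar> * \<delta> \<le> \<delta> * \<delta> + x\<^sup>2" by (simp add: power2_eq_square)
    then show ?thesis using \<delta> by (simp add: field_simps power2_eq_square)
  qed
  have VU: "\<bar>V \<omega>\<bar> \<le> U \<omega>" if "\<omega> \<in> space M" for \<omega>
  proof -
    have "\<bar>V \<omega>\<bar> \<le> \<bar>Ih \<omega>\<bar> / (2 * \<theta>) + \<bar>Ir \<omega>\<bar>"
      unfolding V[OF that] using th by (intro order.trans[OF abs_triangle_ineq]) simp
    also have "\<dots> \<le> U \<omega>" unfolding U_def using th abs_sq by (intro add_right_mono divide_right_mono) auto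
    finally show ?thesis .
  qed
  have iI: "integrable M (\<lambda>\<omega>. (Ih \<omega>)\<^sup>2)" and EI: "expectation (\<lambda>\<omega>. (Ih \<omega>)\<^sup>2) \<le> 4 * B * C * T / \<gamma>"
    unfolding Ih_def h_def using corrector_moments(1,2)[OF \<gamma> T F LF] by auto
  have iR: "integrable M (\<lambda>\<omega>. \<bar>Ir \<omega>\<bar>)" and ER: "expectation (\<lambda>\<omega>. \<bar>Ir \<omega>\<bar>) \<le> occ \<gamma> T (\<lambda>a. \<bar>r a\<bar>)"
    unfolding Ir_def using first_moment_abs[OF \<gamma> T, of r, OF rB] by auto
  have iU: "integrable M U" unfolding U_def using iI iR by simp
  define R where "R a = \<bar>davg n d 1 (fst a) (snd a) - \<theta> * pavg n d (disc (snd a)) - Lgen n d nu F a\<bar>" for a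
  have "occ \<gamma> T (\<lambda>a. \<bar>r a\<bar>) \<le> occ \<gamma> T (\<lambda>a. 1 / (2 * \<theta>) * R a)"
  proof (rule occ_mono[OF \<gamma> T])
    fix a assume a: "a \<in> vstates n d"
    obtain G \<eta> where [simp]: "a = (G, \<eta>)" by (cases a)
    have G: "G \<in> matchings n d" using a by (simp add: vstates_def)
    have "r a = (davg n d 1 G \<eta> - \<theta> * pavg n d (disc \<eta>) - Lgen n d nu F a) / (2 * \<theta>)"
    proof -
      have "O2 a = pavg n d (disc \<eta>) / 2" unfolding O2_def using O_obs_pavg[of n d G \<eta>] n d by simp
      then show ?thesis using a th by (simp add: r_def h_def onS_def D_obs_davg[OF G d] field_simps)
    qed
    then show "\<bar>r a\<bar> \<le> 1 / (2 * \<theta>) * R a" using th by (simp add: R_def)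
  qed
  also have "\<dots> = 1 / (2 * \<theta>) * occ \<gamma> T R" by (rule occ_cmult[OF \<gamma> T])
  finally have ER': "expectation (\<lambda>\<omega>. \<bar>Ir \<omega>\<bar>) \<le> 1 / (2 * \<theta>) * occ \<gamma> T R" using ER by linarith
  have EU: "expectation U \<le> (\<delta> + 4 * B * C * T / (\<gamma> * \<delta>) + occ \<gamma> T R) / (2 * \<theta>)"
  proof -
    have "expectation U = (\<delta> + expectation (\<lambda>\<omega>. (Ih \<omega>)\<^sup>2) / \<delta>) / (2 * \<theta>) + expectation (\<lambda>\<omega>. \<bar>Ir \<omega>\<bar>)"
      unfolding U_def using iI iR by (simp add: prob_space)
    also have "\<dots> \<le> (\<delta> + 4 * B * C * T / \<gamma> / \<delta>) / (2 * \<theta>) + 1 / (2 * \<theta>) * occ \<gamma> T R"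
      using EI ER' th \<delta> by (intro add_mono divide_right_mono) auto
    finally show ?thesis by (simp add: add_divide_distrib)
  qed
  have mU: "{\<omega> \<in> space M. \<epsilon> \<le> U \<omega>} \<in> sets M" using borel_measurable_integrable[OF iU] by measurable
  have U0: "0 \<le> U \<omega>" for \<omega> unfolding U_def using \<delta> th by (intro add_nonneg_nonneg divide_nonneg_nonneg) auto
  have "measure M {\<omega> \<in> space M. \<epsilon> < \<bar>V \<omega>\<bar>} \<le> measure M {\<omega> \<in> space M. \<epsilon> \<le> U \<omega>}"
    using VU by (intro finite_measure_mono mU) force
  also have "\<dots> \<le> expectation U / \<epsilon>"
    using integral_Markov_inequality_measure[OF iU sets.top _ \<epsilon>] U0 by auto
  also have "\<dots> \<le> (\<delta> + 4 * B * C * T / (\<gamma> * \<delta>) + occ \<gamma> T R) / (2 * \<theta>) / \<epsilon>"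
    using EU \<epsilon> by (intro divide_right_mono) auto
  finally show ?thesis unfolding V_def O2_def R_def by simp
qed

end

section \<open>Convergence\<close>

locale voter_family =
  fixes d :: nat and nu u T :: real and M :: "nat \<Rightarrow> 'w measure" and X :: "nat \<Rightarrow> real \<Rightarrow> 'w \<Rightarrow> vstate"
  assumes d: "3 \<le> d" and nu: "0 < nu" and T: "0 < T"
    and proc: "\<And>n. 0 < n \<Longrightarrow> even (d * n) \<Longrightarrow> is_voter_process n d nu u (M n) (X n)"
begin

lemma d2: "2 \<le> d" using d by simp

lemma voter: "0 < n \<Longrightarrow> even (d * n) \<Longrightarrow> voter n d nu u (M n) (X n)"
  using proc by unfold_locales auto

lemma gamma_pos: "0 < n \<Longrightarrow> 0 < gamma_n d nu n"
  using theta_pos[OF d nu] by (simp add: gamma_n_def)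

abbreviation occn :: "nat \<Rightarrow> (vstate \<Rightarrow> real) \<Rightarrow> real" where
  "occn n \<equiv> voter.occ n d (M n) (X n) (gamma_n d nu n) T"

text \<open>A one-sided \<open>O(1 / n)\<close> bound along the admissible \<open>n\<close>, at the
  time scale \<open>gamma_n\<close>; the loop quantities it serves for are nonnegative. It is stable
  under finite nonnegative combinations, from which all loop errors are built.\<close>

definition decays :: "(nat \<Rightarrow> vstate \<Rightarrow> real) \<Rightarrow> bool" where
  "decays f \<longleftrightarrow> (\<exists>C. \<forall>n. 0 < n \<longrightarrow> even (d * n) \<longrightarrow> occn n (f n) \<le> C / real n)"

lemma decays_add: assumes "decays f" "decays g" shows "decays (\<lambda>n a. f n a + g n a)"
proof -
  obtain C D where *: "\<And>n. 0 < n \<Longrightarrow> even (d * n) \<Longrightarrow> occn n (f n) \<le> C / real n"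
    "\<And>n. 0 < n \<Longrightarrow> even (d * n) \<Longrightarrow> occn n (g n) \<le> D / real n" using assms unfolding decays_def by metis
  have "occn n (\<lambda>a. f n a + g n a) \<le> (C + D) / real n" if "0 < n" "even (d * n)" for n
    using *[OF that] voter.occ_add[OF voter[OF that] gamma_pos[OF that(1)] T] by (simp add: add_divide_distrib)
  then show ?thesis unfolding decays_def by blast
qed

lemma decays_cmult: assumes "decays f" "0 \<le> c" shows "decays (\<lambda>n a. c * f n a)"
proof -
  obtain C where *: "\<And>n. 0 < n \<Longrightarrow> even (d * n) \<Longrightarrow> occn n (f n) \<le> C / real n"
    using assms unfolding decays_def by metis
  have "occn n (\<lambda>a. c * f n a) \<le> (c * C) / real n" if "0 < n" "even (d * n)" for n
    using mult_left_mono[OF *[OF that] assms(2)] voter.occ_cmult[OF voter[OF that] gamma_pos[OF that(1)] T] by simp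
  then show ?thesis unfolding decays_def by blast
qed

lemma decays_const: assumes "0 \<le> c" shows "decays (\<lambda>n a. c / real n)"
proof -
  have "occn n (\<lambda>a. c / real n) \<le> (c * T) / real n" if "0 < n" "even (d * n)" for n
    using voter.occ_abs_const[OF voter[OF that] gamma_pos[OF that(1)] T, of "c / real n"] assms by simp
  then show ?thesis unfolding decays_def by blast
qed

lemma decays_sum: assumes "finite A" "\<And>i. i \<in> A \<Longrightarrow> decays (f i)" shows "decays (\<lambda>n a. \<Sum>i\<in>A. f i n a)"
  using assms
proof (induction A rule: finite_induct)
  case empty
  show ?case using decays_const[of 0] by simp
next
  case (insert i A)
  then show ?case using decays_add[of "f i" "\<lambda>n a. \<Sum>i\<in>A. f i n a"] by simp
qed

text \<open>Strong induction on the length: the error in \<open>occ_ret_step\<close> involves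
  strictly shorter blocks only. For a single letter there are none, so no separate base case
  arises.\<close>

lemma decays_ret: "set w \<subseteq> {1..<d} \<Longrightarrow> w \<noteq> [] \<Longrightarrow> decays (\<lambda>n a. ret n d (fst a) w)"
proof (induction w rule: length_induct)
  case (1 w)
  have "decays (\<lambda>n a. ret n d (fst a) (take i (drop m w)))" if "m < length w" "i \<in> {1..<length w}" for m i
  proof -
    have "length (take i (drop m w)) < length w" "take i (drop m w) \<noteq> []" using that by auto
    moreover have "set (take i (drop m w)) \<subseteq> {1..<d}"
      using 1(2) set_take_subset set_drop_subset by fastforce
    ultimately show ?thesis using 1(1) by blast
  qed
  then have "decays (\<lambda>n a. subret n d (fst a) w)"
    unfolding subret_def by (intro decays_sum) auto
  then obtain C where C: "\<And>n. 0 < n \<Longrightarrow> even (d * n) \<Longrightarrow> occn n (\<lambda>a. subret n d (fst a) w) \<le> C / real n"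
    unfolding decays_def by metis
  \<comment> \<open>The last summand is \<open>n\<close> times \<open>2 / (gamma_n * nu)\<close>,
    with \<open>gamma_n = n / (2 * theta)\<close>.\<close>
  define D where "D = (7 + 8 * real (length w)) * T + 8 * C + 4 * theta d nu / nu"
  have "occn n (\<lambda>a. ret n d (fst a) w) \<le> D / real n" if n: "0 < n" "even (d * n)" for n
  proof -
    interpret V: voter n d nu u "M n" "X n" by (rule voter[OF n])
    note g = gamma_pos[OF n(1)]
    have "V.occ (gamma_n d nu n) T (\<lambda>a. subret n d (fst a) w) = 
       (\<Sum>m<length w. \<Sum>i\<in>{1..<length w}. V.occ (gamma_n d nu n) T (\<lambda>a. ret n d (fst a) (take i (drop m w))))"
      unfolding subret_def by (simp add: V.occ_sum[OF g T])
    then have "V.occ (gamma_n d nu n) T (\<lambda>a. ret n d (fst a) w) \<le> (7 + 8 * real (length w)) / real n * T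
       + 8 * (C / real n) + 2 / (gamma_n d nu n * nu)"
      using V.occ_ret_step[OF g T n(1) d2 nu 1(2,3)] C[OF n] by linarith
    also have "\<dots> = D / real n"
      using n nu theta_pos[OF d nu] by (simp add: D_def gamma_n_def field_simps)
    finally show ?thesis .
  qed
  then show ?case unfolding decays_def by blast
qed

lemma decays_ravg: assumes "1 \<le> k" shows "decays (\<lambda>n a. ravg n d k (fst a))"
proof -
  have "decays (\<lambda>n a. 1 / (real d - 1) ^ k * (\<Sum>w\<in>words d k. ret n d (fst a) w))"
    using d assms by (intro decays_cmult decays_sum[OF finite_words] decays_ret) (auto simp: words_def)
  then show ?thesis by (simp add: ravg_def)
qed

lemma decays_savg: "decays (\<lambda>n a. savg n d k (fst a))"
proof -
  have "set (take i (drop m w)) \<subseteq> {1..<d}" if "w \<in> words d k" for m i w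
    using that set_take_subset[of i "drop m w"] set_drop_subset[of m w] unfolding words_def by blast
  then have "decays (\<lambda>n a. 1 / (real d - 1) ^ k * (\<Sum>w\<in>words d k. \<Sum>m<length w. \<Sum>i\<in>{1..<length w}. ret n d (fst a) (take i (drop m w))))"
    using d by (intro decays_cmult decays_sum decays_ret) auto
  then show ?thesis by (simp add: savg_def subret_def)
qed

lemma decays_loop_err: assumes "1 \<le> k" shows "decays (\<lambda>n a. loop_err n d nu k (fst a))"
  unfolding loop_err_def using nu
  by (intro decays_add decays_cmult decays_ravg[OF assms] decays_savg decays_const) auto

text \<open>\<open>K\<close> is chosen from \<open>\<delta>\<close> (with \<open>d\<close>,
  \<open>nu\<close> and \<open>T\<close> fixed), so that the truncated constant is close to
  \<open>theta d nu\<close> and \<open>c K\<close> is small. The constants \<open>B\<close>,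
  \<open>C\<close> and \<open>D\<close> then depend on \<open>K\<close> but not on \<open>n\<close>,
  which allows \<open>n\<close> to tend to infinity afterwards.\<close>

lemma corrector_remainder:
  assumes \<delta>: "0 < \<delta>"
  obtains F B C D where "0 \<le> B" "0 \<le> C"
    "\<And>n a. 0 < n \<Longrightarrow> even (d * n) \<Longrightarrow> a \<in> vstates n d \<Longrightarrow> \<bar>F n a\<bar> \<le> C"
    "\<And>n a. 0 < n \<Longrightarrow> even (d * n) \<Longrightarrow> a \<in> vstates n d \<Longrightarrow> \<bar>Lgen n d nu (F n) a\<bar> \<le> B"
    "\<And>n. 0 < n \<Longrightarrow> even (d * n) \<Longrightarrow> occn n (\<lambda>a. \<bar>davg n d 1 (fst a) (snd a)
       - theta d nu * pavg n d (disc (snd a)) - Lgen n d nu (F n) a\<bar>) \<le> \<delta> + D / real n"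
proof -
  define thK where "thK K = 1 - cf_trunc (cf_coef d nu) 1 K / beta_d d" for K
  \<comment> \<open>The first summand is the error of the truncated fraction, the second dominates
    \<open>2 * c K\<close>; the target \<open>\<delta> / T\<close> below accounts for the length of
    the time interval.\<close>
  have "(\<lambda>K. \<bar>thK K - theta d nu\<bar> + 2 * (1 / (nu * real K))) \<longlonglongrightarrow> \<bar>theta d nu - theta d nu\<bar> + 2 * 0"
  proof (intro tendsto_intros)
    show "thK \<longlonglongrightarrow> theta d nu" unfolding thK_def theta_def
      using beta_facts[OF d nu] by (intro tendsto_intros cf_trunc_tendsto_Delta[OF d nu]) auto
    show "(\<lambda>K. 1 / (nu * real K)) \<longlonglongrightarrow> 0"
      using tendsto_mult_right_zero[OF lim_const_over_n[of 1], of "1 / nu"] by simp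
  qed
  then have "eventually (\<lambda>K. \<bar>thK K - theta d nu\<bar> + 2 * (1 / (nu * real K)) < \<delta> / T) sequentially"
    using \<delta> T by (intro order_tendstoD(2)[where a = "\<delta> / T"]) auto
  then have "eventually (\<lambda>K. 1 \<le> K \<and> \<bar>thK K - theta d nu\<bar> + 2 * (1 / (nu * real K)) < \<delta> / T) sequentially"
    using eventually_ge_at_top[of 1] by eventually_elim auto
  then obtain K where K: "1 \<le> K" and Ks: "\<bar>thK K - theta d nu\<bar> + 2 * (1 / (nu * real K)) < \<delta> / T"
    unfolding eventually_sequentially by blast
  obtain c where c0: "(real d - 1) * (2 / real d) * c 0 = 1" 
    and c1: "2 / real d * c 1 = cf_trunc (cf_coef d nu) 1 K / beta_d d"
    and rec: "\<And>k. k \<in> {1..K} \<Longrightarrow> 2 / real d * c (Suc k) + (real d - 1) * (2 / real d) * c (k - 1) = (2 + nu * real k) * c k"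
    and cK: "c (Suc K) = 0" "0 \<le> c K" and cKle: "c K \<le> 1 / (nu * real K)"
    using corrector_coefficients[OF d nu K] by blast
  define e where "e n a = (\<Sum>k\<in>{1..K}. \<bar>c k\<bar> * loop_err n d nu k (fst a))" for n and a :: vstate
  define C where "C = (\<Sum>k\<in>{1..K}. \<bar>c k\<bar>)"
  define B where "B = 1 + \<bar>thK K\<bar> + 2 * c K + (\<Sum>k\<in>{1..K}. \<bar>c k\<bar> * (4 + nu * real k * (6 + 8 * real k + 8 * (real k)\<^sup>2)))"
  have "decays e" unfolding e_def
    by (intro decays_sum decays_cmult decays_loop_err) auto
  then obtain D where D: "\<And>n. 0 < n \<Longrightarrow> even (d * n) \<Longrightarrow> occn n (e n) \<le> D / real n"
    unfolding decays_def by metis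
  let ?F = "\<lambda>n. corrector n d c K"
  have main: "(a \<in> vstates n d \<longrightarrow> \<bar>?F n a\<bar> \<le> C) \<and> (a \<in> vstates n d \<longrightarrow> \<bar>Lgen n d nu (?F n) a\<bar> \<le> B) \<and>
     occn n (\<lambda>a. \<bar>davg n d 1 (fst a) (snd a) - theta d nu * pavg n d (disc (snd a)) - Lgen n d nu (?F n) a\<bar>)
       \<le> \<delta> + D / real n" if n: "0 < n" "even (d * n)" for n a
  proof -
    interpret V: voter n d nu u "M n" "X n" by (rule voter[OF n])
    note g = gamma_pos[OF n(1)]
    have L: "\<bar>Lgen n d nu (corrector n d c K) a - (davg n d 1 (fst a) (snd a) - thK K * pavg n d (disc (snd a)))\<bar>
        \<le> 2 * c K + e n a" if "a \<in> vstates n d" for a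
      using Lgen_corrector[of "fst a" "snd a" n d nu K c] that d2 n(1) nu K c0 rec cK
      by (simp add: e_def thK_def c1[simplified])
    have pb: "0 \<le> pavg n d (disc \<eta>)" "pavg n d (disc \<eta>) \<le> 1" for \<eta> using pavg_bounds[of "disc \<eta>"] by auto
    have "\<bar>corrector n d c K a\<bar> \<le> C" for a
      unfolding corrector_def C_def
      by (intro order.trans[OF sum_abs] sum_mono) (simp add: abs_mult mult_left_le pavg_davg_diff_bound[OF d2])
    moreover have "\<bar>Lgen n d nu (corrector n d c K) a\<bar> \<le> B" if a: "a \<in> vstates n d" for a
    proof -
      have "\<bar>thK K * pavg n d (disc (snd a))\<bar> \<le> \<bar>thK K\<bar>" using pb by (simp add: abs_mult mult_left_le)
      moreover have "\<bar>davg n d 1 (fst a) (snd a)\<bar> \<le> 1" using davg_bounds[OF d2] by (simp add: abs_le_iff order_trans[of _ 0])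
      moreover have "e n a \<le> (\<Sum>k\<in>{1..K}. \<bar>c k\<bar> * (4 + nu * real k * (6 + 8 * real k + 8 * (real k)\<^sup>2)))"
        unfolding e_def by (intro sum_mono mult_left_mono loop_err_bounds d2 n(1) nu) auto
      ultimately show ?thesis using L[OF a] unfolding B_def by linarith
    qed
    moreover have "occn n (\<lambda>a. \<bar>davg n d 1 (fst a) (snd a) - theta d nu * pavg n d (disc (snd a)) - Lgen n d nu (corrector n d c K) a\<bar>)
       \<le> \<delta> + D / real n"
    proof -
      have "occn n (\<lambda>a. \<bar>davg n d 1 (fst a) (snd a) - theta d nu * pavg n d (disc (snd a)) - Lgen n d nu (corrector n d c K) a\<bar>)
         \<le> occn n (\<lambda>a. (\<bar>thK K - theta d nu\<bar> + 2 * c K) + e n a)"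
      proof (rule V.occ_mono[OF g T])
        fix a assume a: "a \<in> vstates n d"
        have "\<bar>(thK K - theta d nu) * pavg n d (disc (snd a))\<bar> \<le> \<bar>thK K - theta d nu\<bar>"
          using pb by (simp add: abs_mult mult_left_le)
        then show "\<bar>davg n d 1 (fst a) (snd a) - theta d nu * pavg n d (disc (snd a)) - Lgen n d nu (corrector n d c K) a\<bar>
          \<le> (\<bar>thK K - theta d nu\<bar> + 2 * c K) + e n a"
          using L[OF a] unfolding left_diff_distrib by linarith
      qed
      also have "\<dots> = occn n (\<lambda>a. \<bar>thK K - theta d nu\<bar> + 2 * c K) + occn n (e n)" by (rule V.occ_add[OF g T])
      also have "\<dots> \<le> (\<bar>thK K - theta d nu\<bar> + 2 * c K) * T + D / real n"
        using cK by (intro add_mono V.occ_abs_const[OF g T] D n) auto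
      also have "(\<bar>thK K - theta d nu\<bar> + 2 * c K) * T \<le> \<delta> / T * T"
        using Ks cKle T by (intro mult_right_mono) auto
      finally show ?thesis using T by simp
    qed
    ultimately show ?thesis by blast
  qed
  have "0 \<le> C" by (simp add: C_def sum_nonneg)
  moreover have "0 \<le> B" unfolding B_def using cK nu by (intro add_nonneg_nonneg sum_nonneg mult_nonneg_nonneg) auto
  ultimately show thesis
    using main by (intro that[where F = ?F and B = B and C = C and D = D]) simp_all
qed

lemma deviation_tendsto_0:
  assumes \<epsilon>: "0 < \<epsilon>"
  shows "(\<lambda>n. if 0 < n \<and> even (d * n) then
            measure (M n) {\<omega> \<in> space (M n).
              \<epsilon> < \<bar>gamma_n d nu n / real n *
                      set_lebesgue_integral lborel {0..T} (\<lambda>s. D_obs n d (X n (gamma_n d nu n * s) \<omega>))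
                   - set_lebesgue_integral lborel {0..T}
                      (\<lambda>s. O_obs n (X n (gamma_n d nu n * s) \<omega>) * (1 - O_obs n (X n (gamma_n d nu n * s) \<omega>)))\<bar>}
          else 0) \<longlonglongrightarrow> 0" (is "?f \<longlonglongrightarrow> 0")
proof (rule LIMSEQ_I)
  fix r :: real assume r: "0 < r"
  define \<theta> where "\<theta> = theta d nu"
  have th: "0 < \<theta>" unfolding \<theta>_def by (rule theta_pos[OF d nu])
  \<comment> \<open>Three contributions of size \<open>\<delta>\<close> have to fit under
    \<open>r\<close>: the free parameter of \<open>deviation_bound\<close>, the remainder of the
    corrector, and all terms of order \<open>1 / n\<close>.\<close>
  define \<delta> where "\<delta> = r * (2 * \<theta> * \<epsilon>) / 3"
  have \<delta>: "0 < \<delta>" using r th \<epsilon> by (simp add: \<delta>_def)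
  obtain F B C D where B: "0 \<le> B" and C: "0 \<le> C" and
     F: "\<And>n a. 0 < n \<Longrightarrow> even (d * n) \<Longrightarrow> a \<in> vstates n d \<Longrightarrow> \<bar>F n a\<bar> \<le> C"
     "\<And>n a. 0 < n \<Longrightarrow> even (d * n) \<Longrightarrow> a \<in> vstates n d \<Longrightarrow> \<bar>Lgen n d nu (F n) a\<bar> \<le> B" and
     R: "\<And>n. 0 < n \<Longrightarrow> even (d * n) \<Longrightarrow> 
       occn n (\<lambda>a. \<bar>davg n d 1 (fst a) (snd a) - \<theta> * pavg n d (disc (snd a)) - Lgen n d nu (F n) a\<bar>) \<le> \<delta> + D / real n"
    unfolding \<theta>_def by (rule corrector_remainder[OF \<delta>]) blast
  have "(\<lambda>n. (8 * \<theta> * B * C * T / \<delta> + D) / real n) \<longlonglongrightarrow> 0" by (rule lim_const_over_n)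
  then have "eventually (\<lambda>n. (8 * \<theta> * B * C * T / \<delta> + D) / real n < \<delta>) sequentially"
    using \<delta> by (intro order_tendstoD(2))
  then obtain N where N: "\<And>n. n \<ge> N \<Longrightarrow> (8 * \<theta> * B * C * T / \<delta> + D) / real n < \<delta>"
    unfolding eventually_sequentially by blast
  have "norm (?f n - 0) < r" if "n \<ge> N" for n
  proof (cases "0 < n \<and> even (d * n)")
    case True
    then have n: "0 < n" "even (d * n)" by auto
    interpret V: voter n d nu u "M n" "X n" by (rule voter[OF n])
    have gam: "gamma_n d nu n = real n / (2 * \<theta>)" by (simp add: gamma_n_def \<theta>_def)
    have "?f n \<le> (\<delta> + 4 * B * C * T / (gamma_n d nu n * \<delta>) + 
        occn n (\<lambda>a. \<bar>davg n d 1 (fst a) (snd a) - \<theta> * pavg n d (disc (snd a)) - Lgen n d nu (F n) a\<bar>)) / (2 * \<theta> * \<epsilon>)"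
      unfolding gam using V.deviation_bound[OF n(1) d2 th T \<epsilon> \<delta> F(1)[OF n] C F(2)[OF n] B] True by simp
    also have "\<dots> \<le> (\<delta> + 4 * B * C * T / (gamma_n d nu n * \<delta>) + (\<delta> + D / real n)) / (2 * \<theta> * \<epsilon>)"
      using R[OF n] th \<epsilon> by (intro divide_right_mono add_left_mono) auto
    also have "4 * B * C * T / (gamma_n d nu n * \<delta>) = 8 * \<theta> * B * C * T / \<delta> / real n"
      using n th \<delta> by (simp add: gam field_simps)
    also have "(\<delta> + 8 * \<theta> * B * C * T / \<delta> / real n + (\<delta> + D / real n)) = 2 * \<delta> + (8 * \<theta> * B * C * T / \<delta> + D) / real n"
      by (simp add: add_divide_distrib)
    also have "\<dots> / (2 * \<theta> * \<epsilon>) < 3 * \<delta> / (2 * \<theta> * \<epsilon>)"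
      using N[OF that] th \<epsilon> by (intro divide_strict_right_mono) auto
    also have "\<dots> = r" using th \<epsilon> by (simp add: \<delta>_def)
    finally have "?f n < r" .
    moreover have "0 \<le> ?f n" by simp
    ultimately show ?thesis by (simp only: real_norm_def diff_zero abs_of_nonneg)
  qed (use r in auto)
  then show "\<exists>N. \<forall>n\<ge>N. norm (?f n - 0) < r" by blast
qed

end

theorem theorem2p11:
  fixes d :: nat and nu u T :: real
    and M :: "nat \<Rightarrow> 'w measure" and X :: "nat \<Rightarrow> real \<Rightarrow> 'w \<Rightarrow> vstate"
  assumes "3 \<le> d" and "0 < nu" and "0 < u" and "u < 1" and "0 < T"
    and "\<And>n. 0 < n \<Longrightarrow> even (d * n) \<Longrightarrow> is_voter_process n d nu u (M n) (X n)"
  shows "\<forall>\<epsilon>>0. (\<lambda>n. if 0 < n \<and> even (d * n) then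
            measure (M n) {\<omega> \<in> space (M n).
              \<epsilon> < \<bar>gamma_n d nu n / real n *
                      set_lebesgue_integral lborel {0..T} (\<lambda>s. D_obs n d (X n (gamma_n d nu n * s) \<omega>))
                   - set_lebesgue_integral lborel {0..T}
                      (\<lambda>s. O_obs n (X n (gamma_n d nu n * s) \<omega>) * (1 - O_obs n (X n (gamma_n d nu n * s) \<omega>)))\<bar>}
          else 0) \<longlonglongrightarrow> 0"
proof -
  interpret voter_family d nu u T M X
    using assms by unfold_locales auto
  show ?thesis using deviation_tendsto_0 by blast
qed

end
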